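(* Let $\Omega$ be a constant symplectic structure on $\mathbb{R}^{2n}$ and let $N\ge l\ge 1$ be integers. For polynomial functions $f_1,\dots,f_l$ on $\mathbb{R}^{2n}$ define, as a formal Gaussian integral over $N$ copies of $\mathbb{R}^{2n}$, $$\langle(f_1,\dots,f_l)\rangle=\frac1{Z[0]}\int d^{2n}x_1\cdots d^{2n}x_N\;\sum_{i_1=1}^N t_{i_1}f_1(x_{i_1})\cdots\sum_{i_l=1}^N t_{i_l}f_l(x_{i_l})\;e^{-S}\in\mathbb{R}[t_i,t_{ij}],\qquad S=\frac12\sum_{i,j=1}^N x_i^\mu t^{ij}x_j^\nu\,\Omega_{\mu\nu}.$$ Then: 1. $\langle(f_1,\dots,f_l)\rangle$ is (the polynomial representing) a graph chain with $l$ vertices, so that $(f_1,\dots,f_l)\mapsto\langle(f_1,\dots,f_l)\rangle$ gives a map from chains of $\mathrm{CE}_\bullet(\mathrm{Ham}^0(\mathbb{R}^{2n}))$ to graph chains $\Gamma_\bullet$; explicitly it is given by the recipe $$\langle(f_1,\dots,f_l)\rangle=\sum_{G}\frac{c_G(f_1,\dots,f_l)}{\#P(G)}\,P_G(t),$$ where the sum is over all unoriented loop-free multigraphs $G$ on the labelled vertex set $\{1,\dots,l\}$ (each equipped with an arbitrary choice of direction for its edges), and $\#P(G)$, $c_G$, $P_G$ are defined in the context. 2. On polynomials representing graph chains with $l$ vertices, the graph differential $\partial_{Gph}$ (edge contraction) is given by the operator $$\partial_{Gph}=-\frac1{2(N-l+1)}\sum_{\substack{k,p=1\\k\ne p}}^N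 R^p_k\,\frac{\partial}{\partial t_{kp}}\frac{\partial}{\partial t_p}.$$ 3. The map intertwines the differentials: $$\langle\partial(f_1,\dots,f_l)\rangle=\partial_{Gph}\langle(f_1,\dots,f_l)\rangle,$$ where $\partial$ is the Chevalley–Eilenberg differential.
   Context: **Formal variables.** $t_1,\dots,t_N$ are odd (mutually anticommuting) variables; $t_{ij}=-t_{ji}$ ($1\le i,j\le N$, so $t_{ii}=0$) are even (commuting) variables, and $(t^{ij})$ is formally the inverse matrix of $(t_{ij})$. Derivatives respect antisymmetry: the independent variables are $t_{ij}$ with $i<j$, and $\partial/\partial t_{ji}=-\partial/\partial t_{ij}$. $\partial/\partial t_p$ is the (left) odd derivation with $\partial t_q/\partial t_p=\delta_{pq}$. For $p\ne k$, $R^p_k$ is the algebra endomorphism renaming the index $p$ to $k$ in the variables $t_{ij}$: $t_{ij}\mapsto t_{ij}$ if $i,j\neq p$, $t_{pj}\mapsto t_{kj}$, $t_{jp}\mapsto t_{jk}$ (with $t_{kk}=0$); it leaves the $t_i$ unchanged. In the operator $\partial_{Gph}$ the derivatives act first, then $R^p_k$. **Formal Gaussian integral.** Greek indices run over $1,\dots,2n$ and repeated Greek indices are summed. The normalized formal integral ($Z[0]$ being the same integral without insertions) is defined by Wick's theorem with propagator $\langle x_i^\mu x_j^\nu\rangle=(\Omega^{-1})^{\mu\nu}t_{ij}$, i.e. $$\langle(f_1,\dots,f_l)\rangle=\sum_{i_1,\dots,i_l=1}^N t_{i_1}\cdots t_{i_l}\; f_1\!\left(\tfrac{\partial}{\partial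 J^{i_1}}\right)\cdots f_l\!\left(\tfrac{\partial}{\partial J^{i_l}}\right)\exp\!\Big(\tfrac12\sum_{i,j=1}^N J^i_\mu(\Omega^{-1})^{\mu\nu}t_{ij}J^j_\nu\Big)\Big|_{J=0},$$ where $J^i_\mu$ are commuting formal variables and $f(\partial/\partial J^i)$ means substituting $\partial/\partial J^i_\mu$ for $x^\mu$. **Chevalley–Eilenberg complex.** The Poisson bracket is $\{f,g\}=\partial_\mu f\,(\Omega^{-1})^{\mu\nu}\,\partial_\nu g$, and the Hamiltonian vector field of $f$ is $\mathbb{X}_f=(\partial_\mu f)(\Omega^{-1})^{\mu\nu}\partial_\nu$, so $[\mathbb{X}_f,\mathbb{X}_g]=\mathbb{X}_{\{f,g\}}$. $\mathrm{Ham}^0(\mathbb{R}^{2n})$ is the Lie algebra of the $\mathbb{X}_f$ with $f$ a polynomial having only quadratic and higher terms. The chain $\mathbb{X}_{f_1}\wedge\dots\wedge\mathbb{X}_{f_l}$ is abbreviated $(f_1,\dots,f_l)$, and $$\partial(f_1,\dots,f_l)=\sum_{i<j}(-1)^{i+j+1}(\{f_i,f_j\},f_1,\dots,\hat f_i,\dots,\hat f_j,\dots,f_l);$$ $\langle\cdot\rangle$ is extended linearly to sums of chains. **Graph complex.** Graphs are finite with multiple edges allowed. An orientation of a graph is an ordering of its vertices together with a direction of each edge; two orientations related by a vertex permutation $\sigma$ and $k$ edge reversals are equal if $(-1)^k\mathrm{sgn}(\sigma)=1$ and opposite otherwise. $\Gamma_l$ is the real vector space spanned by (isomorphism classes of)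 oriented graphs with $l$ vertices modulo $(\Gamma,\text{orientation})\sim(-\Gamma,\text{opposite orientation})$; in particular graphs with an edge joining a vertex to itself vanish. The graph differential $\partial_{Gph}:\Gamma_l\to\Gamma_{l-1}$ is the sum over all edges of the operation contracting that edge: if the edge is directed from vertex $i$ to vertex $j$ with $i<j$, its two end vertices are merged into a vertex numbered $i$ that inherits all other edges at $i$ and $j$, vertices numbered after $j$ have their number lowered by one, and the sign is $(-1)^j$; if the edge is directed from $j$ to $i$ there is an extra minus sign. **Graphs as polynomials.** For a graph $G$ with vertices numbered $1,\dots,l$ and directed edges, its class in $\Gamma_l$ is represented by $$P_G(t)=\sum_{i_1,\dots,i_l=1}^N t_{i_1}\cdots t_{i_l}\prod_{\text{edges }a\to b\text{ of }G}t_{i_ai_b}.$$ Graph chains are identified with linear combinations of such polynomials. **Coefficients.** For such $G$, $\#P(G)=\prod_{a<b}\pi_{ab}!$, where $\pi_{ab}$ is the number of edges between $a$ and $b$. The number $c_G(f_1,\dots,f_l)$ is obtained as follows: for each directed edge $a\to b$ differentiate $f_a$ by $\partial_\mu$ and $f_b$ by $\partial_\nu$ and contract with $(\Omega^{-1})^{\mu\nu}$; do this for all edges, multiply the resulting functions, and set $x=0$. The product $c_G\,P_G$ does not depend on the chosen edge directions. *)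

theory Defs
  imports
    "HOL-Analysis.Analysis"
    "HOL-Analysis.Finite_Function_Topology"
    "HOL-Library.Poly_Mapping"
    "HOL-Library.FSet"
    "HOL-Library.Multiset"
    "HOL-Combinatorics.Permutations"
begin

section \<open>Grassmann algebras\<close>

text \<open>
  The Grassmann algebra over a commutative ring \<open>'a\<close> on odd generators indexed by the natural
  numbers. The basis element belonging to a finite set \<open>A\<close> is the product of the generators with
  index in \<open>A\<close>, taken in increasing order.
\<close>

typedef (overloaded) 'a grassmann = "UNIV :: (nat fset \<Rightarrow>\<^sub>0 'a::zero) set"
  morphisms gcoeffs Grassmann ..

setup_lifting type_definition_grassmann

text \<open>The sign of the shuffle that sorts the concatenation of increasing enumerations of \<open>A\<close>, \<open>B\<close>.\<close>

definition shuffle_sign :: "nat fset \<Rightarrow> nat fset \<Rightarrow> 'a::ring_1" where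
  "shuffle_sign A B = (-1) ^ card {(a, b). a |\<in>| A \<and> b |\<in>| B \<and> b < a}"

definition gprod :: "(nat fset \<Rightarrow> 'a) \<Rightarrow> (nat fset \<Rightarrow> 'a) \<Rightarrow> nat fset \<Rightarrow> 'a::comm_ring_1" where
  "gprod f g C = (\<Sum>A | A |\<subseteq>| C. shuffle_sign A (C |-| A) * f A * g (C |-| A))"

lemma finite_fsubsets [simp]: "finite {A. A |\<subseteq>| (C :: nat fset)}"
proof -
  have "{A. A |\<subseteq>| C} = fset (fPow C)" by auto
  then show ?thesis by simp
qed

lemma finite_gprod:
  fixes f g :: "nat fset \<Rightarrow> 'a::comm_ring_1"
  assumes "finite {A. f A \<noteq> 0}" "finite {A. g A \<noteq> 0}"
  shows "finite {C. gprod f g C \<noteq> 0}"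
proof -
  have "{C. gprod f g C \<noteq> 0} \<subseteq> (\<lambda>(A, B). A |\<union>| B) ` ({A. f A \<noteq> 0} \<times> {A. g A \<noteq> 0})"
  proof
    fix C assume "C \<in> {C. gprod f g C \<noteq> 0}"
    then obtain A where A: "A |\<subseteq>| C" "shuffle_sign A (C |-| A) * f A * g (C |-| A) \<noteq> 0"
      unfolding gprod_def by (metis (mono_tags, lifting) mem_Collect_eq sum.not_neutral_contains_not_neutral)
    have "C = A |\<union>| (C |-| A)" using A(1) by auto
    moreover have "f A \<noteq> 0" "g (C |-| A) \<noteq> 0" using A(2) by auto
    ultimately show "C \<in> (\<lambda>(A, B). A |\<union>| B) ` ({A. f A \<noteq> 0} \<times> {A. g A \<noteq> 0})"
      by (intro image_eqI[of _ _ "(A, C |-| A)"]) simp_all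
  qed
  then show ?thesis using assms by (meson finite_SigmaI finite_imageI finite_subset)
qed

lemma shuffle_sign_assoc:
  assumes "A |\<inter>| B = {||}" "A |\<inter>| C = {||}" "B |\<inter>| C = {||}"
  shows "shuffle_sign A B * shuffle_sign (A |\<union>| B) C
    = (shuffle_sign A (B |\<union>| C) * shuffle_sign B C :: 'a::ring_1)"
proof -
  let ?i = "\<lambda>A B. {(a, b). a |\<in>| A \<and> b |\<in>| B \<and> b < (a::nat)}"
  have fin: "finite (?i A B)" for A B
    by (rule finite_subset[of _ "fset A \<times> fset B"]) auto
  have d: "\<And>x. x |\<in>| A \<Longrightarrow> x |\<notin>| B" "\<And>x. x |\<in>| A \<Longrightarrow> x |\<notin>| C" "\<And>x. x |\<in>| B \<Longrightarrow> x |\<notin>| C"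
    using assms by (auto simp: fset_eq_iff)
  have "card (?i (A |\<union>| B) C) = card (?i A C \<union> ?i B C)" by (rule arg_cong[where f = card]) auto
  also have "\<dots> = card (?i A C) + card (?i B C)"
    by (rule card_Un_disjoint[OF fin fin]) (use d in auto)
  finally have 1: "card (?i (A |\<union>| B) C) = card (?i A C) + card (?i B C)" .
  have "card (?i A (B |\<union>| C)) = card (?i A B \<union> ?i A C)" by (rule arg_cong[where f = card]) auto
  also have "\<dots> = card (?i A B) + card (?i A C)"
    by (rule card_Un_disjoint[OF fin fin]) (use d in auto)
  finally have 2: "card (?i A (B |\<union>| C)) = card (?i A B) + card (?i A C)" .
  show ?thesis unfolding shuffle_sign_def 1 2 by (simp add: power_add mult.assoc)
qed

lemma shuffle_sign_empty [simp]: "shuffle_sign {||} B = 1" "shuffle_sign A {||} = 1"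
  by (simp_all add: shuffle_sign_def)

lemma gprod_assoc: "gprod (gprod f g) h D = gprod f (gprod g h) D"
proof -
  have "gprod (gprod f g) h D = (\<Sum>C | C |\<subseteq>| D. \<Sum>A | A |\<subseteq>| C.
      shuffle_sign C (D |-| C) * (shuffle_sign A (C |-| A) * f A * g (C |-| A)) * h (D |-| C))"
    unfolding gprod_def by (simp add: sum_distrib_left sum_distrib_right)
  also have "\<dots> = (\<Sum>(C, A) \<in> Sigma {C. C |\<subseteq>| D} (\<lambda>C. {A. A |\<subseteq>| C}).
      shuffle_sign C (D |-| C) * (shuffle_sign A (C |-| A) * f A * g (C |-| A)) * h (D |-| C))"
    by (rule sum.Sigma) auto
  also have "\<dots> = (\<Sum>(A, B) \<in> Sigma {A. A |\<subseteq>| D} (\<lambda>A. {B. B |\<subseteq>| D |-| A}).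
      shuffle_sign A (D |-| A) * f A * (shuffle_sign B (D |-| A |-| B) * g B * h (D |-| A |-| B)))"
  proof (rule sum.reindex_bij_witness[where i = "\<lambda>(A, B). (A |\<union>| B, A)" and j = "\<lambda>(C, A). (A, C |-| A)"],
      goal_cases)
    case (5 x)
    then obtain C A where x: "x = (C, A)" and C: "C |\<subseteq>| D" and A: "A |\<subseteq>| C" by auto
    have e: "A |\<union>| (C |-| A) = C" "(C |-| A) |\<union>| (D |-| C) = D |-| A" "D |-| A |-| (C |-| A) = D |-| C"
      using C A by auto
    have "shuffle_sign A (C |-| A) * shuffle_sign (A |\<union>| (C |-| A)) (D |-| C)
      = (shuffle_sign A ((C |-| A) |\<union>| (D |-| C)) * shuffle_sign (C |-| A) (D |-| C) :: 'a)"
      using C A by (intro shuffle_sign_assoc) auto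
    then have s: "shuffle_sign A (C |-| A) * shuffle_sign C (D |-| C)
      = (shuffle_sign A (D |-| A) * shuffle_sign (C |-| A) (D |-| C) :: 'a)"
      unfolding e .
    have "shuffle_sign C (D |-| C) * (shuffle_sign A (C |-| A) * f A * g (C |-| A)) * h (D |-| C)
      = (shuffle_sign A (C |-| A) * shuffle_sign C (D |-| C)) * (f A * g (C |-| A) * h (D |-| C))"
      by (simp add: algebra_simps)
    then show ?case unfolding s x by (simp add: e algebra_simps)
  qed auto
  also have "\<dots> = (\<Sum>A | A |\<subseteq>| D. \<Sum>B | B |\<subseteq>| D |-| A.
      shuffle_sign A (D |-| A) * f A * (shuffle_sign B (D |-| A |-| B) * g B * h (D |-| A |-| B)))"
    by (rule sum.Sigma[symmetric]) auto
  also have "\<dots> = gprod f (gprod g h) D"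
    unfolding gprod_def by (simp add: sum_distrib_left)
  finally show ?thesis .
qed

instantiation grassmann :: (comm_ring_1) ring_1
begin

lift_definition zero_grassmann :: "'a grassmann" is 0 .
lift_definition plus_grassmann :: "'a grassmann \<Rightarrow> 'a grassmann \<Rightarrow> 'a grassmann" is "(+)" .
lift_definition minus_grassmann :: "'a grassmann \<Rightarrow> 'a grassmann \<Rightarrow> 'a grassmann" is "(-)" .
lift_definition uminus_grassmann :: "'a grassmann \<Rightarrow> 'a grassmann" is uminus .
lift_definition one_grassmann :: "'a grassmann" is "Poly_Mapping.single {||} 1" .
lift_definition times_grassmann :: "'a grassmann \<Rightarrow> 'a grassmann \<Rightarrow> 'a grassmann"
  is "\<lambda>f g. Abs_poly_mapping (gprod (Poly_Mapping.lookup f) (Poly_Mapping.lookup g))" .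

lemma lookup_times_grassmann:
  "Poly_Mapping.lookup (gcoeffs (F * G)) = gprod (Poly_Mapping.lookup (gcoeffs F)) (Poly_Mapping.lookup (gcoeffs G))"
  by (simp add: times_grassmann.rep_eq finite_gprod)

lemma grassmann_eqI:
  "(\<And>A. Poly_Mapping.lookup (gcoeffs F) A = Poly_Mapping.lookup (gcoeffs G) A) \<Longrightarrow> F = G"
  by (metis gcoeffs_inject poly_mapping_eqI)

instance
proof
  fix a b c :: "'a grassmann"
  show "a + b + c = a + (b + c)" by transfer (simp add: add.assoc)
  show "a + b = b + a" by transfer (simp add: add.commute)
  show "0 + a = a" by transfer simp
  show "- a + a = 0" by transfer simp
  show "a - b = a + - b" by transfer simp
  show "(0::'a grassmann) \<noteq> 1" by transfer (metis lookup_single_eq lookup_zero zero_neq_one)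
  show "a * b * c = a * (b * c)"
    by (rule grassmann_eqI) (simp only: lookup_times_grassmann gprod_assoc)
  show "(a + b) * c = a * c + b * c"
    by (rule grassmann_eqI)
      (simp add: lookup_times_grassmann plus_grassmann.rep_eq lookup_add gprod_def algebra_simps sum.distrib)
  show "a * (b + c) = a * b + a * c"
    by (rule grassmann_eqI)
      (simp add: lookup_times_grassmann plus_grassmann.rep_eq lookup_add gprod_def algebra_simps sum.distrib)
  show "1 * a = a"
  proof (rule grassmann_eqI)
    fix C
    have "gprod (Poly_Mapping.lookup (gcoeffs 1)) (Poly_Mapping.lookup (gcoeffs a)) C
      = (\<Sum>A | A |\<subseteq>| C. if A = {||} then Poly_Mapping.lookup (gcoeffs a) C else 0)"
      unfolding gprod_def one_grassmann.rep_eq lookup_single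
      by (rule sum.cong) (auto simp: when_def)
    then show "Poly_Mapping.lookup (gcoeffs (1 * a)) C = Poly_Mapping.lookup (gcoeffs a) C"
      by (simp add: lookup_times_grassmann)
  qed
  show "a * 1 = a"
  proof (rule grassmann_eqI)
    fix C
    have "gprod (Poly_Mapping.lookup (gcoeffs a)) (Poly_Mapping.lookup (gcoeffs 1)) C
      = (\<Sum>A | A |\<subseteq>| C. if A = C then Poly_Mapping.lookup (gcoeffs a) C else 0)"
      unfolding gprod_def one_grassmann.rep_eq lookup_single
      by (rule sum.cong) (auto simp: when_def)
    then show "Poly_Mapping.lookup (gcoeffs (a * 1)) C = Poly_Mapping.lookup (gcoeffs a) C"
      by (simp add: lookup_times_grassmann)
  qed
qed

end

instantiation grassmann :: ("{comm_ring_1, real_vector}") real_vector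
begin

definition scaleR_grassmann :: "real \<Rightarrow> 'a grassmann \<Rightarrow> 'a grassmann" where
  "scaleR_grassmann r F = Grassmann (r *\<^sub>R gcoeffs F)"

instance
  by standard (simp_all add: scaleR_grassmann_def plus_grassmann_def Grassmann_inverse gcoeffs_inverse
      scaleR_add_right scaleR_add_left)

end

lift_definition odd_gen :: "nat \<Rightarrow> 'a::comm_ring_1 grassmann"
  is "\<lambda>i. Poly_Mapping.single {|i|} 1" .

lift_definition even_part :: "'a \<Rightarrow> 'a::comm_ring_1 grassmann"
  is "\<lambda>c. Poly_Mapping.single {||} c" .

text \<open>Left derivative with respect to the \<open>p\<close>-th odd generator, which is moved to the front first.\<close>

lift_definition odd_deriv :: "nat \<Rightarrow> 'a grassmann \<Rightarrow> 'a::comm_ring_1 grassmann"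
  is "\<lambda>p F. \<Sum>A\<in>{A \<in> Poly_Mapping.keys F. p |\<in>| A}.
    Poly_Mapping.single (A |-| {|p|}) ((-1) ^ card {a. a |\<in>| A \<and> a < p} * Poly_Mapping.lookup F A)" .

text \<open>The coefficientwise extension of an additive map that fixes the odd generators.\<close>

lift_definition map_coeffs :: "('a \<Rightarrow> 'a) \<Rightarrow> 'a grassmann \<Rightarrow> 'a::comm_ring_1 grassmann"
  is "Poly_Mapping.map" .

lemma shuffle_sign_singleton: "shuffle_sign {|q|} B = (-1) ^ card {b. b |\<in>| B \<and> b < q}"
proof -
  have "{(a, b). a |\<in>| {|q|} \<and> b |\<in>| B \<and> b < a} = Pair q ` {b. b |\<in>| B \<and> b < q}" by auto
  then show ?thesis by (simp add: shuffle_sign_def card_image inj_on_def)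
qed

lemma lookup_odd_gen_mult:
  "Poly_Mapping.lookup (gcoeffs (odd_gen q * F)) C =
    (if q |\<in>| C then (-1) ^ card {b. b |\<in>| C \<and> b < q} * Poly_Mapping.lookup (gcoeffs F) (C |-| {|q|}) else 0)"
proof -
  have "Poly_Mapping.lookup (gcoeffs (odd_gen q * F)) C =
    (\<Sum>A | A |\<subseteq>| C. if A = {|q|} then shuffle_sign {|q|} (C |-| {|q|}) * Poly_Mapping.lookup (gcoeffs F) (C |-| {|q|}) else 0)"
    unfolding lookup_times_grassmann gprod_def odd_gen.rep_eq lookup_single
    by (rule sum.cong) (auto simp: when_def)
  also have "\<dots> = (if q |\<in>| C then shuffle_sign {|q|} (C |-| {|q|}) * Poly_Mapping.lookup (gcoeffs F) (C |-| {|q|}) else 0)"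
    by simp
  also have "shuffle_sign {|q|} (C |-| {|q|}) = ((-1) ^ card {b. b |\<in>| C \<and> b < q} :: 'a)"
    unfolding shuffle_sign_singleton by (rule arg_cong[where f = "\<lambda>X. (-1) ^ card X"]) auto
  finally show ?thesis .
qed

lemma lookup_odd_deriv:
  "Poly_Mapping.lookup (gcoeffs (odd_deriv p F)) A =
    (if p |\<in>| A then 0 else (-1) ^ card {a. a |\<in>| A \<and> a < p} * Poly_Mapping.lookup (gcoeffs F) (finsert p A))"
proof -
  let ?f = "Poly_Mapping.lookup (gcoeffs F)"
  let ?K = "{B \<in> Poly_Mapping.keys (gcoeffs F). p |\<in>| B}"
  have fin: "finite ?K" by simp
  have "Poly_Mapping.lookup (gcoeffs (odd_deriv p F)) A =
    (\<Sum>B\<in>?K. if B |-| {|p|} = A then (-1) ^ card {a. a |\<in>| B \<and> a < p} * ?f B else 0)"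
    unfolding odd_deriv.rep_eq lookup_sum lookup_single by (simp add: when_def)
  also have "\<dots> = (\<Sum>B\<in>?K. if B = finsert p A then
      (if p |\<in>| A then 0 else (-1) ^ card {a. a |\<in>| A \<and> a < p} * ?f B) else 0)"
  proof (rule sum.cong[OF refl])
    fix B assume "B \<in> ?K"
    then have B: "p |\<in>| B" by simp
    show "(if B |-| {|p|} = A then (-1) ^ card {a. a |\<in>| B \<and> a < p} * ?f B else 0) =
      (if B = finsert p A then (if p |\<in>| A then 0 else (-1) ^ card {a. a |\<in>| A \<and> a < p} * ?f B) else 0)"
    proof (cases "B |-| {|p|} = A")
      case True
      then have 1: "B = finsert p A" "p |\<notin>| A" using B by auto
      have "{a. a |\<in>| B \<and> a < p} = {a. a |\<in>| A \<and> a < p}" unfolding 1(1) by auto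
      then show ?thesis using True 1 by simp
    next
      case False
      then have "B = finsert p A \<Longrightarrow> p |\<in>| A" by auto
      then show ?thesis using False by auto
    qed
  qed
  also have "\<dots> = (if p |\<in>| A then 0 else (-1) ^ card {a. a |\<in>| A \<and> a < p} * ?f (finsert p A))"
    by (simp add: sum.delta[OF fin] in_keys_iff)
  finally show ?thesis .
qed

lemma card_less_finsert:
  assumes "q |\<notin>| A"
  shows "card {b. b |\<in>| finsert q A \<and> b < p} = card {b. b |\<in>| A \<and> b < (p::nat)} + (if q < p then 1 else 0)"
proof -
  have "{b. b |\<in>| finsert q A \<and> b < p} =
    (if q < p then insert q {b. b |\<in>| A \<and> b < p} else {b. b |\<in>| A \<and> b < p})" by auto
  then show ?thesis using assms by simp
qed

lemma odd_deriv_odd_gen_mult: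
  "odd_deriv p (odd_gen q * F) = (if p = q then F else 0) - odd_gen q * odd_deriv p F"
proof (rule grassmann_eqI)
  fix A
  note lk = minus_grassmann.rep_eq uminus_grassmann.rep_eq zero_grassmann.rep_eq lookup_minus lookup_odd_gen_mult lookup_odd_deriv
  show "Poly_Mapping.lookup (gcoeffs (odd_deriv p (odd_gen q * F))) A =
    Poly_Mapping.lookup (gcoeffs ((if p = q then F else 0) - odd_gen q * odd_deriv p F)) A"
  proof (cases "p = q")
    case True
    have e: "{b. (b = q \<or> b |\<in>| A) \<and> b < q} = {b. b |\<in>| A \<and> b < q}" by auto
    show ?thesis
    proof (cases "q |\<in>| A")
      case False
      then have "A |-| {|q|} = A" by auto
      then show ?thesis using True False by (simp add: lk e fminus_finsert_absorb flip: mult.assoc power_add)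
    next
      case qA: True
      have "finsert q (A |-| {|q|}) = A" using qA by auto
      moreover have "{a. a |\<in>| A \<and> a \<noteq> q \<and> a < q} = {a. a |\<in>| A \<and> a < q}" by auto
      ultimately show ?thesis using True qA by (simp add: lk flip: mult.assoc power_add)
    qed
  next
    case pq: False
    show ?thesis
    proof (cases "p |\<notin>| A \<and> q |\<in>| A")
      case True
      define B where "B = A |-| {|q|}"
      have A: "A = finsert q B" "q |\<notin>| B" and pB: "p |\<notin>| B" using True by (auto simp: B_def)
      have e: "finsert p A |-| {|q|} = finsert p B" "A |-| {|q|} = B" using A pq by auto
      have c: "card {b. b |\<in>| finsert p A \<and> b < q} = card {b. b |\<in>| A \<and> b < q} + (if p < q then 1 else 0)"
        "card {b. b |\<in>| A \<and> b < p} = card {b. b |\<in>| B \<and> b < p} + (if q < p then 1 else 0)"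
        using True card_less_finsert[of p A q] card_less_finsert[of q B p] A by simp_all
      show ?thesis using True pq pB
        by (simp only: lk e c) (auto simp: zero_grassmann.rep_eq power_add algebra_simps)
    next
      case False
      then show ?thesis using pq by (auto simp: lk)
    qed
  qed
qed

lemma odd_gen_mult_odd_gen: "odd_gen i * odd_gen j = - (odd_gen j * odd_gen i)"
  if "i \<noteq> j"
proof (rule grassmann_eqI)
  fix A
  have "Poly_Mapping.lookup (gcoeffs (odd_gen i * odd_gen j :: 'a grassmann)) A =
    (if A = {|i, j|} then if i < j then 1 else -1 else 0)" if "i \<noteq> j" for i j
  proof -
    have "A |-| {|i|} = {|j|} \<and> i |\<in>| A \<longleftrightarrow> A = {|i, j|}" using that by auto
    moreover have "{b. (b = i \<or> b = j) \<and> b < i} = (if i < j then {} else {j})" using that by auto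
    ultimately show ?thesis
      by (auto simp: lookup_odd_gen_mult odd_gen.rep_eq lookup_single when_def)
  qed
  from this[of i j] this[of j i] that
  show "Poly_Mapping.lookup (gcoeffs (odd_gen i * odd_gen j :: 'a grassmann)) A =
    Poly_Mapping.lookup (gcoeffs (- (odd_gen j * odd_gen i :: 'a grassmann))) A"
    by (auto simp: uminus_grassmann.rep_eq)
qed

lemma odd_gen_square: "odd_gen i * odd_gen i = 0"
  by (rule grassmann_eqI)
    (auto simp: lookup_odd_gen_mult odd_gen.rep_eq zero_grassmann.rep_eq lookup_single when_def fset_eq_iff)

section \<open>Polynomials and formal power series in several commuting variables\<close>

type_synonym ('x, 'a) mpoly = "('x \<Rightarrow>\<^sub>0 nat) \<Rightarrow>\<^sub>0 'a"

definition mvar :: "'x \<Rightarrow> ('x, 'a::comm_ring_1) mpoly" where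
  "mvar x = Poly_Mapping.single (Poly_Mapping.single x 1) 1"

definition mconst :: "'a \<Rightarrow> ('x, 'a::comm_ring_1) mpoly" where
  "mconst c = Poly_Mapping.single 0 c"

definition mpderiv :: "'x \<Rightarrow> ('x, 'a) mpoly \<Rightarrow> ('x, 'a::comm_ring_1) mpoly" where
  "mpderiv x p = (\<Sum>m\<in>Poly_Mapping.keys p.
     Poly_Mapping.single (m - Poly_Mapping.single x 1)
       (of_nat (Poly_Mapping.lookup m x) * Poly_Mapping.lookup p m))"

definition msubst :: "('x \<Rightarrow> ('y, 'a) mpoly) \<Rightarrow> ('x, 'a) mpoly \<Rightarrow> ('y, 'a::comm_ring_1) mpoly" where
  "msubst \<phi> p = (\<Sum>m\<in>Poly_Mapping.keys p.
     mconst (Poly_Mapping.lookup p m) * (\<Prod>x\<in>Poly_Mapping.keys m. \<phi> x ^ Poly_Mapping.lookup m x))"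

definition mon_degree :: "('x \<Rightarrow>\<^sub>0 nat) \<Rightarrow> nat" where
  "mon_degree m = (\<Sum>x\<in>Poly_Mapping.keys m. Poly_Mapping.lookup m x)"

definition lin_ext :: "('x \<Rightarrow> 'v) \<Rightarrow> ('x \<Rightarrow>\<^sub>0 real) \<Rightarrow> 'v::real_vector" where
  "lin_ext \<phi> c = (\<Sum>x\<in>Poly_Mapping.keys c. Poly_Mapping.lookup c x *\<^sub>R \<phi> x)"

text \<open>Formal power series are represented by their coefficient functions.\<close>

type_synonym ('x, 'a) mseries = "('x \<Rightarrow>\<^sub>0 nat) \<Rightarrow> 'a"

text \<open>
  The exponential of a polynomial without constant term: \<open>Q ^ k\<close> contributes only to monomials
  of degree at least \<open>k\<close>.
\<close>

definition series_exp :: "('x, 'a) mpoly \<Rightarrow> ('x, 'a::{comm_ring_1, real_vector}) mseries" where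
  "series_exp Q = (\<lambda>m. \<Sum>k\<le>mon_degree m. (1 / fact k) *\<^sub>R Poly_Mapping.lookup (Q ^ k) m)"

text \<open>
  The multi-index derivative \<open>\<partial>\<^sup>\<alpha>\<close>: the coefficient of \<open>\<partial>\<^sup>\<alpha> F\<close> at \<open>\<beta>\<close> is
  \<open>(\<alpha> + \<beta>)! / \<beta>!\<close> times the coefficient of \<open>F\<close> at \<open>\<alpha> + \<beta>\<close>.
\<close>

definition series_deriv :: "('x \<Rightarrow>\<^sub>0 nat) \<Rightarrow> ('x, 'a) mseries \<Rightarrow> ('x, 'a::comm_ring_1) mseries" where
  "series_deriv \<alpha> F = (\<lambda>\<beta>.
     of_nat (\<Prod>x\<in>Poly_Mapping.keys \<alpha>. pochhammer (Suc (Poly_Mapping.lookup \<beta> x)) (Poly_Mapping.lookup \<alpha> x))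
       * F (\<alpha> + \<beta>))"


section \<open>The algebra generated by the odd and even variables\<close>

text \<open>
  The independent even variables are those indexed by pairs \<open>(i, j)\<close> with \<open>i < j\<close>;
  indices of other pairs never occur in the polynomials below.
\<close>

type_synonym even_poly = "(nat \<times> nat, real) mpoly"
type_synonym superpoly = "even_poly grassmann"

definition t_odd :: "nat \<Rightarrow> superpoly" where
  "t_odd i = odd_gen i"

definition t_even :: "nat \<Rightarrow> nat \<Rightarrow> even_poly" where
  "t_even i j = (if i < j then mvar (i, j) else if j < i then - mvar (j, i) else 0)"

definition t_even_deriv :: "nat \<Rightarrow> nat \<Rightarrow> even_poly \<Rightarrow> even_poly" where
  "t_even_deriv i j q =
    (if i < j then mpderiv (i, j) q else if j < i then - mpderiv (j, i) q else 0)"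

text \<open>The endomorphism that renames the index \<open>p\<close> to \<open>k\<close> in the even variables.\<close>

definition rename_index :: "nat \<Rightarrow> nat \<Rightarrow> even_poly \<Rightarrow> even_poly" where
  "rename_index p k =
    msubst (\<lambda>(i, j). t_even (if i = p then k else i) (if j = p then k else j))"

definition graph_diff_op :: "nat \<Rightarrow> nat \<Rightarrow> superpoly \<Rightarrow> superpoly" where
  "graph_diff_op N l F = - (1 / (2 * (real N - real l + 1))) *\<^sub>R
    (\<Sum>k\<in>{1..N}. \<Sum>p\<in>{1..N} - {k}.
      map_coeffs (rename_index p k) (map_coeffs (t_even_deriv k p) (odd_deriv p F)))"

definition index_lists :: "nat \<Rightarrow> nat \<Rightarrow> nat list set" where
  "index_lists N l = {ix. length ix = l \<and> set ix \<subseteq> {1..N}}"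


section \<open>Hamiltonian vector fields and the Chevalley--Eilenberg complex\<close>

text \<open>Polynomial functions on a vector space with coordinates indexed by \<open>'m\<close>.\<close>

type_synonym 'm fun_poly = "('m, real) mpoly"

definition symplectic_form :: "real^'m^'m \<Rightarrow> bool" where
  "symplectic_form \<Omega> \<longleftrightarrow> transpose \<Omega> = - \<Omega> \<and> invertible \<Omega>"

definition poisson :: "real^'m^'m \<Rightarrow> 'm::finite fun_poly \<Rightarrow> 'm fun_poly \<Rightarrow> 'm fun_poly" where
  "poisson \<Omega> f g = (\<Sum>\<mu>\<in>UNIV. \<Sum>\<nu>\<in>UNIV. (matrix_inv \<Omega> $ \<mu> $ \<nu>) *\<^sub>R (mpderiv \<mu> f * mpderiv \<nu> g))"

text \<open>A polynomial vector field is given by its components.\<close>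

definition ham_field :: "real^'m^'m \<Rightarrow> 'm::finite fun_poly \<Rightarrow> 'm fun_poly ^ 'm" where
  "ham_field \<Omega> f = (\<chi> \<nu>. \<Sum>\<mu>\<in>UNIV. (matrix_inv \<Omega> $ \<mu> $ \<nu>) *\<^sub>R mpderiv \<mu> f)"

text \<open>The Hamiltonians of the elements of the Lie algebra: no constant and no linear terms.\<close>

definition ham0 :: "'m fun_poly set" where
  "ham0 = {f. \<forall>m\<in>Poly_Mapping.keys f. 2 \<le> mon_degree m}"

text \<open>
  The list \<open>[f\<^sub>1, \<dots>, f\<^sub>l]\<close> stands for the wedge product of the Hamiltonian vector fields of its
  entries. Chains are represented by formal linear combinations of such lists, which are
  identified by multilinearity and the alternating property of the wedge product.
\<close>

definition ce_chains :: "nat \<Rightarrow> ('m fun_poly list \<Rightarrow>\<^sub>0 real) set" where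
  "ce_chains l = {c. \<forall>fs\<in>Poly_Mapping.keys c. length fs = l \<and> set fs \<subseteq> ham0}"

definition ce_relations :: "real^'m^'m \<Rightarrow> nat \<Rightarrow> ('m::finite fun_poly list \<Rightarrow>\<^sub>0 real) set" where
  "ce_relations \<Omega> l =
    {Poly_Mapping.single (fs[i := h]) 1 - a *\<^sub>R Poly_Mapping.single (fs[i := f]) 1
        - b *\<^sub>R Poly_Mapping.single (fs[i := g]) 1 | fs i f g h a b.
      length fs = l \<and> set fs \<subseteq> ham0 \<and> i < l \<and> f \<in> ham0 \<and> g \<in> ham0 \<and> h \<in> ham0 \<and>
      ham_field \<Omega> h = a *\<^sub>R ham_field \<Omega> f + b *\<^sub>R ham_field \<Omega> g} \<union>
    {Poly_Mapping.single fs 1 | fs.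
      length fs = l \<and> set fs \<subseteq> ham0 \<and>
      (\<exists>i j. i < j \<and> j < l \<and> ham_field \<Omega> (fs ! i) = ham_field \<Omega> (fs ! j))}"

definition ce_equiv ::
  "real^'m^'m \<Rightarrow> nat \<Rightarrow> ('m::finite fun_poly list \<Rightarrow>\<^sub>0 real) \<Rightarrow> ('m fun_poly list \<Rightarrow>\<^sub>0 real) \<Rightarrow> bool" where
  "ce_equiv \<Omega> l c c' \<longleftrightarrow> c - c' \<in> span (ce_relations \<Omega> l)"

text \<open>List positions start at 0, so \<open>f\<^sub>i\<close> is the entry at \<open>i - 1\<close>; \<open>nths\<close> drops \<open>f\<^sub>i\<close> and \<open>f\<^sub>j\<close>.\<close>

definition ce_diff_list ::
  "real^'m^'m \<Rightarrow> 'm::finite fun_poly list \<Rightarrow> ('m fun_poly list \<Rightarrow>\<^sub>0 real)" where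
  "ce_diff_list \<Omega> fs = (\<Sum>j\<in>{1..length fs}. \<Sum>i\<in>{1..<j}.
     (-1) ^ (i + j + 1) *\<^sub>R
       Poly_Mapping.single (poisson \<Omega> (fs ! (i - 1)) (fs ! (j - 1)) # nths fs (- {i - 1, j - 1})) 1)"

definition ce_diff ::
  "real^'m^'m \<Rightarrow> ('m::finite fun_poly list \<Rightarrow>\<^sub>0 real) \<Rightarrow> ('m fun_poly list \<Rightarrow>\<^sub>0 real)" where
  "ce_diff \<Omega> = lin_ext (ce_diff_list \<Omega>)"


section \<open>The formal Gaussian integral\<close>

text \<open>Half the quadratic form in the sources; the pair \<open>(i, \<mu>)\<close> indexes the source \<open>J\<^sup>i\<^sub>\<mu>\<close>.\<close>

definition source_form :: "real^'m^'m \<Rightarrow> nat \<Rightarrow> (nat \<times> 'm::finite, even_poly) mpoly" where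
  "source_form \<Omega> N = (1 / 2) *\<^sub>R (\<Sum>i\<in>{1..N}. \<Sum>j\<in>{1..N}. \<Sum>\<mu>\<in>UNIV. \<Sum>\<nu>\<in>UNIV.
     mvar (i, \<mu>) * mconst ((matrix_inv \<Omega> $ \<mu> $ \<nu>) *\<^sub>R t_even i j) * mvar (j, \<nu>))"

text \<open>The differential operator \<open>f (\<partial> / \<partial>J\<^sup>i)\<close>.\<close>

definition source_op ::
  "nat \<Rightarrow> 'm::finite fun_poly \<Rightarrow> (nat \<times> 'm, even_poly) mseries \<Rightarrow> (nat \<times> 'm, even_poly) mseries" where
  "source_op i f F = (\<lambda>\<beta>. \<Sum>m\<in>Poly_Mapping.keys f. Poly_Mapping.lookup f m *\<^sub>R
     series_deriv (\<Sum>\<mu>\<in>UNIV. Poly_Mapping.single (i, \<mu>) (Poly_Mapping.lookup m \<mu>)) F \<beta>)"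

definition correlator :: "real^'m^'m \<Rightarrow> nat \<Rightarrow> 'm::finite fun_poly list \<Rightarrow> superpoly" where
  "correlator \<Omega> N fs = (\<Sum>ix\<in>index_lists N (length fs).
     prod_list (map t_odd ix) *
     even_part (foldr (\<lambda>(i, f). source_op i f) (zip ix fs) (series_exp (source_form \<Omega> N)) 0))"

definition chain_correlator ::
  "real^'m^'m \<Rightarrow> nat \<Rightarrow> ('m::finite fun_poly list \<Rightarrow>\<^sub>0 real) \<Rightarrow> superpoly" where
  "chain_correlator \<Omega> N = lin_ext (correlator \<Omega> N)"


section \<open>The graph complex\<close>

text \<open>
  An oriented graph with vertices numbered \<open>1, \<dots>, l\<close> is given by the list of its directed edges.
  The order of the list is only a naming of the edges: by the relations below it is immaterial.
\<close>

type_synonym digraph = "(nat \<times> nat) list"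

definition graph_chains :: "nat \<Rightarrow> (digraph \<Rightarrow>\<^sub>0 real) set" where
  "graph_chains l = {\<gamma>. \<forall>es\<in>Poly_Mapping.keys \<gamma>. set es \<subseteq> {1..l} \<times> {1..l}}"

text \<open>
  Renumber the vertices by the permutation \<open>\<sigma>\<close> and reverse the edges at the positions in \<open>K\<close>.
  Reversing a loop shows that a graph with a loop is equivalent to 0.
\<close>

definition reorient :: "(nat \<Rightarrow> nat) \<Rightarrow> nat set \<Rightarrow> digraph \<Rightarrow> digraph" where
  "reorient \<sigma> K es = map (\<lambda>q. let (a, b) = es ! q in if q \<in> K then (\<sigma> b, \<sigma> a) else (\<sigma> a, \<sigma> b))
     [0..<length es]"

definition graph_relations :: "nat \<Rightarrow> (digraph \<Rightarrow>\<^sub>0 real) set" where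
  "graph_relations l =
    {Poly_Mapping.single es' 1 - ((-1) ^ card K * real_of_int (sign \<sigma>)) *\<^sub>R Poly_Mapping.single es 1
      | es es' \<sigma> K. set es \<subseteq> {1..l} \<times> {1..l} \<and> \<sigma> permutes {1..l} \<and> K \<subseteq> {..<length es} \<and>
        mset es' = mset (reorient \<sigma> K es)}"

definition graph_equiv :: "nat \<Rightarrow> (digraph \<Rightarrow>\<^sub>0 real) \<Rightarrow> (digraph \<Rightarrow>\<^sub>0 real) \<Rightarrow> bool" where
  "graph_equiv l \<gamma> \<gamma>' \<longleftrightarrow> \<gamma> - \<gamma>' \<in> span (graph_relations l)"

text \<open>Contraction of the edge at position \<open>q\<close>; a loop belongs to a vanishing graph and gives 0.\<close>

definition contract_edge :: "digraph \<Rightarrow> nat \<Rightarrow> (digraph \<Rightarrow>\<^sub>0 real)" where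
  "contract_edge es q = (let (a, b) = es ! q; i = min a b; j = max a b;
       \<rho> = (\<lambda>v. if v = j then i else if j < v then v - 1 else v)
     in if a = b then 0
        else ((-1) ^ j * (if a < b then 1 else -1)) *\<^sub>R
          Poly_Mapping.single (map (map_prod \<rho> \<rho>) (take q es @ drop (Suc q) es)) 1)"

definition graph_diff :: "(digraph \<Rightarrow>\<^sub>0 real) \<Rightarrow> (digraph \<Rightarrow>\<^sub>0 real)" where
  "graph_diff = lin_ext (\<lambda>es. \<Sum>q<length es. contract_edge es q)"

text \<open>The vertex \<open>a\<close> carries the index \<open>ix ! (a - 1)\<close>.\<close>

definition digraph_poly :: "nat \<Rightarrow> nat \<Rightarrow> digraph \<Rightarrow> superpoly" where
  "digraph_poly N l es = (\<Sum>ix\<in>index_lists N l.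
     prod_list (map t_odd ix) *
     even_part (\<Prod>(a, b)\<leftarrow>es. t_even (ix ! (a - 1)) (ix ! (b - 1))))"

definition graph_poly :: "nat \<Rightarrow> nat \<Rightarrow> (digraph \<Rightarrow>\<^sub>0 real) \<Rightarrow> superpoly" where
  "graph_poly N l = lin_ext (digraph_poly N l)"


section \<open>Multigraphs and the coefficients of the graph expansion\<close>

text \<open>Unoriented loop-free multigraphs on the labelled vertices \<open>1, \<dots>, l\<close>.\<close>

definition multigraphs :: "nat \<Rightarrow> nat set multiset set" where
  "multigraphs l = {G. \<forall>e\<in>#G. e \<subseteq> {1..l} \<and> card e = 2}"

definition underlying :: "digraph \<Rightarrow> nat set multiset" where
  "underlying es = mset (map (\<lambda>(a, b). {a, b}) es)"

definition parallel_factor :: "nat \<Rightarrow> nat set multiset \<Rightarrow> nat" where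
  "parallel_factor l G = (\<Prod>b\<in>{1..l}. \<Prod>a\<in>{1..<b}. fact (count G {a, b}))"

definition diff_at :: "'m \<Rightarrow> nat \<Rightarrow> 'm fun_poly list \<Rightarrow> 'm fun_poly list" where
  "diff_at \<mu> a fs = fs[a - 1 := mpderiv \<mu> (fs ! (a - 1))]"

fun graph_coeff :: "real^'m^'m \<Rightarrow> digraph \<Rightarrow> 'm::finite fun_poly list \<Rightarrow> real" where
  "graph_coeff \<Omega> [] fs = (\<Prod>f\<leftarrow>fs. Poly_Mapping.lookup f 0)"
| "graph_coeff \<Omega> ((a, b) # es) fs = (\<Sum>\<mu>\<in>UNIV. \<Sum>\<nu>\<in>UNIV.
     matrix_inv \<Omega> $ \<mu> $ \<nu> * graph_coeff \<Omega> es (diff_at \<nu> b (diff_at \<mu> a fs)))"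

end

theory Submission
  imports Defs "HOL-Combinatorics.Multiset_Permutations"
begin

text \<open>
  All polynomials of the theorem have the form \<open>\<Sum> t\<^sub>i\<^sub>1 \<cdots> t\<^sub>i\<^sub>l w(i\<^sub>1, \<dots>, i\<^sub>l)\<close> with coefficients \<open>w\<close> in the
  even variables (\<open>index_sum\<close>). As the \<open>t\<^sub>i\<close> anticommute, only index lists without repetition
  contribute, and permuting the entries costs the sign of the permutation.

  The recipe is Wick's theorem. Differentiation with respect to a source is adjoint to
  multiplication by it (\<open>wick_pairing_mvar_mult\<close>). Hence each factor of the quadratic form \<open>Q\<close> in
  \<open>Q\<^sup>k / k!\<close> differentiates two of the functions, contracts the derivatives with \<open>\<Omega>\<^sup>-\<^sup>1\<close> and
  contributes a variable \<open>t\<^sub>i\<^sub>j\<close>: it is an edge. The coefficient of \<open>t\<^sub>i\<^sub>1 \<cdots> t\<^sub>i\<^sub>l\<close> is therefore a sum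
  over words of \<open>k\<close> edges with weight \<open>1 / k!\<close> (\<open>wick_coeff_expansion\<close>). A multigraph \<open>G\<close> is named by
  \<open>k! / #P(G)\<close> words, which leaves the weight \<open>1 / #P(G)\<close> (\<open>wick_coeff_multigraphs\<close>).

  The operator for the graph differential is analysed once for all coefficients \<open>w\<close>
  (\<open>graph_diff_op_index_sum\<close>). The derivative by \<open>t\<^sub>p\<close> removes the vertex with index \<open>p\<close>, the
  derivative by \<open>t\<^sub>k\<^sub>p\<close> selects an edge from it to the vertex with index \<open>k\<close>, and the renaming merges
  the two vertices. Suppose that the last two steps turn \<open>w\<close> into a sum of terms \<open>v i j\<close>, one for each
  ordered pair of vertices, with \<open>v j i = - v i j\<close>. Then each unordered pair occurs twice, and the
  removed index \<open>p\<close> has \<open>N - l + 1\<close> possible values; this is the normalization of the operator.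
  The statements about the differentials are two instances. For the monomial of a graph, \<open>v i j\<close> sums
  the contractions of the edges between \<open>i\<close> and \<open>j\<close> (\<open>graph_poly_graph_diff\<close>). For the coefficients of
  the Gaussian integral, the derivative of the exponential brings down
  \<open>(\<Omega>\<^sup>-\<^sup>1)\<^sup>\<mu>\<^sup>\<nu> \<partial>\<^sub>\<mu>f\<^sub>i \<partial>\<^sub>\<nu>f\<^sub>j\<close>, and the renaming moves both factors to the same point, where they
  multiply to the Poisson bracket (\<open>graph_diff_op_correlator\<close>).

  The Gaussian integral is well defined on wedge products of vector fields: moving an entry of a chain
  to the front costs only a sign (\<open>correlator_insert_at\<close>), and a Hamiltonian without constant term is
  determined by its vector field (\<open>ham_field_linear_eq\<close>).

  The polynomial of a graph chain determines its class because the coefficient of \<open>t\<^sub>1 \<cdots> t\<^sub>l\<close>, whose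
  monomials are read as graphs, is \<open>l!\<close> times the chain modulo the orientation relations
  (\<open>graph_poly_eq_zero_imp\<close>).
\<close>

section \<open>Polynomials as finitely supported functions\<close>

abbreviation "lookup \<equiv> Poly_Mapping.lookup"
abbreviation "single \<equiv> Poly_Mapping.single"
abbreviation "keys \<equiv> Poly_Mapping.keys"

lemma poly_mapping_sum_induct [case_names single add]:
  assumes "\<And>m c. P (single m c)" and "\<And>p q. P p \<Longrightarrow> P q \<Longrightarrow> P (p + q)"
  shows "P (p :: 'x \<Rightarrow>\<^sub>0 'a::comm_monoid_add)"
proof (induction p rule: update_induct)
  case const
  show ?case using assms(1)[of undefined 0] by simp
next
  case (update p a b)
  have "Poly_Mapping.update a b p = p + single a b"
    using update(1) by (intro poly_mapping_eqI)
      (auto simp: lookup_update lookup_add lookup_single when_def not_in_keys_iff_lookup_eq_zero)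
  then show ?case using assms update(3) by simp
qed

lemma lookup_scaleR [simp]: "lookup (r *\<^sub>R p) m = r *\<^sub>R lookup p m"
proof -
  have "finite {i. r *\<^sub>R lookup p i \<noteq> 0}"
    by (rule finite_subset[OF _ finite_lookup[of p]]) auto
  then show ?thesis by (simp add: scaleR_poly_mapping_def)
qed

lemma scaleR_single: "r *\<^sub>R single m c = single m (r *\<^sub>R c)"
  by (rule poly_mapping_eqI) (simp add: lookup_single when_def)

lemma mconst_simps [simp]:
  "mconst 0 = 0" "mconst 1 = 1" "mconst (a + b) = mconst a + mconst b" "mconst (a * b) = mconst a * mconst b"
  "mconst (- a) = - mconst a"
  by (simp_all add: mconst_def single_add mult_single single_uminus)

lemma mconst_mult_single: "mconst a * single m c = single m (a * c)"
  by (simp add: mconst_def mult_single)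

lemma lookup_mconst_mult [simp]:
  "lookup (mconst a * p) m = a * lookup p m"
  by (induction p rule: poly_mapping_sum_induct)
    (auto simp: mconst_mult_single lookup_single when_def lookup_add algebra_simps)

lemma scaleR_eq_mconst_mult: "r *\<^sub>R p = mconst r * (p :: ('x, real) mpoly)"
  by (rule poly_mapping_eqI) simp

lemma scaleR_mpoly_mult [simp]:
  fixes p q :: "('x, real) mpoly"
  shows "(r *\<^sub>R p) * q = r *\<^sub>R (p * q)" "p * (r *\<^sub>R q) = r *\<^sub>R (p * q)"
  by (simp_all add: scaleR_eq_mconst_mult algebra_simps)

lemma scaleR_eq_mconst_mconst_mult:
  fixes Q :: "('v, ('x, real) mpoly) mpoly"
  shows "r *\<^sub>R Q = mconst (mconst r) * Q"
  by (rule poly_mapping_eqI) (simp add: scaleR_eq_mconst_mult)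

lemma of_nat_mpoly_mult: "of_nat n * p = real n *\<^sub>R (p :: ('x, real) mpoly)"
  by (induction n) (simp_all add: algebra_simps)

lemma poly_mapping_eq_sum_single:
  "p = (\<Sum>m\<in>keys p. single m (lookup p m))"
  by (rule poly_mapping_eqI)
    (auto simp: lookup_sum lookup_single when_def in_keys_iff sum.delta')

lemma lookup_mpderiv:
  "lookup (mpderiv x p) m =
    of_nat (Suc (lookup m x)) * lookup p (m + single x 1)"
proof -
  have "lookup (mpderiv x p) m = (\<Sum>n\<in>keys p.
      if n = m + single x 1
      then of_nat (Suc (lookup m x)) * lookup p n else 0)"
    unfolding mpderiv_def lookup_sum
  proof (rule sum.cong[OF refl])
    fix n
    show "lookup (single (n - single x 1)
        (of_nat (lookup n x) * lookup p n)) m =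
      (if n = m + single x 1
      then of_nat (Suc (lookup m x)) * lookup p n else 0)"
    proof (cases "lookup n x = 0")
      case True
      then have "n \<noteq> m + single x 1" by (auto simp: lookup_add)
      with True show ?thesis by simp
    next
      case False
      then have "n = n - single x 1 + single x 1"
        by (intro poly_mapping_eqI) (auto simp: lookup_add lookup_minus lookup_single when_def)
      then have "n - single x 1 = m \<longleftrightarrow> n = m + single x 1" by auto
      then show ?thesis by (auto simp: lookup_single when_def lookup_add)
    qed
  qed
  then show ?thesis by (simp add: in_keys_iff)
qed

lemma mpderiv_add [simp]: "mpderiv x (p + q) = mpderiv x p + mpderiv x q"
  by (rule poly_mapping_eqI) (simp only: lookup_mpderiv lookup_add algebra_simps)

lemma mpderiv_zero [simp]: "mpderiv x 0 = 0"
  by (simp add: mpderiv_def)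

lemma mpderiv_uminus [simp]: "mpderiv x (- p) = - mpderiv x p"
  by (rule poly_mapping_eqI) (simp only: lookup_mpderiv lookup_uminus mult_minus_right)

lemma mpderiv_mconst_mult [simp]: "mpderiv x (mconst c * p) = mconst c * mpderiv x p"
  by (rule poly_mapping_eqI) (simp only: lookup_mpderiv lookup_mconst_mult mult.left_commute)

lemma mpderiv_scaleR [simp]: "mpderiv x (r *\<^sub>R p) = r *\<^sub>R mpderiv x (p :: ('x, real) mpoly)"
  by (simp add: scaleR_eq_mconst_mult)

lemma mpderiv_commute: "mpderiv x (mpderiv y p) = mpderiv y (mpderiv x p)"
proof (cases "x = y")
  case False
  show ?thesis
  proof (rule poly_mapping_eqI)
    fix m
    have "m + single x 1 + single y 1 =
      m + single y 1 + single x (1::nat)" by (simp add: add_ac)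
    then show "lookup (mpderiv x (mpderiv y p)) m =
        lookup (mpderiv y (mpderiv x p)) m"
      using False unfolding lookup_mpderiv
      by (simp add: lookup_add lookup_single when_def mult_ac del: of_nat_Suc)
  qed
qed simp

lemma mpderiv_single:
  "mpderiv x (single m c) =
    single (m - single x 1) (of_nat (lookup m x) * c)"
  by (cases "c = 0") (simp_all add: mpderiv_def)

lemma mpderiv_mvar [simp]: "mpderiv x (mvar y) = (if x = y then 1 else 0)"
  by (auto simp: mvar_def mpderiv_single lookup_single when_def)

lemma mpderiv_mult: "mpderiv x (p * q) = mpderiv x p * q + p * mpderiv x q"
proof (induction p rule: poly_mapping_sum_induct)
  case (single m c)
  show ?case
  proof (induction q rule: poly_mapping_sum_induct)
    case (single n d)
    have shift: "single (k + n' - single x 1) (of_nat (lookup k x) * e) =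
      single (k - single x 1 + n') (of_nat (lookup k x) * e)"
      for k n' :: "'a \<Rightarrow>\<^sub>0 nat" and e :: 'b
    proof (cases "lookup k x = 0")
      case False
      then have "k + n' - single x 1 = k - single x 1 + n'"
        by (intro poly_mapping_eqI) (auto simp: lookup_add lookup_minus lookup_single when_def)
      then show ?thesis by simp
    qed simp
    have "mpderiv x (single m c * single n d) =
      single (m + n - single x 1) (of_nat (lookup m x) * (c * d)) +
      single (n + m - single x 1) (of_nat (lookup n x) * (c * d))"
      by (simp add: mult_single mpderiv_single lookup_add algebra_simps flip: single_add)
    then show ?case unfolding shift
      by (simp add: mult_single mpderiv_single algebra_simps)
  next
    case (add p q)
    then show ?case by (simp add: algebra_simps)
  qed
next
  case (add p q)
  then show ?case by (simp add: algebra_simps)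
qed

text \<open>The coefficient of a monomial containing \<open>x\<close> reappears in the derivative by \<open>x\<close>, multiplied by
  the exponent of \<open>x\<close>, which is invertible over the reals.\<close>

lemma mpderiv_eq_zero_imp_zero:
  fixes p :: "('x, real) mpoly"
  assumes "\<And>x. mpderiv x p = 0" "lookup p 0 = 0"
  shows "p = 0"
proof (rule poly_mapping_eqI)
  fix m
  show "lookup p m = lookup 0 m"
  proof (cases "m = 0")
    case False
    then obtain x where x: "lookup m x \<noteq> 0" by (metis poly_mapping_eqI lookup_zero)
    then have "m - single x 1 + single x 1 = m"
      by (intro poly_mapping_eqI) (auto simp: lookup_add lookup_minus lookup_single when_def)
    with assms(1)[of x] lookup_mpderiv[of x p "m - single x 1"]
    show ?thesis by simp
  qed (simp add: assms)
qed

lemma msubst_single: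
  "msubst \<phi> (single m c) =
    mconst c * (\<Prod>x\<in>keys m. \<phi> x ^ lookup m x)"
  by (cases "c = 0") (simp_all add: msubst_def)

lemma msubst_add [simp]: "msubst \<phi> (p + q) = msubst \<phi> p + msubst \<phi> q"
  unfolding msubst_def by (rule setsum_keys_plus_distrib) (simp_all add: algebra_simps)

lemma msubst_mult [simp]: "msubst \<phi> (p * q) = msubst \<phi> p * msubst \<phi> q"
proof (induction p rule: poly_mapping_sum_induct)
  case (single m c)
  show ?case
  proof (induction q rule: poly_mapping_sum_induct)
    case (single n d)
    let ?M = "\<lambda>m S. \<Prod>x\<in>S. \<phi> x ^ lookup m x"
    have ext: "?M k (keys k) = ?M k (keys m \<union> keys n)"
      if "keys k \<subseteq> keys m \<union> keys n" for k
      using that by (intro prod.mono_neutral_left) (auto simp: in_keys_iff)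
    have "?M (m + n) (keys (m + n)) =
      ?M m (keys m) * ?M n (keys n)"
      by (subst (1 2 3) ext) (simp_all add: keys_add lookup_add power_add prod.distrib)
    then show ?case by (simp add: mult_single msubst_single algebra_simps)
  qed (simp add: algebra_simps)
qed (simp add: algebra_simps)

lemma msubst_simps [simp]:
  "msubst \<phi> 0 = 0" "msubst \<phi> 1 = 1" "msubst \<phi> (mconst c) = mconst c" "msubst \<phi> (mvar x) = \<phi> x"
  "msubst \<phi> (- p) = - msubst \<phi> p"
proof -
  show z: "msubst \<phi> 0 = 0" by (simp add: msubst_def)
  show "msubst \<phi> (mconst c) = mconst c" for c by (simp add: mconst_def msubst_single)
  from this[of 1] show "msubst \<phi> 1 = 1" by simp
  show "msubst \<phi> (mvar x) = \<phi> x" by (simp add: mvar_def msubst_single)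
  show "msubst \<phi> (- p) = - msubst \<phi> p"
    using msubst_add[of \<phi> "- p" p] z by (simp add: eq_neg_iff_add_eq_0)
qed

lemma msubst_scaleR [simp]: "msubst \<phi> (r *\<^sub>R p) = r *\<^sub>R msubst \<phi> (p :: ('x, real) mpoly)"
  by (simp add: scaleR_eq_mconst_mult)

lemma lin_ext_add: "lin_ext \<phi> (c + d) = lin_ext \<phi> c + lin_ext \<phi> d"
  unfolding lin_ext_def by (rule setsum_keys_plus_distrib) (simp_all add: scaleR_add_left)

lemma lin_ext_single [simp]: "lin_ext \<phi> (single x r) = r *\<^sub>R \<phi> x"
  by (cases "r = 0") (simp_all add: lin_ext_def)

lemma lin_ext_scaleR: "lin_ext \<phi> (r *\<^sub>R c) = r *\<^sub>R lin_ext \<phi> c"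
  by (induction c rule: poly_mapping_sum_induct)
    (simp_all add: scaleR_single lin_ext_add scaleR_add_right)

lemma linear_lin_ext: "linear (lin_ext \<phi>)"
  by (intro linearI lin_ext_add lin_ext_scaleR)

section \<open>Products of odd variables\<close>

lemma lookup_mult_even_part:
  "lookup (gcoeffs (F * even_part c)) A = lookup (gcoeffs F) A * c"
proof -
  have "lookup (gcoeffs (F * even_part c)) A
    = (\<Sum>B | B |\<subseteq>| A. if B = A then lookup (gcoeffs F) A * c else 0)"
    unfolding lookup_times_grassmann gprod_def even_part.rep_eq lookup_single
    by (rule sum.cong) (auto simp: when_def)
  then show ?thesis by simp
qed

lemmas lookup_grassmann = plus_grassmann.rep_eq minus_grassmann.rep_eq uminus_grassmann.rep_eq
  zero_grassmann.rep_eq lookup_add lookup_minus lookup_uminus lookup_zero lookup_mult_even_part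

lemma gcoeffs_scaleR: "gcoeffs (r *\<^sub>R F) = r *\<^sub>R gcoeffs F"
  by (simp add: scaleR_grassmann_def Grassmann_inverse)

lemma gcoeffs_sum: "gcoeffs (sum f S) = (\<Sum>x\<in>S. gcoeffs (f x))"
  by (induction S rule: infinite_finite_induct)
    (simp_all add: zero_grassmann.rep_eq plus_grassmann.rep_eq)

lemma even_part_simps [simp]:
  "even_part 0 = 0" "even_part (a + b) = even_part a + even_part b" "even_part (- a) = - even_part a"
  by (rule grassmann_eqI, simp add: even_part.rep_eq lookup_grassmann lookup_single when_def)+

lemma even_part_sum: "even_part (sum f S) = (\<Sum>x\<in>S. even_part (f x))"
  by (induction S rule: infinite_finite_induct) simp_all

lemma mult_even_part_scaleR: "(F :: superpoly) * even_part (r *\<^sub>R a) = r *\<^sub>R (F * even_part a)"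
  by (rule grassmann_eqI) (simp add: gcoeffs_scaleR lookup_grassmann)

lemma scaleR_superpoly_mult [simp]:
  fixes F G :: superpoly
  shows "(r *\<^sub>R F) * G = r *\<^sub>R (F * G)" "F * (r *\<^sub>R G) = r *\<^sub>R (F * G)"
  by (rule grassmann_eqI, simp add: gcoeffs_scaleR lookup_times_grassmann gprod_def scaleR_sum_right)+

lemma map_coeffs_sum:
  assumes "\<And>a b. h (a + b) = h a + h b"
  shows "map_coeffs h (sum f S) = (\<Sum>x\<in>S. map_coeffs h (f x))"
proof -
  have z: "h 0 = 0" using assms[of 0 0] by simp
  then have "map_coeffs h 0 = 0"
    by (intro grassmann_eqI) (simp add: map_coeffs.rep_eq zero_grassmann.rep_eq map.rep_eq)
  moreover have "map_coeffs h (F + G) = map_coeffs h F + map_coeffs h G" for F G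
    using assms z by (intro grassmann_eqI)
      (auto simp: map_coeffs.rep_eq plus_grassmann.rep_eq map.rep_eq lookup_add when_def
        simp flip: assms)
  ultimately show ?thesis by (induction S rule: infinite_finite_induct) simp_all
qed

lemma odd_deriv_sum:
  fixes f :: "'b \<Rightarrow> 'a::comm_ring_1 grassmann"
  shows "odd_deriv p (sum f S) = (\<Sum>x\<in>S. odd_deriv p (f x))"
proof -
  have "odd_deriv p (0 :: 'a grassmann) = 0" "odd_deriv p (F + G) = odd_deriv p F + odd_deriv p G" for F G :: "'a grassmann"
    by (intro grassmann_eqI; simp add: lookup_odd_deriv lookup_grassmann algebra_simps)+
  then show ?thesis by (induction S rule: infinite_finite_induct) simp_all
qed

definition odd_word :: "nat list \<Rightarrow> superpoly" where
  "odd_word ix = prod_list (map t_odd ix)"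

lemma odd_word_simps [simp]:
  "odd_word [] = 1" "odd_word (i # ix) = t_odd i * odd_word ix" "odd_word (ix @ iy) = odd_word ix * odd_word iy"
  by (simp_all add: odd_word_def)

lemma t_odd_anticommute: "t_odd i * t_odd j = - (t_odd j * t_odd i)"
proof (cases "i = j")
  case True
  then show ?thesis by (simp add: t_odd_def odd_gen_square)
next
  case False
  then show ?thesis unfolding t_odd_def by (rule odd_gen_mult_odd_gen)
qed

lemma t_odd_mult_odd_word: "t_odd i * odd_word ys = (-1) ^ length ys *\<^sub>R (odd_word ys * t_odd i)"
proof (induction ys)
  case (Cons y ys)
  have "t_odd i * odd_word (y # ys) = (t_odd i * t_odd y) * odd_word ys"
    by (simp add: mult.assoc)
  also have "\<dots> = - (t_odd y * (t_odd i * odd_word ys))"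
    unfolding t_odd_anticommute[of i y] by (simp add: mult.assoc)
  also have "\<dots> = (-1) ^ length (y # ys) *\<^sub>R (odd_word (y # ys) * t_odd i)"
    unfolding Cons by (simp add: mult.assoc)
  finally show ?case .
qed simp

text \<open>Both letters pass the word between them, with equal signs; what remains is the sign from
  exchanging the two letters themselves.\<close>

lemma odd_word_swap: "odd_word (xs @ a # ys @ b # zs) = - odd_word (xs @ b # ys @ a # zs)"
proof -
  have "t_odd a * odd_word ys * t_odd b = (-1) ^ length ys *\<^sub>R (odd_word ys * (t_odd a * t_odd b))"
    by (simp add: t_odd_mult_odd_word mult.assoc)
  also have "\<dots> = - ((-1) ^ length ys *\<^sub>R (odd_word ys * (t_odd b * t_odd a)))"
    unfolding t_odd_anticommute[of a b] by simp
  also have "\<dots> = - (t_odd b * odd_word ys * t_odd a)"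
    by (simp add: t_odd_mult_odd_word mult.assoc)
  finally have "t_odd a * odd_word ys * t_odd b = - (t_odd b * odd_word ys * t_odd a)" .
  then have "odd_word xs * (t_odd a * odd_word ys * t_odd b) * odd_word zs =
    - (odd_word xs * (t_odd b * odd_word ys * t_odd a) * odd_word zs)" by simp
  then show ?thesis by (simp add: mult.assoc)
qed

lemma eq_neg_imp_zero:
  assumes "(x :: 'v::real_vector) = - x"
  shows "x = 0"
proof -
  have "2 *\<^sub>R x = x + x" by (simp add: scaleR_2)
  also have "\<dots> = 0" using assms by (simp add: eq_neg_iff_add_eq_0)
  finally show ?thesis by simp
qed

lemma odd_word_eq_zero:
  assumes "\<not> distinct ix"
  shows "odd_word ix = 0"
proof -
  obtain xs ys zs y where "ix = xs @ [y] @ ys @ [y] @ zs"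
    using not_distinct_decomp[OF assms] by blast
  then have "odd_word ix = - odd_word ix" using odd_word_swap[of xs y ys y zs] by (simp del: odd_word_simps)
  then show ?thesis by (rule eq_neg_imp_zero)
qed

text \<open>The coefficients of a word are signs; hence a map of the coefficients that is odd acts on the
  even factor alone.\<close>

lemma lookup_odd_word_cases:
  "lookup (gcoeffs (odd_word ix)) A \<in> {0, 1, - 1}"
proof (induction ix arbitrary: A)
  case Nil
  show ?case by (simp add: one_grassmann.rep_eq lookup_single when_def)
next
  case (Cons i ix)
  have "(-1) ^ n * x \<in> {0, 1, - 1}" if "x \<in> {0, 1, - 1}" for x :: even_poly and n
    using that by (cases "even n") auto
  with Cons show ?case by (simp add: t_odd_def lookup_odd_gen_mult)
qed

lemma lookup_odd_word_eq_zero: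
  "fset A \<noteq> set ix \<Longrightarrow> lookup (gcoeffs (odd_word ix)) A = 0"
proof (induction ix arbitrary: A)
  case Nil
  then show ?case by (auto simp: one_grassmann.rep_eq lookup_single when_def)
next
  case (Cons i ix)
  show ?case
  proof (cases "i |\<in>| A")
    case True
    then have "fset (A |-| {|i|}) = set ix \<Longrightarrow> fset A = set (i # ix)" by auto
    with Cons.prems have "fset (A |-| {|i|}) \<noteq> set ix" by blast
    from Cons.IH[OF this] show ?thesis by (simp add: t_odd_def lookup_odd_gen_mult)
  qed (simp add: t_odd_def lookup_odd_gen_mult)
qed

lemma lookup_odd_word_sorted:
  assumes "sorted_wrt (<) ix"
  shows "lookup (gcoeffs (odd_word ix)) (fset_of_list ix) = 1"
  using assms
proof (induction ix)
  case Nil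
  show ?case by (simp add: one_grassmann.rep_eq)
next
  case (Cons i ix)
  have tail: "fset_of_list (i # ix) |-| {|i|} = fset_of_list ix"
    using Cons.prems by (auto simp: fset_of_list_elem)
  have none: "{b. b |\<in>| fset_of_list (i # ix) \<and> b < i} = {}"
    using Cons.prems by (auto simp: fset_of_list_elem)
  have "i |\<in>| fset_of_list (i # ix)" by simp
  then have "lookup (gcoeffs (odd_word (i # ix))) (fset_of_list (i # ix)) =
    lookup (gcoeffs (odd_word ix)) (fset_of_list ix)"
    by (simp only: odd_word_simps t_odd_def lookup_odd_gen_mult none tail if_True card.empty
        power_0 mult_1)
  then show ?case using Cons by simp
qed

lemma map_coeffs_odd_word:
  assumes "h 0 = 0" "\<And>c. h (- c) = - h c"
  shows "map_coeffs h (odd_word ix * even_part c) = odd_word ix * even_part (h c)"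
proof (rule grassmann_eqI)
  fix A :: "nat fset"
  show "lookup (gcoeffs (map_coeffs h (odd_word ix * even_part c))) A =
    lookup (gcoeffs (odd_word ix * even_part (h c))) A"
    using lookup_odd_word_cases[of ix A] assms
    by (auto simp: map_coeffs.rep_eq map.rep_eq lookup_mult_even_part when_def)
qed

lemma odd_deriv_t_odd_mult:
  "odd_deriv p (t_odd q * F) = (if p = q then F else 0) - t_odd q * odd_deriv p F"
  by (simp add: t_odd_def odd_deriv_odd_gen_mult)

lemma odd_deriv_odd_word_mult:
  assumes "p \<notin> set ys"
  shows "odd_deriv p (odd_word ys * F) = (-1) ^ length ys *\<^sub>R (odd_word ys * odd_deriv p F)"
  using assms
proof (induction ys)
  case (Cons y ys)
  have "odd_deriv p (odd_word (y # ys) * F) = - (t_odd y * odd_deriv p (odd_word ys * F))"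
    using Cons.prems by (simp add: odd_deriv_t_odd_mult mult.assoc)
  also have "\<dots> = (-1) ^ length (y # ys) *\<^sub>R (odd_word (y # ys) * odd_deriv p F)"
    using Cons by (simp add: mult.assoc)
  finally show ?case .
qed simp

lemma odd_deriv_even_part [simp]: "odd_deriv p (even_part c) = 0"
  by (rule grassmann_eqI)
    (auto simp: lookup_odd_deriv even_part.rep_eq lookup_single zero_grassmann.rep_eq when_def)

lemma odd_deriv_word_eq_zero: "p \<notin> set ys \<Longrightarrow> odd_deriv p (odd_word ys * even_part c) = 0"
  by (simp add: odd_deriv_odd_word_mult)

lemma odd_deriv_word:
  assumes "p \<notin> set xs" "p \<notin> set ys"
  shows "odd_deriv p (odd_word (xs @ p # ys) * even_part c) =
    (-1) ^ length xs *\<^sub>R (odd_word (xs @ ys) * even_part c)"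
  using assms by (simp add: odd_deriv_odd_word_mult mult.assoc odd_deriv_word_eq_zero odd_deriv_t_odd_mult)

text \<open>By induction over transpositions of the positions. The reading \<open>g\<close> of the positions is arbitrary
  because each transposition changes it.\<close>

lemma odd_word_permute:
  assumes "\<sigma> permutes {1..l}"
  shows "odd_word (map (\<lambda>a. g (\<sigma> a)) [1..<Suc l]) =
    real_of_int (sign \<sigma>) *\<^sub>R odd_word (map g [1..<Suc l])"
  using assms finite_atLeastAtMost
proof (induction arbitrary: g rule: permutes_induct)
  case id
  show ?case by simp
next
  case (swap a b \<sigma>)
  have transp: "odd_word (map (\<lambda>x. g (Transposition.transpose a b x)) [1..<Suc l]) = - odd_word (map g [1..<Suc l])"
    if "a \<in> {1..l}" "b \<in> {1..l}" "a < b" for a b :: nat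
  proof -
    have u: "[1..<Suc l] = [1..<a] @ a # [Suc a..<b] @ b # [Suc b..<Suc l]"
      using that upt_add_eq_append[of 1 a "Suc l - a"] upt_add_eq_append[of "Suc a" b "Suc l - b"]
      by (simp add: upt_conv_Cons del: upt_Suc)
    have keep: "map (\<lambda>x. g (Transposition.transpose a b x)) xs = map g xs" if "a \<notin> set xs" "b \<notin> set xs" for xs
      using that by (intro map_cong refl arg_cong[where f = g]) (auto simp: Transposition.transpose_def)
    have "map (\<lambda>x. g (Transposition.transpose a b x)) [1..<Suc l] =
        map g [1..<a] @ g b # map g [Suc a..<b] @ g a # map g [Suc b..<Suc l]"
      unfolding u map_append list.map using that by (simp add: keep del: upt_Suc)
    moreover have "map g [1..<Suc l] = map g [1..<a] @ g a # map g [Suc a..<b] @ g b # map g [Suc b..<Suc l]"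
      unfolding u by simp
    ultimately show ?thesis by (simp only: odd_word_swap[of _ "g b"])
  qed
  have "Transposition.transpose a b = Transposition.transpose b a" by (rule transpose_commute)
  then have "odd_word (map (\<lambda>x. g (Transposition.transpose a b x)) [1..<Suc l]) = - odd_word (map g [1..<Suc l])"
    using transp[of a b] transp[of b a] swap by (cases a b rule: linorder_cases) auto
  moreover have "sign (Transposition.transpose a b \<circ> \<sigma>) = - sign \<sigma>"
    using sign_compose[OF permutation_swap_id permutes_imp_permutation[OF finite_atLeastAtMost swap(4)]]
      swap(3) by (simp add: sign_swap_id)
  ultimately show ?case
    using swap.IH[of "\<lambda>x. g (Transposition.transpose a b x)"]
    by (simp only: o_def of_int_minus scaleR_minus_left scaleR_minus_right)
qed

section \<open>The graph differential operator on sums over index lists\<close>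

text \<open>Removing the entry at position \<open>j\<close> is described by its inverse, so that sums over lists can be
  reindexed by the removed entry and the remaining list.\<close>

definition insert_at :: "nat \<Rightarrow> 'a \<Rightarrow> 'a list \<Rightarrow> 'a list" where
  "insert_at j x xs = take j xs @ x # drop j xs"

lemma length_insert_at [simp]: "length (insert_at j x xs) = Suc (length xs)"
  by (simp add: insert_at_def)

lemma insert_at_0 [simp]: "insert_at 0 x xs = x # xs"
  by (simp add: insert_at_def)

lemma nth_insert_at:
  "j \<le> length xs \<Longrightarrow> insert_at j x xs ! i = (if i < j then xs ! i else if i = j then x else xs ! (i - 1))"
  by (auto simp: insert_at_def nth_append nth_Cons' min_def)

lemma set_insert_at [simp]: "set (insert_at j x xs) = insert x (set xs)"
proof -
  have "set (take j xs) \<union> set (drop j xs) = set xs" by (simp flip: set_append)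
  then show ?thesis by (auto simp: insert_at_def)
qed

lemma mset_insert_at [simp]: "mset (insert_at j x xs) = add_mset x (mset xs)"
  using mset_append[of "take j xs" "drop j xs"] by (simp add: insert_at_def)

lemma distinct_insert_at [simp]: "distinct (insert_at j x xs) \<longleftrightarrow> x \<notin> set xs \<and> distinct xs"
  using mset_eq_imp_distinct_iff[of "insert_at j x xs" "x # xs"] by simp

lemma list_update_insert_at: "j \<le> length xs \<Longrightarrow> (insert_at j x xs)[j := y] = insert_at j y xs"
  by (simp add: insert_at_def list_update_append)

lemma delete_insert_at: "j \<le> length xs \<Longrightarrow> take j (insert_at j x xs) @ drop (Suc j) (insert_at j x xs) = xs"
  by (simp add: insert_at_def min_def)

lemma insert_at_commute:
  "i \<le> j \<Longrightarrow> j \<le> length xs \<Longrightarrow> insert_at (Suc j) x (insert_at i y xs) = insert_at i y (insert_at j x xs)"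
  by (intro nth_equalityI) (auto simp: nth_insert_at)

lemma odd_word_insert_at:
  "j \<le> length xs \<Longrightarrow> odd_word (insert_at j x xs) = (-1) ^ j *\<^sub>R odd_word (x # xs)"
proof -
  assume j: "j \<le> length xs"
  have "odd_word (x # xs) = t_odd x * odd_word (take j xs) * odd_word (drop j xs)"
    by (simp add: mult.assoc flip: odd_word_simps)
  also have "\<dots> = (-1) ^ j *\<^sub>R odd_word (insert_at j x xs)"
    using j by (simp add: t_odd_mult_odd_word insert_at_def mult.assoc)
  finally show ?thesis by (simp flip: power_mult_distrib)
qed

lemma finite_index_lists [simp]: "finite (index_lists N l)"
proof -
  have "index_lists N l = {ix. set ix \<subseteq> {1..N} \<and> length ix = l}" by (auto simp: index_lists_def)
  then show ?thesis using finite_lists_length_eq[of "{1..N}" l] by simp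
qed

lemma sum_lists_insert_at:
  assumes "j \<le> m"
  shows "(\<Sum>xs | length xs = Suc m \<and> set xs \<subseteq> A. g xs) =
    (\<Sum>x\<in>A. \<Sum>ys | length ys = m \<and> set ys \<subseteq> A. g (insert_at j x ys))"
  unfolding sum.cartesian_product
proof (rule sum.reindex_bij_witness[where i = "\<lambda>(x, ys). insert_at j x ys"
      and j = "\<lambda>xs. (xs ! j, take j xs @ drop (Suc j) xs)"], goal_cases)
  case (1 xs)
  then show ?case using assms by (auto simp: insert_at_def min_def id_take_nth_drop[symmetric])
next
  case (2 xs)
  then have "set (take j xs @ drop (Suc j) xs) \<subseteq> set xs"
    using set_take_subset[of j xs] set_drop_subset[of "Suc j" xs] by simp
  with 2 show ?case using assms by (auto simp: subset_iff)
next
  case (3 x)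
  then show ?case using assms by (auto simp: insert_at_def nth_append min_def)
next
  case (4 x)
  then show ?case using assms by auto
next
  case (5 xs)
  then show ?case using assms by (auto simp: insert_at_def min_def id_take_nth_drop[symmetric])
qed

lemma sum_index_lists_insert_at:
  "j \<le> m \<Longrightarrow> (\<Sum>ix\<in>index_lists N (Suc m). g ix) =
    (\<Sum>p\<in>{1..N}. \<Sum>ys\<in>index_lists N m. g (insert_at j p ys))"
  unfolding index_lists_def by (rule sum_lists_insert_at)

lemma t_even_deriv_add [simp]: "t_even_deriv k p (a + b) = t_even_deriv k p a + t_even_deriv k p b"
  by (simp add: t_even_deriv_def)

lemma t_even_deriv_simps [simp]:
  "t_even_deriv k p 0 = 0" "t_even_deriv k p (- a) = - t_even_deriv k p a"
  "t_even_deriv k p (r *\<^sub>R a) = r *\<^sub>R t_even_deriv k p a"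
  by (simp_all add: t_even_deriv_def)

lemma t_even_deriv_sum: "t_even_deriv k p (sum f S) = (\<Sum>x\<in>S. t_even_deriv k p (f x))"
  by (induction S rule: infinite_finite_induct) simp_all

lemma t_even_deriv_mult:
  "t_even_deriv k p (a * b) = t_even_deriv k p a * b + a * t_even_deriv k p b"
  by (simp add: t_even_deriv_def mpderiv_mult)

lemma rename_index_simps [simp]:
  "rename_index p k 0 = 0" "rename_index p k 1 = 1" "rename_index p k (- a) = - rename_index p k a"
  "rename_index p k (a + b) = rename_index p k a + rename_index p k b"
  "rename_index p k (a * b) = rename_index p k a * rename_index p k b"
  "rename_index p k (r *\<^sub>R a) = r *\<^sub>R rename_index p k a"
  by (simp_all add: rename_index_def)

lemma rename_index_sum: "rename_index p k (sum f S) = (\<Sum>x\<in>S. rename_index p k (f x))"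
  by (induction S rule: infinite_finite_induct) simp_all

lemma t_even_swap: "t_even i j = - t_even j i"
  by (simp add: t_even_def)

lemma t_even_same [simp]: "t_even i i = 0"
  by (simp add: t_even_def)

lemma rename_index_t_even:
  "rename_index p k (t_even i j) = t_even (if i = p then k else i) (if j = p then k else j)"
proof -
  have *: "rename_index p k (mvar (i, j)) = t_even (if i = p then k else i) (if j = p then k else j)" for i j
    by (simp add: rename_index_def)
  show ?thesis
    by (cases i j rule: linorder_cases) (simp_all add: t_even_def[of i j] * t_even_swap[of "if j = p then k else j"])
qed

lemma t_even_deriv_t_even:
  "k \<noteq> p \<Longrightarrow> t_even_deriv k p (t_even i j) =
    (if i = k \<and> j = p then 1 else if i = p \<and> j = k then - 1 else 0)"
  by (auto simp: t_even_deriv_def t_even_def)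

definition index_sum :: "nat \<Rightarrow> nat \<Rightarrow> (nat list \<Rightarrow> even_poly) \<Rightarrow> superpoly" where
  "index_sum N l w = (\<Sum>ix\<in>index_lists N l. odd_word ix * even_part (w ix))"

lemma index_sum_distinct:
  "index_sum N l w = (\<Sum>ix\<in>{ix \<in> index_lists N l. distinct ix}. odd_word ix * even_part (w ix))"
  unfolding index_sum_def by (rule sum.mono_neutral_right) (auto simp: odd_word_eq_zero)

lemma index_sum_cong:
  "(\<And>ix. ix \<in> index_lists N l \<Longrightarrow> distinct ix \<Longrightarrow> w ix = w' ix) \<Longrightarrow> index_sum N l w = index_sum N l w'"
  unfolding index_sum_distinct by (rule sum.cong) auto

lemma index_sum_uminus: "index_sum N l (\<lambda>ix. - w ix) = - index_sum N l w"
  by (simp add: index_sum_def sum_negf)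

lemma index_sum_scaleR: "index_sum N l (\<lambda>ix. r *\<^sub>R w ix) = r *\<^sub>R index_sum N l w"
  by (simp add: index_sum_def mult_even_part_scaleR scaleR_sum_right)

lemma index_sum_add: "index_sum N l (\<lambda>ix. w ix + w' ix) = index_sum N l w + index_sum N l w'"
  by (simp add: index_sum_def sum.distrib algebra_simps)

lemma index_sum_sum: "index_sum N l (\<lambda>ix. \<Sum>x\<in>S. w x ix) = (\<Sum>x\<in>S. index_sum N l (w x))"
  unfolding index_sum_def by (simp add: even_part_sum sum_distrib_left) (rule sum.swap)

text \<open>The list of the indices carried by the vertices before the merging of the vertices at
  positions \<open>i\<close> and \<open>j\<close>, when the merged vertex, which comes first in \<open>iy\<close>, is doubled again.\<close>

definition double_first :: "nat \<Rightarrow> nat \<Rightarrow> nat list \<Rightarrow> nat list" where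
  "double_first i j iy = insert_at (max i j) (hd iy) (insert_at (min i j) (hd iy) (tl iy))"

lemma double_first_commute: "double_first i j iy = double_first j i iy"
  by (simp add: double_first_def max.commute min.commute)

lemma sum_push_inward:
  "(\<Sum>p\<in>P. \<Sum>x\<in>C. \<Sum>j\<in>D. \<Sum>i\<in>E j. g p x j i) =
    (\<Sum>x\<in>C. \<Sum>j\<in>D. \<Sum>i\<in>E j. \<Sum>p\<in>P. g p x j i :: 'c::comm_monoid_add)"
  by (rule trans[OF sum.swap], rule sum.cong[OF refl], rule trans[OF sum.swap], rule sum.cong[OF refl],
      rule sum.swap)

text \<open>Here \<open>v i j\<close> is a function of the index list in which the vertex at position \<open>j\<close> has received
  the index \<open>k\<close> of the vertex at position \<open>i\<close>, that is, of the list after the renaming. On the right,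
  the merged vertex is placed first, which makes the sign symmetric in \<open>i\<close> and \<open>j\<close>.\<close>

theorem graph_diff_op_index_sum:
  assumes "1 \<le> l" "l \<le> N"
    and contract: "\<And>ix j k. ix \<in> index_lists N l \<Longrightarrow> distinct ix \<Longrightarrow> j < l \<Longrightarrow> k \<in> {1..N} \<Longrightarrow> k \<noteq> ix ! j \<Longrightarrow>
      rename_index (ix ! j) k (t_even_deriv k (ix ! j) (w ix)) =
        (\<Sum>i\<in>{..<l} - {j}. if ix ! i = k then v i j (ix[j := k]) else 0)"
    and anti: "\<And>i j iy. v j i iy = - v i j iy"
  shows "graph_diff_op N l (index_sum N l w) =
    (\<Sum>j<l. \<Sum>i<j. (-1) ^ (i + j + 1) *\<^sub>R index_sum N (l - 1) (\<lambda>iy. v i j (double_first i j iy)))"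
proof -
  define L where "L = {ix \<in> index_lists N l. distinct ix}"
  have [simp]: "finite L" by (simp add: L_def)
  define del where "del j ix = take j ix @ drop (Suc j) ix" for j and ix :: "nat list"
  define D where "D k p F = map_coeffs (rename_index p k) (map_coeffs (t_even_deriv k p) (odd_deriv p F))"
    for k p and F :: superpoly
  define G where "G i j ix = (-1) ^ j *\<^sub>R (odd_word (del j ix) * even_part (v i j (ix[j := ix ! i])))"
    for i j ix
  let ?total = "\<Sum>k\<in>{1..N}. \<Sum>p\<in>{1..N} - {k}. D k p (index_sum N l w)"
  have D_word: "D k p (odd_word ix * even_part (w ix)) =
      (\<Sum>j<l. \<Sum>i\<in>{..<l} - {j}. if ix ! j = p \<and> ix ! i = k then G i j ix else 0)"
    if ix: "ix \<in> L" and k: "k \<in> {1..N}" "k \<noteq> p" for k p ix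
  proof (cases "p \<in> set ix")
    case False
    then have "D k p (odd_word ix * even_part (w ix)) = 0"
      using map_coeffs_sum[of "t_even_deriv k p" "\<lambda>_. 0" "{}"] map_coeffs_sum[of "rename_index p k" "\<lambda>_. 0" "{}"]
      by (simp add: D_def odd_deriv_word_eq_zero)
    moreover have "ix ! j \<noteq> p" if "j < l" for j
      using False that ix by (auto simp: L_def index_lists_def)
    ultimately show ?thesis by simp
  next
    case True
    then obtain j where j: "j < l" "ix ! j = p" using ix by (auto simp: L_def index_lists_def in_set_conv_nth)
    have len: "length ix = l" and dist: "distinct ix" using ix by (auto simp: L_def index_lists_def)
    have dec: "ix = take j ix @ p # drop (Suc j) ix" using j len id_take_nth_drop[of j ix] by simp
    then have "p \<notin> set (take j ix)" "p \<notin> set (drop (Suc j) ix)"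
      using dist by (metis distinct_append distinct.simps(2) disjoint_iff list.set_intros(1))+
    from odd_deriv_word[OF this, folded dec]
    have "odd_deriv p (odd_word ix * even_part (w ix)) = odd_word (del j ix) * even_part ((-1) ^ j *\<^sub>R w ix)"
      using j len by (simp add: del_def mult_even_part_scaleR)
    then have "D k p (odd_word ix * even_part (w ix)) =
        odd_word (del j ix) * even_part (rename_index p k (t_even_deriv k p ((-1) ^ j *\<^sub>R w ix)))"
      by (simp add: D_def map_coeffs_odd_word)
    also have "\<dots> =
        (-1) ^ j *\<^sub>R (odd_word (del j ix) * even_part (rename_index p k (t_even_deriv k p (w ix))))"
      by (simp add: mult_even_part_scaleR)
    also have "rename_index p k (t_even_deriv k p (w ix)) =
        (\<Sum>i\<in>{..<l} - {j}. if ix ! i = k then v i j (ix[j := k]) else 0)"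
      using contract[of ix j k] ix j k by (simp add: L_def)
    also have "(-1) ^ j *\<^sub>R (odd_word (del j ix) * even_part \<dots>) =
        (\<Sum>i\<in>{..<l} - {j}. if ix ! i = k then G i j ix else 0)"
      unfolding even_part_sum sum_distrib_left scaleR_sum_right
      by (intro sum.cong refl) (simp add: G_def)
    also have "\<dots> = (\<Sum>j'<l. \<Sum>i\<in>{..<l} - {j'}. if ix ! j' = p \<and> ix ! i = k then G i j' ix else 0)"
    proof -
      have "(\<Sum>i\<in>{..<l} - {j'}. if ix ! j' = p \<and> ix ! i = k then G i j' ix else 0) =
          (if j' = j then \<Sum>i\<in>{..<l} - {j}. if ix ! i = k then G i j ix else 0 else 0)" if "j' < l" for j'
        using j that nth_eq_iff_index_eq[OF dist, of j' j] len by auto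
      then show ?thesis using j by (simp add: sum.delta)
    qed
    finally show ?thesis .
  qed
  have "?total =
      (\<Sum>k\<in>{1..N}. \<Sum>p\<in>{1..N} - {k}. \<Sum>ix\<in>L. \<Sum>j<l. \<Sum>i\<in>{..<l} - {j}.
        if ix ! j = p \<and> ix ! i = k then G i j ix else 0)"
  proof (intro sum.cong[OF refl])
    fix k p assume "k \<in> {1..N}" "p \<in> {1..N} - {k}"
    then have "D k p (index_sum N l w) = (\<Sum>ix\<in>L. D k p (odd_word ix * even_part (w ix)))"
      unfolding index_sum_distinct L_def[symmetric]
      by (simp add: D_def odd_deriv_sum map_coeffs_sum)
    also have "\<dots> = (\<Sum>ix\<in>L. \<Sum>j<l. \<Sum>i\<in>{..<l} - {j}. if ix ! j = p \<and> ix ! i = k then G i j ix else 0)"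
      using \<open>k \<in> {1..N}\<close> \<open>p \<in> {1..N} - {k}\<close> by (intro sum.cong D_word) auto
    finally show "D k p (index_sum N l w) = \<dots>" .
  qed
  also have "\<dots> = (\<Sum>ix\<in>L. \<Sum>j<l. \<Sum>i\<in>{..<l} - {j}. \<Sum>k\<in>{1..N}. \<Sum>p\<in>{1..N} - {k}.
        if ix ! j = p \<and> ix ! i = k then G i j ix else 0)"
    by (rule trans[OF sum.cong[OF refl sum_push_inward] sum_push_inward])
  also have "\<dots> = (\<Sum>ix\<in>L. \<Sum>j<l. \<Sum>i\<in>{..<l} - {j}. G i j ix)"
  proof (intro sum.cong[OF refl])
    fix ix j i assume ix: "ix \<in> L" and j: "j \<in> {..<l}" and i: "i \<in> {..<l} - {j}"
    have "ix ! i \<noteq> ix ! j" "ix ! i \<in> {1..N}" "ix ! j \<in> {1..N}"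
      using ix i j nth_eq_iff_index_eq[of ix i j] by (auto simp: L_def index_lists_def subset_iff)
    moreover have "(\<Sum>p\<in>{1..N} - {k}. if ix ! j = p \<and> ix ! i = k then G i j ix else 0) =
        (if k = ix ! i then \<Sum>p\<in>{1..N} - {k}. if p = ix ! j then G i j ix else 0 else 0)" for k
      by (auto intro!: sum.cong)
    ultimately show "(\<Sum>k\<in>{1..N}. \<Sum>p\<in>{1..N} - {k}. if ix ! j = p \<and> ix ! i = k then G i j ix else 0) = G i j ix"
      by (simp add: sum.delta)
  qed
  also have "\<dots> = (\<Sum>j<l. \<Sum>i\<in>{..<l} - {j}. \<Sum>ix\<in>L. G i j ix)"
    by (rule trans[OF sum.swap], rule sum.cong[OF refl], rule sum.swap)
  finally have expand: "?total =
    (\<Sum>j<l. \<Sum>i\<in>{..<l} - {j}. \<Sum>ix\<in>L. G i j ix)" .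

  \<comment> \<open>The terms for \<open>(i, j)\<close> and \<open>(j, i)\<close> agree: the antisymmetry of \<open>v\<close> compensates the sign of
    removing the vertices in the other order.\<close>
  define S where "S i j = index_sum N (l - 1) (\<lambda>iy. v i j (double_first i j iy))" for i j
  let ?Y = "\<lambda>i j. (if i < j then 1 else - 1) *\<^sub>R ((-1) ^ (i + j) *\<^sub>R S i j)"
  let ?Z = "\<lambda>i j. (-1) ^ (i + j) *\<^sub>R S i j"
  have S_anti: "S j i = - S i j" for i j
    unfolding S_def index_sum_uminus[symmetric] using anti[of i j] by (simp add: double_first_commute[of j i])
  have pair: "(\<Sum>ix\<in>L. G i j ix) = (real N - real l + 1) *\<^sub>R (?Y i j)"
    if ij: "i < l" "j < l" "i \<noteq> j" for i j
  proof -
    have l: "l = Suc (Suc m)" if "m = l - 2" for m using ij that by arith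
    define m where "m = l - 2"
    note l = l[OF m_def]
    \<comment> \<open>\<open>i'\<close> is the position of the vertex \<open>i\<close> after the removal of the vertex \<open>j\<close>.\<close>
    define i' where "i' = (if i < j then i else i - 1)"
    have bounds: "j \<le> Suc m" "i' \<le> m" using ij l by (auto simp: i'_def)
    let ?X = "\<lambda>iy. (-1) ^ (j + i') *\<^sub>R (odd_word iy * even_part (v i j (double_first i j iy)))"
    have dup: "insert_at j k (insert_at i' k ys) = double_first i j (k # ys)" if "length ys = m" for k :: nat and ys
    proof (cases "i < j")
      case False
      then show ?thesis
        using ij insert_at_commute[of j "i - 1" ys k k] that l by (simp add: double_first_def i'_def)
    qed (simp add: double_first_def i'_def)
    have "(\<Sum>ix\<in>L. G i j ix) = (\<Sum>ix\<in>index_lists N l. if distinct ix then G i j ix else 0)"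
      by (simp add: L_def sum.inter_filter)
    also have "\<dots> = (\<Sum>p\<in>{1..N}. \<Sum>k\<in>{1..N}. \<Sum>ys\<in>index_lists N m.
        if distinct (insert_at j p (insert_at i' k ys)) then G i j (insert_at j p (insert_at i' k ys)) else 0)"
      unfolding l sum_index_lists_insert_at[OF bounds(1)] sum_index_lists_insert_at[OF bounds(2)] by simp
    also have "\<dots> = (\<Sum>p\<in>{1..N}. \<Sum>k\<in>{1..N}. \<Sum>ys\<in>index_lists N m. if p \<notin> set (k # ys) then
        ?X (k # ys) else 0)"
    proof (intro sum.cong[OF refl])
      fix p k ys assume "ys \<in> index_lists N m"
      then have len: "length ys = m" by (simp add: index_lists_def)
      let ?ix = "insert_at j p (insert_at i' k ys)"
      have "del j ?ix = insert_at i' k ys" 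
        unfolding del_def by (rule delete_insert_at) (use len bounds in simp)
      moreover have "?ix ! i = k" using len bounds ij by (auto simp: nth_insert_at i'_def)
      moreover have "?ix[j := k] = double_first i j (k # ys)"
        using len bounds dup[of ys k] by (simp add: list_update_insert_at)
      ultimately have "G i j ?ix = ?X (k # ys)"
        using len bounds by (simp add: G_def odd_word_insert_at power_add del: odd_word_simps)
      then show "(if distinct ?ix then G i j ?ix else 0) = (if p \<notin> set (k # ys) then
        ?X (k # ys) else 0)"
        using odd_word_eq_zero[of "k # ys"] by (auto simp del: odd_word_simps)
    qed
    also have "\<dots> = (\<Sum>p\<in>{1..N}. \<Sum>iy\<in>index_lists N (Suc m). if p \<notin> set iy then
        ?X iy else 0)"
      by (simp add: sum_index_lists_insert_at[of 0 m] del: odd_word_simps cong: if_cong)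
    also have "\<dots> = (\<Sum>iy\<in>index_lists N (Suc m). \<Sum>p\<in>{1..N}. if p \<notin> set iy then
        ?X iy else 0)"
      by (rule sum.swap)
    also have "\<dots> = (\<Sum>iy\<in>index_lists N (Suc m). (real N - real l + 1) *\<^sub>R
        (?X iy))"
    proof (rule sum.cong[OF refl])
      fix iy assume iy: "iy \<in> index_lists N (Suc m)"
      show "(\<Sum>p\<in>{1..N}. if p \<notin> set iy then ?X iy else 0) = (real N - real l + 1) *\<^sub>R ?X iy"
      proof (cases "distinct iy")
        case True
        have "(\<Sum>p\<in>{1..N}. if p \<notin> set iy then ?X iy else 0) = (\<Sum>p\<in>{1..N} - set iy. ?X iy)"
          by (rule sum.mono_neutral_cong_right) auto
        also have "\<dots> = real (card ({1..N} - set iy)) *\<^sub>R ?X iy"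
          by (rule sum_constant_scaleR)
        \<comment> \<open>The summand does not depend on the removed index, which avoids the \<open>l - 1\<close> others.\<close>
        also have "card ({1..N} - set iy) = N - (l - 1)"
          using iy True l by (subst card_Diff_subset) (auto simp: index_lists_def distinct_card)
        finally show ?thesis using \<open>1 \<le> l\<close> \<open>l \<le> N\<close> by (simp add: of_nat_diff algebra_simps)
      qed (simp add: odd_word_eq_zero cong: if_cong)
    qed
    also have "\<dots> = (real N - real l + 1) *\<^sub>R ((-1) ^ (j + i') *\<^sub>R S i j)"
      using l by (simp add: S_def index_sum_def scaleR_sum_right)
    also have "(-1) ^ (j + i') = (if i < j then 1 else - 1 :: real) * (-1) ^ (i + j)"
    proof (cases "i < j")
      case False
      then have "i + j = Suc (j + i')" using ij by (simp add: i'_def)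
      then show ?thesis using False by (simp add: add.commute)
    qed (simp add: i'_def add.commute)
    finally show ?thesis by simp
  qed
  have "(\<Sum>j<l. \<Sum>i\<in>{..<l} - {j}. \<Sum>ix\<in>L. G i j ix) =
      (\<Sum>j<l. \<Sum>i\<in>{..<l} - {j}. (real N - real l + 1) *\<^sub>R (?Y i j))"
    by (intro sum.cong pair) auto
  also have "\<dots> = (real N - real l + 1) *\<^sub>R (\<Sum>j<l. \<Sum>i\<in>{..<l} - {j}. ?Y i j)"
    by (simp add: scaleR_sum_right)
  also have "(\<Sum>j<l. \<Sum>i\<in>{..<l} - {j}. ?Y i j) =
      (\<Sum>j<l. \<Sum>i<j. ?Z i j) + (\<Sum>j<l. \<Sum>i\<in>{j<..<l}. - (?Z i j))"
    unfolding sum.distrib[symmetric]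
  proof (rule sum.cong[OF refl])
    fix j assume j: "j \<in> {..<l}"
    have "{..<l} - {j} = {..<j} \<union> {j<..<l}" using j by auto
    then show "(\<Sum>i\<in>{..<l} - {j}. ?Y i j) =
      (\<Sum>i<j. ?Z i j) + (\<Sum>i\<in>{j<..<l}. - (?Z i j))"
      by (simp add: sum.union_disjoint disjoint_iff)
  qed
  also have "(\<Sum>j<l. \<Sum>i\<in>{j<..<l}. - (?Z i j)) = (\<Sum>j<l. \<Sum>i<j. ?Z i j)"
  proof -
    have "(\<Sum>j<l. \<Sum>i\<in>{j<..<l}. - (?Z i j)) = (\<Sum>i<l. \<Sum>j<i. - (?Z i j))"
      unfolding sum.Sigma[OF finite_lessThan ballI[OF finite_greaterThanLessThan]]
        sum.Sigma[OF finite_lessThan ballI[OF finite_lessThan]]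
      by (rule sum.reindex_bij_witness[where i = "\<lambda>(a, b). (b, a)" and j = "\<lambda>(a, b). (b, a)"]) auto
    then show ?thesis by (simp add: S_anti[symmetric] add.commute flip: scaleR_minus_right)
  qed
  finally have "?total =
      (2 * (real N - real l + 1)) *\<^sub>R (\<Sum>j<l. \<Sum>i<j. ?Z i j)"
    unfolding expand by (simp add: scaleR_2[symmetric] mult.commute del: scaleR_add_right)
  moreover have "2 * (real N - real l + 1) \<noteq> 0" using \<open>l \<le> N\<close> by (simp add: add_nonneg_eq_0_iff)
  ultimately have "graph_diff_op N l (index_sum N l w) = - (\<Sum>j<l. \<Sum>i<j. ?Z i j)"
    unfolding graph_diff_op_def D_def[symmetric] by (simp del: mult_eq_0_iff)
  then show ?thesis by (simp add: S_def sum_negf)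
qed

section \<open>Formal power series and differential operators\<close>

text \<open>The multi-index factorial; with it the multi-index derivative takes the symmetric form \<open>(\<alpha> + \<beta>)! / \<beta>!\<close>.\<close>

definition mon_fact :: "('x \<Rightarrow>\<^sub>0 nat) \<Rightarrow> nat" where
  "mon_fact m = (\<Prod>x\<in>keys m. fact (lookup m x))"

lemma mon_fact_superset:
  "finite S \<Longrightarrow> keys m \<subseteq> S \<Longrightarrow> mon_fact m = (\<Prod>x\<in>S. fact (lookup m x))"
  unfolding mon_fact_def by (rule prod.mono_neutral_left) (auto simp: in_keys_iff)

lemma mon_fact_pos: "mon_fact m > 0"
  by (simp add: mon_fact_def prod_pos)

lemma mon_fact_nonzero [simp]: "mon_fact m \<noteq> 0"
  using mon_fact_pos[of m] by simp

lemma mon_fact_zero [simp]: "mon_fact 0 = 1"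
  by (simp add: mon_fact_def)

lemma mon_fact_add_single:
  "mon_fact (m + single x 1) = Suc (lookup m x) * mon_fact m"
proof -
  let ?S = "insert x (keys m)"
  have k: "keys (m + single x 1) \<subseteq> ?S" using keys_add[of m "single x 1"] by auto
  have "mon_fact (m + single x 1) = (\<Prod>y\<in>?S. fact (lookup (m + single x 1) y))"
    by (rule mon_fact_superset[OF _ k]) simp
  also have "\<dots> = (\<Prod>y\<in>?S. (if y = x then Suc (lookup m x) else 1) * fact (lookup m y))"
    by (rule prod.cong) (auto simp: lookup_add lookup_single when_def)
  also have "\<dots> = Suc (lookup m x) * (\<Prod>y\<in>?S. fact (lookup m y))"
    by (simp add: prod.distrib prod.delta)
  also have "(\<Prod>y\<in>?S. fact (lookup m y)) = mon_fact m"
    by (rule mon_fact_superset[symmetric]) auto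
  finally show ?thesis .
qed

lemma series_deriv_eq:
  fixes F :: "('x, ('y, real) mpoly) mseries"
  shows "series_deriv \<alpha> F \<beta> = (real (mon_fact (\<alpha> + \<beta>)) / real (mon_fact \<beta>)) *\<^sub>R F (\<alpha> + \<beta>)"
proof -
  let ?S = "keys \<alpha> \<union> keys \<beta>"
  let ?w = "\<Prod>x\<in>keys \<alpha>. pochhammer (Suc (lookup \<beta> x)) (lookup \<alpha> x)"
  have p: "pochhammer (Suc b) a * fact b = (fact (a + b) :: nat)" for a b
    unfolding pochhammer_fact using pochhammer_product'[of "1::nat" b a] by (simp add: add.commute mult.commute)
  have "?w * mon_fact \<beta> = (\<Prod>x\<in>?S. pochhammer (Suc (lookup \<beta> x)) (lookup \<alpha> x)) *
      (\<Prod>x\<in>?S. fact (lookup \<beta> x))"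
    by (intro arg_cong2[where f = "(*)"] prod.mono_neutral_left mon_fact_superset) (auto simp: in_keys_iff)
  also have "\<dots> = (\<Prod>x\<in>?S. fact (lookup (\<alpha> + \<beta>) x))"
    by (simp add: p lookup_add flip: prod.distrib)
  also have "\<dots> = mon_fact (\<alpha> + \<beta>)"
    using keys_add[of \<alpha> \<beta>] by (intro mon_fact_superset[symmetric]) auto
  finally have "real ?w * real (mon_fact \<beta>) = real (mon_fact (\<alpha> + \<beta>))" by (metis of_nat_mult)
  then have "real (mon_fact (\<alpha> + \<beta>)) / real (mon_fact \<beta>) = real ?w" by (simp add: field_simps)
  then show ?thesis unfolding series_deriv_def by (simp add: of_nat_mpoly_mult del: of_nat_prod)
qed

lemma series_deriv_series_deriv:
  fixes F :: "('x, ('y, real) mpoly) mseries"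
  shows "series_deriv \<alpha> (series_deriv \<beta> F) = series_deriv (\<alpha> + \<beta>) F"
  by (rule ext) (simp add: series_deriv_eq ac_simps)

text \<open>A series is a function of exponents, so the product with a variable is a shift.\<close>

definition var_mult :: "'x \<Rightarrow> ('x, 'a) mseries \<Rightarrow> ('x, 'a::zero) mseries" where
  "var_mult v F = (\<lambda>\<beta>. if lookup \<beta> v = 0 then 0 else F (\<beta> - single v 1))"

lemma add_single_diff:
  "lookup m v \<noteq> 0 \<Longrightarrow> m - single v 1 + single v (1::nat) = m"
  by (rule poly_mapping_eqI) (auto simp: lookup_add lookup_minus lookup_single when_def)

lemma lookup_mvar_mult: "lookup (mvar v * P) = var_mult v (lookup P)"
proof (induction P rule: poly_mapping_sum_induct)
  case (single m c)
  show ?case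
  proof
    fix \<beta>
    have "single v 1 + m = \<beta> \<longleftrightarrow> lookup \<beta> v \<noteq> 0 \<and> m = \<beta> - single v 1"
      using add_single_diff[of \<beta> v] by (auto simp: lookup_add add.commute)
    then show "lookup (mvar v * single m c) \<beta> =
        var_mult v (lookup (single m c)) \<beta>"
      by (auto simp: mvar_def mult_single lookup_single var_mult_def when_def)
  qed
next
  case (add P Q)
  then show ?case by (auto simp: distrib_left lookup_add var_mult_def fun_eq_iff)
qed

text \<open>The Heisenberg commutation relation: the second term arises when one of the derivatives hits the
  variable.\<close>

lemma series_deriv_var_mult:
  fixes F :: "('x, ('y, real) mpoly) mseries"
  shows "series_deriv \<alpha> (var_mult v F) \<beta> = var_mult v (series_deriv \<alpha> F) \<beta> +
    real (lookup \<alpha> v) *\<^sub>R series_deriv (\<alpha> - single v 1) F \<beta>"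
proof -
  let ?v = "single v (1::nat)"
  let ?r = "\<lambda>m. real (mon_fact m)"
  have fact_shift: "?r m = real (lookup m v) * ?r (m - ?v)" if "lookup m v \<noteq> 0" for m
    using mon_fact_add_single[of "m - ?v" v] add_single_diff[OF that] that
    by (simp add: lookup_minus del: of_nat_Suc)
  show ?thesis
  proof (cases "lookup (\<alpha> + \<beta>) v = 0")
    case True
    then show ?thesis by (simp add: series_deriv_eq var_mult_def lookup_add)
  next
    case False
    define \<gamma> where "\<gamma> = \<alpha> + \<beta> - ?v"
    have lhs: "series_deriv \<alpha> (var_mult v F) \<beta> =
        (real (lookup \<alpha> v + lookup \<beta> v) * ?r \<gamma> / ?r \<beta>) *\<^sub>R F \<gamma>"
      using False fact_shift[of "\<alpha> + \<beta>"] by (simp add: series_deriv_eq var_mult_def lookup_add \<gamma>_def)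
    have 1: "var_mult v (series_deriv \<alpha> F) \<beta> = (real (lookup \<beta> v) * ?r \<gamma> / ?r \<beta>) *\<^sub>R F \<gamma>"
    proof (cases "lookup \<beta> v = 0")
      case False
      then have "\<alpha> + (\<beta> - ?v) = \<gamma>" unfolding \<gamma>_def
        by (intro poly_mapping_eqI) (auto simp: lookup_add lookup_minus lookup_single when_def)
      then show ?thesis using False fact_shift[of \<beta>] by (simp add: var_mult_def series_deriv_eq)
    qed (simp add: var_mult_def)
    have 2: "real (lookup \<alpha> v) *\<^sub>R series_deriv (\<alpha> - ?v) F \<beta> =
        (real (lookup \<alpha> v) * ?r \<gamma> / ?r \<beta>) *\<^sub>R F \<gamma>"
    proof (cases "lookup \<alpha> v = 0")
      case False
      then have "\<alpha> - ?v + \<beta> = \<gamma>" unfolding \<gamma>_def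
        by (intro poly_mapping_eqI) (auto simp: lookup_add lookup_minus lookup_single when_def)
      then show ?thesis by (simp add: series_deriv_eq)
    qed simp
    show ?thesis unfolding lhs 1 2 by (simp add: algebra_simps add_divide_distrib flip: scaleR_add_left)
  qed
qed

text \<open>The monomial \<open>m\<close> in the coordinates, written in the sources of the \<open>i\<close>-th copy of the space.\<close>

definition source_mon :: "nat \<Rightarrow> ('m::finite \<Rightarrow>\<^sub>0 nat) \<Rightarrow> (nat \<times> 'm \<Rightarrow>\<^sub>0 nat)" where
  "source_mon i m = (\<Sum>\<mu>\<in>UNIV. single (i, \<mu>) (lookup m \<mu>))"

lemma lookup_source_mon:
  "lookup (source_mon i m) (j, \<mu>) = (if j = i then lookup m \<mu> else 0)"
proof -
  have "lookup (source_mon i m) (j, \<mu>) =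
      (\<Sum>\<nu>\<in>UNIV. if \<nu> = \<mu> then if j = i then lookup m \<mu> else 0 else 0)"
    unfolding source_mon_def lookup_sum by (rule sum.cong) (auto simp: lookup_single when_def)
  then show ?thesis by (simp add: sum.delta)
qed

lemma source_mon_add: "source_mon i (m + n) = source_mon i m + source_mon i n"
  by (rule poly_mapping_eqI) (auto simp: lookup_add lookup_source_mon split: prod.split)

lemma source_mon_zero [simp]: "source_mon i 0 = 0"
  by (simp add: source_mon_def)

lemma source_op_eq: "source_op i f F \<beta> =
    (\<Sum>m\<in>keys f. lookup f m *\<^sub>R series_deriv (source_mon i m) F \<beta>)"
  by (simp add: source_op_def source_mon_def)

lemma source_op_add: "source_op i (f + g) F \<beta> = source_op i f F \<beta> + source_op i g F \<beta>"
  unfolding source_op_eq by (rule setsum_keys_plus_distrib) (simp_all add: algebra_simps)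

lemma source_op_single:
  "source_op i (single m c) F \<beta> = c *\<^sub>R series_deriv (source_mon i m) F \<beta>"
  by (cases "c = 0") (simp_all add: source_op_eq)

lemma source_op_zero [simp]: "source_op i 0 F \<beta> = 0"
  by (simp add: source_op_eq)

lemma source_op_scaleR: "source_op i (r *\<^sub>R f) F \<beta> = r *\<^sub>R source_op i f F \<beta>"
  by (induction f rule: poly_mapping_sum_induct)
    (simp_all add: scaleR_single source_op_single source_op_add scaleR_add_right)

lemma source_op_sum: "source_op i (\<Sum>x\<in>S. f x) F \<beta> = (\<Sum>x\<in>S. source_op i (f x) F \<beta>)"
  by (induction S rule: infinite_finite_induct) (simp_all add: source_op_add)

lemma series_deriv_linear:
  fixes F G :: "('x, ('y, real) mpoly) mseries"
  shows "series_deriv \<alpha> (\<lambda>m. F m + G m) \<beta> = series_deriv \<alpha> F \<beta> + series_deriv \<alpha> G \<beta>"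
    "series_deriv \<alpha> (\<lambda>m. c * F m) \<beta> = c * series_deriv \<alpha> F \<beta>"
    "series_deriv \<alpha> (\<lambda>m. r *\<^sub>R F m) \<beta> = r *\<^sub>R series_deriv \<alpha> F \<beta>"
  by (simp_all add: series_deriv_eq algebra_simps)

lemma source_op_linear:
  "source_op i f (\<lambda>m. F m + G m) \<beta> = source_op i f F \<beta> + source_op i f G \<beta>"
  "source_op i f (\<lambda>m. c * F m) \<beta> = c * source_op i f F \<beta>"
  by (simp_all add: source_op_eq series_deriv_linear sum.distrib algebra_simps sum_distrib_left)

text \<open>These are differential operators with constant coefficients: they commute, and operators
  attached to the same copy of the space compose as their symbols multiply.\<close>

lemma source_op_series_deriv:
  "source_op i f (series_deriv \<alpha> F) = series_deriv \<alpha> (source_op i f F)"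
proof (rule ext)
  show "source_op i f (series_deriv \<alpha> F) \<beta> = series_deriv \<alpha> (source_op i f F) \<beta>" for \<beta>
  proof (induction f rule: poly_mapping_sum_induct)
    case (single m c)
    have "source_op i (single m c) F = (\<lambda>\<beta>. c *\<^sub>R series_deriv (source_mon i m) F \<beta>)"
      by (rule ext) (rule source_op_single)
    then show ?case
      by (simp add: source_op_single series_deriv_linear series_deriv_series_deriv add.commute)
  next
    case (add f g)
    have "source_op i (f + g) F = (\<lambda>\<beta>. source_op i f F \<beta> + source_op i g F \<beta>)"
      by (rule ext) (rule source_op_add)
    then show ?case using add by (simp add: source_op_add series_deriv_linear)
  qed
qed

lemma source_op_commute: "source_op i f (source_op j g F) = source_op j g (source_op i f F)"
proof (rule ext)
  show "source_op i f (source_op j g F) \<beta> = source_op j g (source_op i f F) \<beta>" for \<beta>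
  proof (induction f rule: poly_mapping_sum_induct)
    case (single m c)
    have e: "source_op i (single m c) F = (\<lambda>\<beta>. mconst c * series_deriv (source_mon i m) F \<beta>)"
      by (rule ext) (simp add: source_op_single scaleR_eq_mconst_mult)
    show ?case unfolding e source_op_linear
      by (simp add: source_op_single source_op_series_deriv scaleR_eq_mconst_mult)
  next
    case (add f g')
    have e: "source_op i (f + g') F = (\<lambda>\<beta>. source_op i f F \<beta> + source_op i g' F \<beta>)"
      by (rule ext) (rule source_op_add)
    show ?case unfolding e source_op_linear using add by (simp add: source_op_add)
  qed
qed

lemma source_op_source_op: "source_op i f (source_op i g F) = source_op i (f * g) F"
proof (rule ext)
  show "source_op i f (source_op i g F) \<beta> = source_op i (f * g) F \<beta>" for \<beta>
  proof (induction f rule: poly_mapping_sum_induct)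
    case (single m c)
    show ?case
    proof (induction g rule: poly_mapping_sum_induct)
      case (single n d)
      have e: "source_op i (single n d) F = (\<lambda>\<beta>. mconst d * series_deriv (source_mon i n) F \<beta>)"
        by (rule ext) (simp add: source_op_single scaleR_eq_mconst_mult)
      show ?case unfolding e source_op_linear mult_single
        by (simp add: source_op_single series_deriv_series_deriv source_mon_add scaleR_eq_mconst_mult)
    next
      case (add g g')
      have e: "source_op i (g + g') F = (\<lambda>\<beta>. source_op i g F \<beta> + source_op i g' F \<beta>)"
        by (rule ext) (rule source_op_add)
      show ?case unfolding e source_op_linear using add by (simp add: source_op_add distrib_left)
    qed
  next
    case (add f g')
    then show ?case by (simp add: source_op_add distrib_right)
  qed
qed

text \<open>Commuting the symbol \<open>f\<close> past a variable differentiates it, by linearity from the Heisenberg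
  relation for monomials.\<close>

lemma source_op_var_mult:
  "source_op i f (var_mult (j, \<nu>) F) \<beta> = var_mult (j, \<nu>) (source_op i f F) \<beta> +
    (if i = j then source_op i (mpderiv \<nu> f) F \<beta> else 0)"
proof (induction f rule: poly_mapping_sum_induct)
  case (single m c)
  have "source_mon i m - single (j, \<nu>) 1 = source_mon i (m - single \<nu> 1)" if "i = j"
  proof (rule poly_mapping_eqI)
    fix x show "lookup (source_mon i m - single (j, \<nu>) 1) x =
        lookup (source_mon i (m - single \<nu> 1)) x"
      using that by (cases x) (simp add: lookup_minus lookup_source_mon lookup_single when_def)
  qed
  moreover have "var_mult (j, \<nu>) (\<lambda>a. c *\<^sub>R G a) \<beta> = c *\<^sub>R var_mult (j, \<nu>) G \<beta>"
    for G :: "(nat \<times> 'a, even_poly) mseries"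
    by (simp add: var_mult_def)
  ultimately show ?case
    by (auto simp: source_op_single series_deriv_var_mult mpderiv_single lookup_source_mon
        scaleR_add_right mult.commute)
next
  case (add f g)
  then show ?case by (auto simp: source_op_add var_mult_def)
qed

section \<open>Wick's theorem\<close>

definition source_ops ::
  "nat list \<Rightarrow> 'm::finite fun_poly list \<Rightarrow> (nat \<times> 'm, even_poly) mseries \<Rightarrow> (nat \<times> 'm, even_poly) mseries" where
  "source_ops ix fs F = foldr (\<lambda>(i, f). source_op i f) (zip ix fs) F"

lemma source_ops_simps [simp]:
  "source_ops [] fs F = F" "source_ops ix [] F = F"
  "source_ops (i # ix) (f # fs) F = source_op i f (source_ops ix fs F)"
  by (simp_all add: source_ops_def)

lemma source_op_zero_series [simp]: "source_op i f (\<lambda>_. 0) \<beta> = 0"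
  using source_op_linear(2)[of i f 0 "\<lambda>_. 0" \<beta>] by simp

lemma source_op_sum_series: "source_op i f (\<lambda>\<beta>. \<Sum>x\<in>S. G x \<beta>) \<beta> = (\<Sum>x\<in>S. source_op i f (G x) \<beta>)"
  by (induction S rule: infinite_finite_induct) (simp_all add: source_op_linear)

lemma source_ops_linear:
  "source_ops ix fs (\<lambda>m. F m + G m) \<beta> = source_ops ix fs F \<beta> + source_ops ix fs G \<beta>"
  "source_ops ix fs (\<lambda>m. c * F m) \<beta> = c * source_ops ix fs F \<beta>"
proof -
  have "source_ops ix fs (\<lambda>m. F m + G m) = (\<lambda>\<beta>. source_ops ix fs F \<beta> + source_ops ix fs G \<beta>)"
    "source_ops ix fs (\<lambda>m. c * F m) = (\<lambda>\<beta>. c * source_ops ix fs F \<beta>)"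
    by (induction ix fs rule: list_induct2') (auto intro!: ext simp: source_op_linear)
  then show "source_ops ix fs (\<lambda>m. F m + G m) \<beta> = source_ops ix fs F \<beta> + source_ops ix fs G \<beta>"
    "source_ops ix fs (\<lambda>m. c * F m) \<beta> = c * source_ops ix fs F \<beta>" by simp_all
qed

lemma source_ops_var_mult:
  assumes "length ix = length fs"
  shows "source_ops ix fs (var_mult (j, \<nu>) F) \<beta> = var_mult (j, \<nu>) (source_ops ix fs F) \<beta> +
    (\<Sum>a<length fs. if ix ! a = j then source_ops ix (fs[a := mpderiv \<nu> (fs ! a)]) F \<beta> else 0)"
  using assms
proof (induction ix fs arbitrary: \<beta> rule: list_induct2)
  case Nil
  show ?case by simp
next
  case (Cons i ix f fs)
  have e: "source_ops ix fs (var_mult (j, \<nu>) F) = (\<lambda>\<beta>. var_mult (j, \<nu>) (source_ops ix fs F) \<beta> +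
      (\<Sum>a<length fs. if ix ! a = j then source_ops ix (fs[a := mpderiv \<nu> (fs ! a)]) F \<beta> else 0))"
    using Cons.IH by (rule ext)
  have if_out: "source_op i f (\<lambda>\<beta>. if P then G \<beta> else 0) \<beta> = (if P then source_op i f G \<beta> else 0)" for P G
    by simp
  show ?case
    unfolding source_ops_simps e source_op_linear source_op_sum_series if_out source_op_var_mult
      length_Cons sum.lessThan_Suc_shift by (simp cong: if_cong)
qed

text \<open>The value at vanishing sources, when the differential operators act on a polynomial.\<close>

definition wick_pairing :: "nat list \<Rightarrow> 'm::finite fun_poly list \<Rightarrow> (nat \<times> 'm, even_poly) mpoly \<Rightarrow> even_poly" where
  "wick_pairing ix fs P = source_ops ix fs (lookup P) 0"

lemma wick_pairing_add: "wick_pairing ix fs (P + Q) = wick_pairing ix fs P + wick_pairing ix fs Q"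
  using source_ops_linear(1)[of ix fs "lookup P" "lookup Q"]
  by (simp add: wick_pairing_def lookup_add fun_eq_iff[symmetric] plus_poly_mapping.rep_eq)

lemma wick_pairing_mconst_mult: "wick_pairing ix fs (mconst c * P) = c * wick_pairing ix fs P"
proof -
  have "lookup (mconst c * P) = (\<lambda>m. c * lookup P m)" by (rule ext) simp
  then show ?thesis by (simp add: wick_pairing_def source_ops_linear)
qed

lemma wick_pairing_sum: "wick_pairing ix fs (\<Sum>x\<in>S. P x) = (\<Sum>x\<in>S. wick_pairing ix fs (P x))"
proof -
  have "wick_pairing ix fs 0 = 0" using wick_pairing_mconst_mult[of ix fs 0 0] by simp
  then show ?thesis by (induction S rule: infinite_finite_induct) (simp_all add: wick_pairing_add)
qed

text \<open>Differentiating with respect to a source is adjoint to multiplying with it: a factor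
  \<open>J\<^sup>j\<^sub>\<nu>\<close> moves onto the functions that are evaluated at the point \<open>x\<^sub>j\<close>, where it differentiates.\<close>

lemma wick_pairing_mvar_mult:
  assumes "length ix = length fs"
  shows "wick_pairing ix fs (mvar (j, \<nu>) * P) =
    (\<Sum>a<length fs. if ix ! a = j then wick_pairing ix (fs[a := mpderiv \<nu> (fs ! a)]) P else 0)"
  unfolding wick_pairing_def lookup_mvar_mult source_ops_var_mult[OF assms] by (simp add: var_mult_def)

lemma wick_pairing_one:
  fixes fs :: "'m::finite fun_poly list"
  shows "length ix = length fs \<Longrightarrow> wick_pairing ix fs 1 = mconst (\<Prod>f\<leftarrow>fs. lookup f 0)"
proof -
  let ?one = "lookup (1 :: (nat \<times> 'm, even_poly) mpoly)"
  have add_zero_iff: "\<alpha> + \<beta> = 0 \<longleftrightarrow> \<alpha> = 0 \<and> \<beta> = 0" for \<alpha> \<beta> :: "nat \<times> 'm \<Rightarrow>\<^sub>0 nat"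
    by (auto simp: poly_mapping_eq_iff fun_eq_iff lookup_add)
  have mon_zero: "source_mon i m = 0 \<longleftrightarrow> m = 0" for i and m :: "'m \<Rightarrow>\<^sub>0 nat"
    by (auto simp: poly_mapping_eq_iff fun_eq_iff lookup_source_mon)
  have op: "source_op i f ?one = (\<lambda>\<beta>. mconst (lookup f 0) * ?one \<beta>)" for i and f :: "'m fun_poly"
  proof
    fix \<beta>
    show "source_op i f ?one \<beta> = mconst (lookup f 0) * ?one \<beta>"
      by (induction f rule: poly_mapping_sum_induct)
        (auto simp: source_op_single series_deriv_eq lookup_one when_def add_zero_iff mon_zero lookup_single
          source_op_add lookup_add distrib_right scaleR_eq_mconst_mult)
  qed
  assume "length ix = length fs"
  then have "source_ops ix fs ?one = (\<lambda>\<beta>. mconst (\<Prod>f\<leftarrow>fs. lookup f 0) * ?one \<beta>)"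
    by (induction ix fs rule: list_induct2) (auto intro!: ext simp: source_op_linear op mult.assoc mult.left_commute)
  then show ?thesis by (simp add: wick_pairing_def)
qed

lemma diff_at_commute: "diff_at \<mu> a (diff_at \<nu> b fs) = diff_at \<nu> b (diff_at \<mu> a fs)"
  by (cases "a - 1 < length fs"; cases "b - 1 < length fs")
    (auto simp: diff_at_def list_update_beyond nth_list_update mpderiv_commute intro!: nth_equalityI)

lemma length_diff_at [simp]: "length (diff_at \<mu> a fs) = length fs"
  by (simp add: diff_at_def)

lemma matrix_inv_left:
  assumes "invertible (A :: real^'n^'n)"
  shows "matrix_inv A ** A = mat 1"
  unfolding matrix_inv_def by (rule someI2_ex) (use assms in \<open>auto simp: invertible_def\<close>)

lemma matrix_inv_antisym:
  assumes "symplectic_form \<Omega>"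
  shows "matrix_inv \<Omega> $ \<mu> $ \<nu> = - matrix_inv \<Omega> $ \<nu> $ \<mu>"
proof -
  have inv: "invertible \<Omega>" and anti: "transpose \<Omega> = - \<Omega>" using assms by (auto simp: symplectic_form_def)
  note left = matrix_inv_left[OF inv]
  let ?T = "transpose (matrix_inv \<Omega>)"
  have neg: "(- A) ** B = - (A ** B)" "B ** (- A) = - (B ** A)" for A B :: "real^'a^'a"
    by (simp_all add: matrix_matrix_mult_def vec_eq_iff sum_negf)
  have "transpose \<Omega> ** ?T = mat 1"
    using left by (metis matrix_transpose_mul transpose_mat)
  then have "\<Omega> ** (- ?T) = mat 1" by (simp add: anti neg)
  then have "- ?T = matrix_inv \<Omega>"
    using left by (metis matrix_mul_assoc matrix_mul_lid matrix_mul_rid)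
  then have "(- ?T) $ \<mu> $ \<nu> = matrix_inv \<Omega> $ \<mu> $ \<nu>" by simp
  then show ?thesis by (simp add: transpose_def)
qed

text \<open>Directing every edge upwards picks one representative for each unoriented edge.\<close>

definition edge_pairs :: "nat \<Rightarrow> (nat \<times> nat) set" where
  "edge_pairs l = (SIGMA b:{1..l}. {1..<b})\<inverse>"

lemma mem_edge_pairs: "(a, b) \<in> edge_pairs l \<longleftrightarrow> 1 \<le> a \<and> a < b \<and> b \<le> l"
  by (auto simp: edge_pairs_def)

lemma finite_edge_pairs [simp]: "finite (edge_pairs l)"
  by (simp add: edge_pairs_def)

definition edge_words :: "nat \<Rightarrow> nat \<Rightarrow> digraph set" where
  "edge_words l k = {es. length es = k \<and> set es \<subseteq> edge_pairs l}"

lemma finite_edge_words [simp]: "finite (edge_words l k)"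
proof -
  have "edge_words l k = {es. set es \<subseteq> edge_pairs l \<and> length es = k}" by (auto simp: edge_words_def)
  then show ?thesis using finite_lists_length_eq[of "edge_pairs l" k] by simp
qed

lemma sum_edge_words_Suc:
  "(\<Sum>es\<in>edge_words l (Suc k). g es) = (\<Sum>e\<in>edge_pairs l. \<Sum>es\<in>edge_words l k. g (e # es))"
  unfolding sum.cartesian_product
  by (rule sum.reindex_bij_witness[where i = "\<lambda>(e, es). e # es" and j = "\<lambda>es. (hd es, tl es)"])
    (auto simp: edge_words_def length_Suc_conv)

definition edge_prod :: "nat list \<Rightarrow> digraph \<Rightarrow> even_poly" where
  "edge_prod ix es = (\<Prod>(a, b)\<leftarrow>es. t_even (ix ! (a - 1)) (ix ! (b - 1)))"

lemma edge_prod_simps [simp]: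
  "edge_prod ix [] = 1"
  "edge_prod ix ((a, b) # es) = t_even (ix ! (a - 1)) (ix ! (b - 1)) * edge_prod ix es"
  by (simp_all add: edge_prod_def)

lemma sum_symmetric_pairs:
  assumes "\<And>a b. h a b = h b a" "\<And>a. h a a = (0 :: 'v::real_vector)"
  shows "(\<Sum>a<l. \<Sum>b<l. h a b) = 2 *\<^sub>R (\<Sum>(a, b)\<in>edge_pairs l. h (a - 1) (b - 1))"
proof -
  have "(\<Sum>a<l. \<Sum>b<l. h a b) = 2 *\<^sub>R (\<Sum>b<l. \<Sum>a<b. h a b)"
  proof (induction l)
    case (Suc l)
    have "(\<Sum>a<Suc l. \<Sum>b<Suc l. h a b) = (\<Sum>a<l. \<Sum>b<l. h a b) + 2 *\<^sub>R (\<Sum>a<l. h a l)"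
      using assms by (simp add: sum.distrib scaleR_2)
    then show ?case using Suc by (simp add: scaleR_add_right)
  qed simp
  also have "(\<Sum>b<l. \<Sum>a<b. h a b) = (\<Sum>(a, b)\<in>edge_pairs l. h (a - 1) (b - 1))"
    unfolding sum.Sigma[OF finite_lessThan ballI[OF finite_lessThan]]
    by (rule sum.reindex_bij_witness[where i = "\<lambda>(a, b). (b - 1, a - 1)" and j = "\<lambda>(b, a). (Suc a, Suc b)"])
      (auto simp: mem_edge_pairs)
  finally show ?thesis .
qed

lemma sum_pairs_swap:
  "(\<Sum>a\<in>A. \<Sum>b\<in>B. \<Sum>c\<in>C. \<Sum>d\<in>D. g a b c d) =
    (\<Sum>c\<in>C. \<Sum>d\<in>D. \<Sum>a\<in>A. \<Sum>b\<in>B. g a b c d :: 'c::comm_monoid_add)"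
proof -
  have push: "(\<Sum>x\<in>X. \<Sum>c\<in>C. \<Sum>d\<in>D. h x c d) = (\<Sum>c\<in>C. \<Sum>d\<in>D. \<Sum>x\<in>X. h x c d :: 'c)"
    for X :: "'x set" and h
    by (rule trans[OF sum.swap], rule sum.cong[OF refl], rule sum.swap)
  show ?thesis
    by (rule trans[OF sum.cong[OF refl push] push])
qed

lemma sum_if_outside:
  "(\<Sum>x\<in>A. \<Sum>y\<in>B. if c then g x y else 0) = (if c then \<Sum>x\<in>A. \<Sum>y\<in>B. g x y else 0)"
  by simp

text \<open>The two factors \<open>J\<close> of a term of the quadratic form differentiate the functions at the vertices
  \<open>a\<close> and \<open>b\<close>. The terms with \<open>a = b\<close> vanish since \<open>t\<^sub>i\<^sub>i = 0\<close>; exchanging \<open>a\<close> and \<open>b\<close> changes the sign of both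
  \<open>\<Omega>\<^sup>-\<^sup>1\<close> and \<open>t\<^sub>i\<^sub>j\<close>, so that the factor \<open>1/2\<close> restricts the sum to \<open>a < b\<close>.\<close>

lemma wick_pairing_source_form:
  fixes fs :: "'m::finite fun_poly list"
  assumes sympl: "symplectic_form \<Omega>" and ix: "ix \<in> index_lists N (length fs)"
  shows "wick_pairing ix fs (source_form \<Omega> N * P) =
    (\<Sum>(a, b)\<in>edge_pairs (length fs). t_even (ix ! (a - 1)) (ix ! (b - 1)) *
      (\<Sum>\<mu>\<in>UNIV. \<Sum>\<nu>\<in>UNIV. (matrix_inv \<Omega> $ \<mu> $ \<nu>) *\<^sub>R wick_pairing ix (diff_at \<nu> b (diff_at \<mu> a fs)) P))"
proof -
  let ?l = "length fs"
  let ?J = "\<lambda>fs. wick_pairing ix fs P"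
  let ?T = "\<lambda>i j \<mu> \<nu> a b. if ix ! a = i \<and> ix ! b = j
      then ((matrix_inv \<Omega> $ \<mu> $ \<nu>) *\<^sub>R t_even i j) * ?J (diff_at \<nu> (Suc b) (diff_at \<mu> (Suc a) fs)) else 0"
  have len: "length ix = ?l" and range: "a < ?l \<Longrightarrow> ix ! a \<in> {1..N}" for a
    using ix by (auto simp: index_lists_def subset_iff)
  define h where "h a b = t_even (ix ! a) (ix ! b) * (\<Sum>\<mu>\<in>UNIV. \<Sum>\<nu>\<in>UNIV. (matrix_inv \<Omega> $ \<mu> $ \<nu>) *\<^sub>R
      ?J (diff_at \<nu> (Suc b) (diff_at \<mu> (Suc a) fs)))" for a b
  have summand: "wick_pairing ix fs (mvar (i, \<mu>) * mconst c * mvar (j, \<nu>) * P) =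
    (\<Sum>a<?l. \<Sum>b<?l. if ix ! a = i \<and> ix ! b = j then c * ?J (diff_at \<nu> (Suc b) (diff_at \<mu> (Suc a) fs)) else 0)"
    for i j \<mu> \<nu> c
  proof -
    have "wick_pairing ix fs (mvar (i, \<mu>) * mconst c * mvar (j, \<nu>) * P) =
        c * wick_pairing ix fs (mvar (i, \<mu>) * (mvar (j, \<nu>) * P))"
      by (simp add: mult_ac flip: wick_pairing_mconst_mult)
    also have "\<dots> = c * (\<Sum>a<?l. if ix ! a = i then \<Sum>b<?l. if ix ! b = j
        then ?J (diff_at \<nu> (Suc b) (diff_at \<mu> (Suc a) fs)) else 0 else 0)"
      using len by (simp add: wick_pairing_mvar_mult diff_at_def cong: if_cong)
    finally show ?thesis by (simp add: sum_distrib_left if_distrib cong: if_cong sum.cong)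
        (intro sum.cong refl, simp)
  qed
  have "wick_pairing ix fs (source_form \<Omega> N * P) =
    (1 / 2) *\<^sub>R (\<Sum>i\<in>{1..N}. \<Sum>j\<in>{1..N}. \<Sum>\<mu>\<in>UNIV. \<Sum>\<nu>\<in>UNIV. \<Sum>a<?l. \<Sum>b<?l. ?T i j \<mu> \<nu> a b)"
    unfolding source_form_def scaleR_eq_mconst_mconst_mult mult.assoc[of "mconst (mconst (1 / 2))"] wick_pairing_mconst_mult
      sum_distrib_right wick_pairing_sum summand by (simp add: scaleR_eq_mconst_mult)
  also have "(\<Sum>i\<in>{1..N}. \<Sum>j\<in>{1..N}. \<Sum>\<mu>\<in>UNIV. \<Sum>\<nu>\<in>UNIV. \<Sum>a<?l. \<Sum>b<?l. ?T i j \<mu> \<nu> a b) =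
    (\<Sum>i\<in>{1..N}. \<Sum>j\<in>{1..N}. \<Sum>a<?l. \<Sum>b<?l. if ix ! a = i \<and> ix ! b = j then h a b else 0)"
  proof (intro sum.cong[OF refl])
    fix i j
    have "(\<Sum>\<mu>\<in>UNIV. \<Sum>\<nu>\<in>UNIV. \<Sum>a<?l. \<Sum>b<?l. ?T i j \<mu> \<nu> a b) =
      (\<Sum>a<?l. \<Sum>b<?l. \<Sum>\<mu>\<in>UNIV. \<Sum>\<nu>\<in>UNIV. ?T i j \<mu> \<nu> a b)"
      by (rule sum_pairs_swap)
    also have "\<dots> = (\<Sum>a<?l. \<Sum>b<?l. if ix ! a = i \<and> ix ! b = j then h a b else 0)"
      unfolding sum_if_outside by (intro sum.cong refl) (simp add: h_def sum_distrib_left)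
    finally show "(\<Sum>\<mu>\<in>UNIV. \<Sum>\<nu>\<in>UNIV. \<Sum>a<?l. \<Sum>b<?l. ?T i j \<mu> \<nu> a b) =
      (\<Sum>a<?l. \<Sum>b<?l. if ix ! a = i \<and> ix ! b = j then h a b else 0)" .
  qed
  also have "\<dots> = (\<Sum>a<?l. \<Sum>b<?l. \<Sum>i\<in>{1..N}. \<Sum>j\<in>{1..N}. if ix ! a = i \<and> ix ! b = j then h a b else 0)"
    by (rule sum_pairs_swap)
  also have "\<dots> = (\<Sum>a<?l. \<Sum>b<?l. h a b)"
  proof (intro sum.cong[OF refl])
    fix a b assume "a \<in> {..<?l}" "b \<in> {..<?l}"
    then have r: "ix ! a \<in> {1..N}" "ix ! b \<in> {1..N}" using range by auto
    have "(\<Sum>i\<in>{1..N}. \<Sum>j\<in>{1..N}. if ix ! a = i \<and> ix ! b = j then h a b else 0) =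
        (\<Sum>i\<in>{1..N}. if i = ix ! a then \<Sum>j\<in>{1..N}. if j = ix ! b then h a b else 0 else 0)"
      by (intro sum.cong refl) (auto intro!: sum.cong)
    also have "\<dots> = h a b" using r by (simp add: sum.delta)
    finally show "(\<Sum>i\<in>{1..N}. \<Sum>j\<in>{1..N}. if ix ! a = i \<and> ix ! b = j then h a b else 0) = h a b" .
  qed
  also have "\<dots> = 2 *\<^sub>R (\<Sum>(a, b)\<in>edge_pairs ?l. h (a - 1) (b - 1))"
  proof (rule sum_symmetric_pairs)
    fix a b
    have "(\<Sum>\<mu>\<in>UNIV. \<Sum>\<nu>\<in>UNIV. (matrix_inv \<Omega> $ \<mu> $ \<nu>) *\<^sub>R ?J (diff_at \<nu> (Suc b) (diff_at \<mu> (Suc a) fs))) =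
        - (\<Sum>\<mu>\<in>UNIV. \<Sum>\<nu>\<in>UNIV. (matrix_inv \<Omega> $ \<nu> $ \<mu>) *\<^sub>R ?J (diff_at \<mu> (Suc a) (diff_at \<nu> (Suc b) fs)))"
      unfolding sum_negf[symmetric]
      by (intro sum.cong refl) (subst matrix_inv_antisym[OF sympl], simp add: diff_at_commute)
    also have "\<dots> = - (\<Sum>\<nu>\<in>UNIV. \<Sum>\<mu>\<in>UNIV. (matrix_inv \<Omega> $ \<nu> $ \<mu>) *\<^sub>R ?J (diff_at \<mu> (Suc a) (diff_at \<nu> (Suc b) fs)))"
      by (subst sum.swap) simp
    finally show "h a b = h b a" unfolding h_def by (subst t_even_swap) simp
  qed (simp add: h_def)
  also have "(\<Sum>(a, b)\<in>edge_pairs ?l. h (a - 1) (b - 1)) =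
      (\<Sum>(a, b)\<in>edge_pairs ?l. t_even (ix ! (a - 1)) (ix ! (b - 1)) *
      (\<Sum>\<mu>\<in>UNIV. \<Sum>\<nu>\<in>UNIV. (matrix_inv \<Omega> $ \<mu> $ \<nu>) *\<^sub>R ?J (diff_at \<nu> b (diff_at \<mu> a fs))))"
    by (intro sum.cong refl) (auto simp: h_def mem_edge_pairs)
  finally show ?thesis by simp
qed

text \<open>Each of the \<open>k\<close> factors of the quadratic form becomes one edge.\<close>

lemma wick_pairing_power:
  assumes "symplectic_form \<Omega>" and "ix \<in> index_lists N l" and "length fs = l"
  shows "wick_pairing ix fs (source_form \<Omega> N ^ k) =
    (\<Sum>es\<in>edge_words l k. graph_coeff \<Omega> es fs *\<^sub>R edge_prod ix es)"
  using assms(3)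
proof (induction k arbitrary: fs)
  case 0
  have "edge_words l 0 = {[]}" by (auto simp: edge_words_def)
  then show ?case using 0 assms by (simp add: wick_pairing_one index_lists_def scaleR_eq_mconst_mult)
next
  case (Suc k)
  let ?c = "\<lambda>a b es. graph_coeff \<Omega> ((a, b) # es) fs"
  let ?D = "\<lambda>a b. \<Sum>\<mu>\<in>UNIV. \<Sum>\<nu>\<in>UNIV. (matrix_inv \<Omega> $ \<mu> $ \<nu>) *\<^sub>R
    (\<Sum>es\<in>edge_words l k. graph_coeff \<Omega> es (diff_at \<nu> b (diff_at \<mu> a fs)) *\<^sub>R edge_prod ix es)"
  have "wick_pairing ix fs (source_form \<Omega> N ^ Suc k) =
    (\<Sum>(a, b)\<in>edge_pairs l. t_even (ix ! (a - 1)) (ix ! (b - 1)) *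
      ?D a b)"
    using assms(1,2) Suc by (simp add: wick_pairing_source_form)
  also have "\<dots> = (\<Sum>(a, b)\<in>edge_pairs l. \<Sum>es\<in>edge_words l k.
      ?c a b es *\<^sub>R edge_prod ix ((a, b) # es))"
  proof (intro sum.cong[OF refl], clarify)
    fix a b
    have "?D a b =
      (\<Sum>es\<in>edge_words l k. ?c a b es *\<^sub>R edge_prod ix es)"
      by (simp add: scaleR_sum_right scaleR_sum_left sum.swap[of _ "edge_words l k"])
    then show "t_even (ix ! (a - 1)) (ix ! (b - 1)) * ?D a b =
      (\<Sum>es\<in>edge_words l k. ?c a b es *\<^sub>R edge_prod ix ((a, b) # es))"
      by (simp add: sum_distrib_left del: graph_coeff.simps)
  qed
  also have "\<dots> = (\<Sum>es\<in>edge_words l (Suc k). graph_coeff \<Omega> es fs *\<^sub>R edge_prod ix es)"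
    by (simp add: sum_edge_words_Suc split_def del: graph_coeff.simps edge_prod_simps)
  finally show ?case .
qed

lemma mon_degree_superset:
  "finite S \<Longrightarrow> keys m \<subseteq> S \<Longrightarrow> mon_degree m = (\<Sum>x\<in>S. lookup m x)"
  unfolding mon_degree_def by (rule sum.mono_neutral_left) (auto simp: in_keys_iff)

lemma mon_degree_add: "mon_degree (m + n) = mon_degree m + mon_degree n"
proof -
  let ?S = "keys m \<union> keys n"
  have "mon_degree (m + n) = (\<Sum>x\<in>?S. lookup (m + n) x)"
    by (rule mon_degree_superset) (auto dest: subsetD[OF keys_add])
  also have "\<dots> = (\<Sum>x\<in>?S. lookup m x) + (\<Sum>x\<in>?S. lookup n x)"
    by (simp add: lookup_add sum.distrib)
  also have "\<dots> = mon_degree m + mon_degree n"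
    by (intro arg_cong2[where f = "(+)"] mon_degree_superset[symmetric]) auto
  finally show ?thesis .
qed

lemma mon_degree_simps [simp]: "mon_degree 0 = 0" "mon_degree (single x k) = k"
  by (simp_all add: mon_degree_def)

lemma mon_degree_source_mon [simp]: "mon_degree (source_mon i m) = mon_degree m"
proof -
  have sum: "mon_degree (sum f S) = (\<Sum>x\<in>S. mon_degree (f x))" for f :: "'b \<Rightarrow> (nat \<times> 'a \<Rightarrow>\<^sub>0 nat)" and S
    by (induction S rule: infinite_finite_induct) (simp_all add: mon_degree_add)
  show ?thesis by (simp add: source_mon_def sum mon_degree_superset[of UNIV m])
qed

definition fun_degree :: "'m fun_poly \<Rightarrow> nat" where
  "fun_degree f = Max (insert 0 (mon_degree ` keys f))"

definition total_degree :: "'m fun_poly list \<Rightarrow> nat" where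
  "total_degree fs = (\<Sum>f\<leftarrow>fs. fun_degree f)"

lemma mon_degree_le_fun_degree: "m \<in> keys f \<Longrightarrow> mon_degree m \<le> fun_degree f"
  by (simp add: fun_degree_def)

lemma fun_degree_mpderiv:
  assumes "mpderiv \<mu> f \<noteq> (0 :: 'm fun_poly)"
  shows "fun_degree (mpderiv \<mu> f) < fun_degree f"
proof -
  have shift: "mon_degree m < fun_degree f" if "m \<in> keys (mpderiv \<mu> f)" for m
  proof -
    have "m + single \<mu> 1 \<in> keys f"
      using that by (auto simp: in_keys_iff lookup_mpderiv)
    from mon_degree_le_fun_degree[OF this] show ?thesis by (simp add: mon_degree_add)
  qed
  obtain m where "m \<in> keys (mpderiv \<mu> f)" using assms by (metis all_not_in_conv keys_eq_empty)
  then have "0 < fun_degree f" using shift[of m] by simp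
  then show ?thesis using shift by (auto simp: fun_degree_def[of "mpderiv \<mu> f"] Max_less_iff)
qed

text \<open>A differential operator of degree \<open>d\<close>, evaluated at vanishing sources, sees a series only up to
  degree \<open>d\<close>. This allows the exponential series to be truncated.\<close>

lemma source_op_cong:
  assumes "\<And>\<gamma>. mon_degree \<gamma> \<le> d + fun_degree f \<Longrightarrow> F \<gamma> = G \<gamma>" and "mon_degree \<beta> \<le> d"
  shows "source_op i f F \<beta> = source_op i f G \<beta>"
  unfolding source_op_eq
proof (intro sum.cong refl arg_cong2[where f = scaleR])
  fix m assume "m \<in> keys f"
  then have "F (source_mon i m + \<beta>) = G (source_mon i m + \<beta>)"
    using mon_degree_le_fun_degree[of m f] assms(2) by (intro assms(1)) (simp add: mon_degree_add)
  then show "series_deriv (source_mon i m) F \<beta> = series_deriv (source_mon i m) G \<beta>"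
    by (simp add: series_deriv_def)
qed

lemma source_ops_cong:
  assumes "\<And>\<gamma>. mon_degree \<gamma> \<le> d + total_degree fs \<Longrightarrow> F \<gamma> = G \<gamma>" and "mon_degree \<beta> \<le> d"
  shows "source_ops ix fs F \<beta> = source_ops ix fs G \<beta>"
  using assms
proof (induction ix fs arbitrary: d \<beta> rule: list_induct2')
  case (4 i ix f fs)
  have "source_ops ix fs F \<gamma> = source_ops ix fs G \<gamma>" if "mon_degree \<gamma> \<le> d + fun_degree f" for \<gamma>
    using 4(2) that by (intro 4(1)[of "d + fun_degree f"]) (simp_all add: total_degree_def add.assoc)
  then show ?case using 4(3) by (auto intro: source_op_cong)
qed auto

lemma lookup_source_form_power:
  "mon_degree m < k \<Longrightarrow> lookup (source_form \<Omega> N ^ k) m = 0"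
proof (induction k arbitrary: m)
  case (Suc k)
  have var: "lookup (mvar x * P) m = 0"
    if "\<And>m. mon_degree m < d \<Longrightarrow> lookup P m = 0" "mon_degree m < Suc d"
    for P :: "(nat \<times> 'a, even_poly) mpoly" and x d m
  proof (cases "lookup m x = 0")
    case False
    then have "mon_degree m = Suc (mon_degree (m - single x 1))"
      using mon_degree_add[of "m - single x 1" "single x 1"]
      by (simp only: add_single_diff[OF False] mon_degree_simps)
    then show ?thesis using that by (simp add: lookup_mvar_mult var_mult_def)
  qed (simp add: lookup_mvar_mult var_mult_def)
  have deg2: "lookup (mvar x * mconst c * mvar y * source_form \<Omega> N ^ k) m = 0" for x y c
  proof -
    have "lookup (mvar y * source_form \<Omega> N ^ k) m = 0" if "mon_degree m < Suc k" for m
      using var[OF Suc.IH that] .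
    from var[where d = "Suc k" and m = m, OF this] have "lookup (mvar x * (mvar y * source_form \<Omega> N ^ k)) m = 0"
      using Suc.prems by simp
    then have "lookup (mconst c * (mvar x * (mvar y * source_form \<Omega> N ^ k))) m = 0" by simp
    then show ?thesis by (simp add: mult_ac del: lookup_mconst_mult)
  qed
  have half: "((1 / 2) *\<^sub>R Q) * P = (1 / 2) *\<^sub>R (Q * P)" for Q P :: "(nat \<times> 'a, even_poly) mpoly"
    by (simp add: scaleR_eq_mconst_mconst_mult mult.assoc)
  show ?case
    unfolding power_Suc by (subst (1) source_form_def) (simp add: half sum_distrib_right lookup_sum deg2)
qed simp

text \<open>The coefficient of \<open>t\<^sub>i\<^sub>1 \<cdots> t\<^sub>i\<^sub>l\<close> in the Gaussian integral.\<close>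

definition wick_coeff :: "real^'m^'m \<Rightarrow> nat \<Rightarrow> 'm::finite fun_poly list \<Rightarrow> nat list \<Rightarrow> even_poly" where
  "wick_coeff \<Omega> N fs ix = source_ops ix fs (series_exp (source_form \<Omega> N)) 0"

lemma correlator_eq_index_sum:
  "correlator \<Omega> N fs = index_sum N (length fs) (wick_coeff \<Omega> N fs)"
  by (simp add: correlator_def index_sum_def wick_coeff_def source_ops_def odd_word_def)

lemma digraph_poly_eq_index_sum: "digraph_poly N l es = index_sum N l (\<lambda>ix. edge_prod ix es)"
  by (simp add: digraph_poly_def index_sum_def edge_prod_def odd_word_def)

text \<open>The bound \<open>K\<close> is arbitrary above the degree, so that the expansions for several lists of functions
  can be cut off at the same order.\<close>

theorem wick_coeff_expansion:
  assumes "symplectic_form \<Omega>" and ix: "ix \<in> index_lists N l" and "length fs = l" and K: "total_degree fs \<le> K"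
  shows "wick_coeff \<Omega> N fs ix =
    (\<Sum>k\<le>K. \<Sum>es\<in>edge_words l k. (graph_coeff \<Omega> es fs / fact k) *\<^sub>R edge_prod ix es)"
proof -
  define E where "E = (\<Sum>k\<le>K. mconst (mconst (1 / fact k)) * source_form \<Omega> N ^ k)"
  have "wick_coeff \<Omega> N fs ix = source_ops ix fs (lookup E) 0"
    unfolding wick_coeff_def
  proof (rule source_ops_cong[where d = 0])
    fix \<gamma> :: "nat \<times> 'a \<Rightarrow>\<^sub>0 nat" assume "mon_degree \<gamma> \<le> 0 + total_degree fs"
    then have "mon_degree \<gamma> \<le> K" using K by simp
    then have "series_exp (source_form \<Omega> N) \<gamma> =
        (\<Sum>k\<le>K. (1 / fact k) *\<^sub>R lookup (source_form \<Omega> N ^ k) \<gamma>)"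
      unfolding series_exp_def by (intro sum.mono_neutral_left) (auto simp: lookup_source_form_power)
    then show "series_exp (source_form \<Omega> N) \<gamma> = lookup E \<gamma>"
      by (simp add: E_def lookup_sum scaleR_eq_mconst_mult)
  qed simp
  also have "\<dots> = (\<Sum>k\<le>K. mconst (1 / fact k) * wick_pairing ix fs (source_form \<Omega> N ^ k))"
    by (simp add: E_def wick_pairing_sum wick_pairing_mconst_mult flip: wick_pairing_def)
  also have "\<dots> = (\<Sum>k\<le>K. \<Sum>es\<in>edge_words l k. (graph_coeff \<Omega> es fs / fact k) *\<^sub>R edge_prod ix es)"
    using assms by (simp add: wick_pairing_power scaleR_sum_right flip: scaleR_eq_mconst_mult)
  finally show ?thesis .
qed

section \<open>The sum over multigraphs\<close>

lemma zero_mem_diff_at: "0 \<in> set fs \<Longrightarrow> 0 \<in> set (diff_at \<mu> a fs)"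
proof -
  assume "0 \<in> set fs"
  then obtain i where i: "i < length fs" "fs ! i = 0" by (auto simp: in_set_conv_nth)
  then have "diff_at \<mu> a fs ! i = 0" by (cases "i = a - 1") (auto simp: diff_at_def)
  with i show ?thesis by (metis length_diff_at nth_mem)
qed

lemma total_degree_diff_at_eq:
  assumes "a - 1 < length fs"
  shows "total_degree (diff_at \<mu> a fs) + fun_degree (fs ! (a - 1)) =
    total_degree fs + fun_degree (mpderiv \<mu> (fs ! (a - 1)))"
proof -
  have "fs = take (a - 1) fs @ fs ! (a - 1) # drop (Suc (a - 1)) fs" using assms by (rule id_take_nth_drop)
  from arg_cong[OF this, of total_degree] show ?thesis
    unfolding diff_at_def upd_conv_take_nth_drop[OF assms] by (simp add: total_degree_def)
qed

lemma total_degree_diff_at: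
  assumes "a - 1 < length fs"
  shows "0 \<in> set (diff_at \<mu> a fs) \<or> total_degree (diff_at \<mu> a fs) < total_degree fs"
proof (cases "mpderiv \<mu> (fs ! (a - 1)) = 0")
  case True
  then show ?thesis using assms by (auto simp: diff_at_def set_update_memI)
next
  case False
  then show ?thesis using fun_degree_mpderiv[OF False] total_degree_diff_at_eq[OF assms, of \<mu>] by linarith
qed

lemma total_degree_diff_at_le: "total_degree (diff_at \<mu> a fs) \<le> total_degree fs"
proof (cases "a - 1 < length fs")
  case True
  have "fun_degree (mpderiv \<mu> (fs ! (a - 1))) \<le> fun_degree (fs ! (a - 1))"
    using fun_degree_mpderiv[of \<mu> "fs ! (a - 1)"]
    by (cases "mpderiv \<mu> (fs ! (a - 1)) = 0") (auto simp: fun_degree_def[of 0])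
  then show ?thesis using total_degree_diff_at_eq[OF True, of \<mu>] by linarith
qed (simp add: diff_at_def list_update_beyond)

text \<open>Each edge either annihilates one of the functions or lowers the total degree; hence only
  finitely many graphs contribute.\<close>

lemma graph_coeff_eq_zero:
  assumes "set es \<subseteq> {1..length fs} \<times> {1..length fs}" "0 \<in> set fs \<or> total_degree fs < length es"
  shows "graph_coeff \<Omega> es fs = 0"
  using assms
proof (induction es arbitrary: fs)
  case Nil
  then show ?case by (auto simp: prod_list_zero_iff image_iff intro!: bexI[of _ 0])
next
  case (Cons e es)
  obtain a b where e: "e = (a, b)" by (cases e)
  have "graph_coeff \<Omega> es (diff_at \<nu> b (diff_at \<mu> a fs)) = 0" for \<mu> \<nu>
  proof (rule Cons.IH)
    show "set es \<subseteq> {1..length (diff_at \<nu> b (diff_at \<mu> a fs))} \<times> {1..length (diff_at \<nu> b (diff_at \<mu> a fs))}"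
      using Cons.prems by simp
    have "a - 1 < length fs" "b - 1 < length (diff_at \<mu> a fs)" using Cons.prems e by auto
    from total_degree_diff_at[OF this(1), of \<mu>] total_degree_diff_at[OF this(2), of \<nu>] Cons.prems(2)
    show "0 \<in> set (diff_at \<nu> b (diff_at \<mu> a fs)) \<or>
        total_degree (diff_at \<nu> b (diff_at \<mu> a fs)) < length es"
      using zero_mem_diff_at by (smt (verit) length_Cons less_Suc_eq less_trans_Suc linorder_not_less not_less_eq)
  qed
  then show ?case by (simp add: e)
qed

lemma graph_coeff_cong_tail:
  "(\<And>fs. graph_coeff \<Omega> es fs = graph_coeff \<Omega> es' fs) \<Longrightarrow> graph_coeff \<Omega> (e # es) fs = graph_coeff \<Omega> (e # es') fs"
  by (cases e) simp

text \<open>The operators of two edges commute because partial derivatives do.\<close>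

lemma graph_coeff_swap: "graph_coeff \<Omega> (e # e' # es) fs = graph_coeff \<Omega> (e' # e # es) fs"
proof -
  obtain a b c d where e: "e = (a, b)" "e' = (c, d)" by (metis surj_pair)
  have "diff_at \<sigma> d (diff_at \<rho> c (diff_at \<nu> b (diff_at \<mu> a fs))) =
      diff_at \<nu> b (diff_at \<mu> a (diff_at \<sigma> d (diff_at \<rho> c fs)))" for \<mu> \<nu> \<rho> \<sigma>
    by (metis diff_at_commute)
  then show ?thesis unfolding e graph_coeff.simps sum_distrib_left
    by (subst sum_pairs_swap) (simp add: mult_ac)
qed

lemma graph_coeff_move: "graph_coeff \<Omega> (xs @ e # ys) fs = graph_coeff \<Omega> (e # xs @ ys) fs"
proof (induction xs arbitrary: fs)
  case (Cons x xs)
  have "graph_coeff \<Omega> (x # xs @ e # ys) fs = graph_coeff \<Omega> (x # e # xs @ ys) fs"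
    by (rule graph_coeff_cong_tail) (rule Cons.IH)
  then show ?case using graph_coeff_swap[of \<Omega> x e "xs @ ys" fs] by simp
qed simp

lemma graph_coeff_mset: "mset es = mset es' \<Longrightarrow> graph_coeff \<Omega> es fs = graph_coeff \<Omega> es' fs"
proof (induction es arbitrary: es' fs)
  case (Cons e es)
  from Cons.prems have "e \<in> set es'" by (metis list.set_intros(1) set_mset_mset)
  then obtain xs ys where es': "es' = xs @ e # ys" by (meson split_list)
  with Cons.prems have "mset es = mset (xs @ ys)" by simp
  from Cons.IH[OF this] show ?case unfolding es' graph_coeff_move by (rule graph_coeff_cong_tail)
qed simp

lemma edge_prod_mset:
  assumes "mset es = mset es'"
  shows "edge_prod ix es = edge_prod ix es'"
  using prod_mset_prod_list[of "map (\<lambda>(a, b). t_even (ix ! (a - 1)) (ix ! (b - 1))) es"]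
    prod_mset_prod_list[of "map (\<lambda>(a, b). t_even (ix ! (a - 1)) (ix ! (b - 1))) es'"] assms
  by (simp add: edge_prod_def)

text \<open>\<open>\<Omega>\<^sup>-\<^sup>1\<close> is antisymmetric.\<close>

lemma graph_coeff_flip:
  assumes "symplectic_form \<Omega>"
  shows "graph_coeff \<Omega> ((b, a) # es) fs = - graph_coeff \<Omega> ((a, b) # es) fs"
proof -
  have "graph_coeff \<Omega> ((b, a) # es) fs = (\<Sum>\<nu>\<in>UNIV. \<Sum>\<mu>\<in>UNIV.
      matrix_inv \<Omega> $ \<mu> $ \<nu> * graph_coeff \<Omega> es (diff_at \<nu> a (diff_at \<mu> b fs)))"
    unfolding graph_coeff.simps by (rule sum.swap)
  also have "\<dots> = - graph_coeff \<Omega> ((a, b) # es) fs"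
    unfolding graph_coeff.simps sum_negf[symmetric]
    by (intro sum.cong refl) (subst matrix_inv_antisym[OF assms], simp add: diff_at_commute)
  finally show ?thesis .
qed

definition upward :: "digraph \<Rightarrow> digraph" where
  "upward es = map (\<lambda>(a, b). (min a b, max a b)) es"

lemma mset_upward: "mset (upward es) = image_mset (\<lambda>e. (Min e, Max e)) (underlying es)"
  by (simp add: upward_def underlying_def image_mset.compositionality comp_def split_def)

text \<open>Reversing an edge changes the sign of both the coefficient and the monomial.\<close>

lemma upward_sign:
  assumes "symplectic_form \<Omega>"
  shows "\<exists>s::real. s * s = 1 \<and> (\<forall>fs. graph_coeff \<Omega> (upward es) fs = s * graph_coeff \<Omega> es fs) \<and>
    (\<forall>ix. edge_prod ix (upward es) = s *\<^sub>R edge_prod ix es)"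
proof (induction es)
  case Nil
  show ?case by (intro exI[of _ 1]) (simp add: upward_def)
next
  case (Cons e es)
  then obtain s :: real where s: "s * s = 1" "\<And>fs. graph_coeff \<Omega> (upward es) fs = s * graph_coeff \<Omega> es fs"
    "\<And>ix. edge_prod ix (upward es) = s *\<^sub>R edge_prod ix es" by auto
  obtain a b where e: "e = (a, b)" by (cases e)
  have tail: "graph_coeff \<Omega> ((c, d) # upward es) fs = s * graph_coeff \<Omega> ((c, d) # es) fs" for c d fs
    by (simp add: s(2) sum_distrib_left mult_ac)
  show ?case
  proof (cases "a \<le> b")
    case True
    then have "upward (e # es) = (a, b) # upward es" by (simp add: upward_def e)
    then show ?thesis using s(1) tail[of a b] by (intro exI[of _ s]) (auto simp: s(3) e simp del: graph_coeff.simps)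
  next
    case False
    then have "upward (e # es) = (b, a) # upward es" by (simp add: upward_def e)
    moreover have "edge_prod ix ((b, a) # upward es) = (- s) *\<^sub>R edge_prod ix ((a, b) # es)" for ix
      using t_even_swap[of "ix ! (b - 1)" "ix ! (a - 1)"] by (simp add: s(3))
    moreover have "graph_coeff \<Omega> ((b, a) # upward es) fs = (- s) * graph_coeff \<Omega> ((a, b) # es) fs" for fs
      unfolding tail graph_coeff_flip[OF assms, of b a] by (simp del: graph_coeff.simps)
    ultimately show ?thesis unfolding e using s(1) by (intro exI[of _ "- s"]) (simp del: graph_coeff.simps edge_prod_simps)
  qed
qed

lemma graph_coeff_underlying:
  assumes "symplectic_form \<Omega>" "underlying es = underlying es'"
  shows "graph_coeff \<Omega> es fs *\<^sub>R edge_prod ix es = graph_coeff \<Omega> es' fs *\<^sub>R edge_prod ix es'"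
proof -
  have up: "graph_coeff \<Omega> (upward es) fs *\<^sub>R edge_prod ix (upward es) = graph_coeff \<Omega> es fs *\<^sub>R edge_prod ix es" for es
  proof -
    obtain s :: real where s: "s * s = 1" "graph_coeff \<Omega> (upward es) fs = s * graph_coeff \<Omega> es fs"
      "edge_prod ix (upward es) = s *\<^sub>R edge_prod ix es"
      using upward_sign[OF assms(1), of es] by auto
    have "(s * graph_coeff \<Omega> es fs * s) = graph_coeff \<Omega> es fs * (s * s)" by (simp only: mult_ac)
    then show ?thesis by (simp add: s)
  qed
  have "mset (upward es) = mset (upward es')" using assms by (simp add: mset_upward)
  from graph_coeff_mset[OF this, of \<Omega> fs] edge_prod_mset[OF this, of ix] show ?thesis
    using up[of es] up[of es'] by simp
qed

lemma underlying_edge_word: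
  assumes "es \<in> edge_words l k"
  shows "underlying es \<in> multigraphs l" "size (underlying es) = k" "upward es = es"
proof -
  have e: "1 \<le> a \<and> a < b \<and> b \<le> l" if "(a, b) \<in> set es" for a b
    using assms that by (auto simp: edge_words_def mem_edge_pairs subset_iff)
  show "underlying es \<in> multigraphs l" using e by (fastforce simp: multigraphs_def underlying_def)
  show "size (underlying es) = k" using assms by (simp add: underlying_def edge_words_def)
  show "upward es = es" unfolding upward_def using e by (intro map_idI) (force simp: min_def max_def)
qed

text \<open>The words that name \<open>G\<close> are the arrangements of the multiset of its upward edges, and
  \<open>#P(G)\<close> is the order of the stabilizer of such an arrangement.\<close>

lemma edge_words_of_multigraph:
  assumes G: "G \<in> multigraphs l"
  defines "M \<equiv> image_mset (\<lambda>e. (Min e, Max e)) G"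
  shows "{es \<in> edge_words l (size G). underlying es = G} = permutations_of_multiset M"
    and "(\<Prod>x\<in>set_mset M. fact (count M x)) = parallel_factor l G"
proof -
  have e: "\<exists>a b. e = {a, b} \<and> 1 \<le> a \<and> a < b \<and> b \<le> l" if "e \<in># G" for e
  proof -
    have "e \<subseteq> {1..l}" "card e = 2" using G that by (auto simp: multigraphs_def)
    then obtain a b where "e = {a, b}" "a \<noteq> b" by (auto simp: card_2_iff)
    then show ?thesis using \<open>e \<subseteq> {1..l}\<close> by (cases a b rule: linorder_cases) auto
  qed
  have M_pairs: "set_mset M \<subseteq> edge_pairs l" using e by (fastforce simp: M_def mem_edge_pairs)
  have unfold_M: "image_mset (\<lambda>(a, b). {a, b}) M = G"
  proof -
    have "image_mset (\<lambda>(a, b). {a, b}) M = image_mset (\<lambda>e. {Min e, Max e}) G"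
      by (simp add: M_def image_mset.compositionality comp_def)
    also have "\<dots> = image_mset (\<lambda>e. e) G" using e by (intro image_mset_cong) fastforce
    finally show ?thesis by simp
  qed
  show "{es \<in> edge_words l (size G). underlying es = G} = permutations_of_multiset M"
  proof (intro set_eqI iffI)
    fix es assume "es \<in> {es \<in> edge_words l (size G). underlying es = G}"
    then show "es \<in> permutations_of_multiset M"
      using mset_upward[of es] underlying_edge_word(3)[of es] by (auto simp: permutations_of_multiset_def M_def)
  next
    fix es assume "es \<in> permutations_of_multiset M"
    then have es: "mset es = M" by (simp add: permutations_of_multiset_def)
    then have "set es \<subseteq> edge_pairs l" using M_pairs by (metis set_mset_mset)
    moreover have "length es = size G" using es by (metis M_def size_image_mset size_mset)
    moreover have "underlying es = G" using es unfold_M by (simp add: underlying_def)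
    ultimately show "es \<in> {es \<in> edge_words l (size G). underlying es = G}" by (simp add: edge_words_def)
  qed
  have cnt: "count G {a, b} = count M (a, b)" if "(a, b) \<in> edge_pairs l" for a b
  proof -
    have "{x. x \<in># M \<and> {a, b} = (case x of (a, b) \<Rightarrow> {a, b})} \<subseteq> {(a, b)}"
      using M_pairs that by (fastforce simp: mem_edge_pairs doubleton_eq_iff)
    then have "(\<Sum>x | x \<in># M \<and> {a, b} = (case x of (a, b) \<Rightarrow> {a, b}). count M x) = (\<Sum>x\<in>{(a, b)}. count M x)"
      by (intro sum.mono_neutral_left) (auto simp: not_in_iff)
    then show ?thesis by (subst unfold_M[symmetric]) (simp add: count_image_mset')
  qed
  have "parallel_factor l G = (\<Prod>(a, b)\<in>edge_pairs l. fact (count G {a, b}))"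
    unfolding parallel_factor_def by (subst prod.Sigma)
      (auto simp: mem_edge_pairs intro!: prod.reindex_bij_witness[where i = "\<lambda>(a, b). (b, a)" and j = "\<lambda>(a, b). (b, a)"])
  also have "\<dots> = (\<Prod>x\<in>edge_pairs l. fact (count M x))"
    by (intro prod.cong refl) (auto simp: cnt)
  also have "\<dots> = (\<Prod>x\<in>set_mset M. fact (count M x))"
    using M_pairs by (intro prod.mono_neutral_right) (auto simp: not_in_iff)
  finally show "(\<Prod>x\<in>set_mset M. fact (count M x)) = parallel_factor l G" ..
qed

lemma graph_coeff_multigraph_eq_zero:
  assumes "G \<in> multigraphs l" "underlying es = G" "length fs = l" "total_degree fs < size G"
  shows "graph_coeff \<Omega> es fs = 0"
proof (rule graph_coeff_eq_zero)
  have "{a, b} \<subseteq> {1..l}" if "(a, b) \<in> set es" for a b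
    using assms(1) that unfolding multigraphs_def assms(2)[symmetric] underlying_def by fastforce
  then show "set es \<subseteq> {1..length fs} \<times> {1..length fs}" using assms(3) by auto
  show "0 \<in> set fs \<or> total_degree fs < length es" using assms(2,4) by (auto simp: underlying_def)
qed

text \<open>A multigraph with \<open>k\<close> edges is named by \<open>k! / #P(G)\<close> words, which turns the factor \<open>1 / k!\<close> of
  the exponential series into \<open>1 / #P(G)\<close>.\<close>

theorem wick_coeff_multigraphs:
  fixes fs :: "'m::finite fun_poly list"
  assumes sympl: "symplectic_form \<Omega>" and len: "length fs = l"
    and dir: "\<And>G. G \<in> multigraphs l \<Longrightarrow> underlying (dir G) = G"
  shows "finite {G \<in> multigraphs l. graph_coeff \<Omega> (dir G) fs \<noteq> 0}" (is "finite ?S")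
    and "ix \<in> index_lists N l \<Longrightarrow> wick_coeff \<Omega> N fs ix =
      (\<Sum>G | G \<in> multigraphs l \<and> graph_coeff \<Omega> (dir G) fs \<noteq> 0.
        (graph_coeff \<Omega> (dir G) fs / real (parallel_factor l G)) *\<^sub>R edge_prod ix (dir G))"
proof -
  define K where "K = total_degree fs"
  define C where "C = {G \<in> multigraphs l. size G \<le> K}"
  have ex: "\<exists>es. es \<in> edge_words l (size G) \<and> underlying es = G" if "G \<in> multigraphs l" for G
    using edge_words_of_multigraph(1)[OF that] permutations_of_multiset_not_empty by blast
  have "C \<subseteq> underlying ` (\<Union>k\<le>K. edge_words l k)" using ex by (fastforce simp: C_def)
  then have fin: "finite C" by (rule finite_subset) simp
  have sub: "?S \<subseteq> C"
    using graph_coeff_multigraph_eq_zero[OF _ dir len, of _ \<Omega>] by (force simp: C_def K_def not_le)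
  show "finite ?S" using finite_subset[OF sub fin] .
  assume ix: "ix \<in> index_lists N l"
  let ?c = "\<lambda>G. graph_coeff \<Omega> (dir G) fs"
  let ?w = "\<lambda>k es. (graph_coeff \<Omega> es fs / fact k) *\<^sub>R edge_prod ix es"
  let ?P = "\<lambda>G. (?c G / real (parallel_factor l G)) *\<^sub>R edge_prod ix (dir G)"
  have "wick_coeff \<Omega> N fs ix =
      (\<Sum>k\<le>K. \<Sum>es\<in>edge_words l k. ?w k es)"
    by (rule wick_coeff_expansion[OF sympl ix len]) (simp add: K_def)
  also have "\<dots> = (\<Sum>k\<le>K. \<Sum>G\<in>{G \<in> C. size G = k}. ?P G)"
  proof (rule sum.cong[OF refl])
    fix k assume k: "k \<in> {..K}"
    have "(\<Sum>es\<in>edge_words l k. ?w k es) =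
      (\<Sum>G\<in>{G \<in> C. size G = k}. \<Sum>es\<in>{es. es \<in> edge_words l k \<and> underlying es = G}.
        ?w k es)"
    proof (rule sum.group[symmetric])
      show "finite {G \<in> C. size G = k}" using fin by simp
      show "underlying ` edge_words l k \<subseteq> {G \<in> C. size G = k}"
        using k underlying_edge_word by (auto simp: C_def)
    qed simp
    also have "\<dots> = (\<Sum>G\<in>{G \<in> C. size G = k}. ?P G)"
    proof (rule sum.cong[OF refl])
      fix G assume "G \<in> {G \<in> C. size G = k}"
      then have G: "G \<in> multigraphs l" "size G = k" by (auto simp: C_def)
      let ?M = "image_mset (\<lambda>e. (Min e, Max e)) G"
      have "(\<Sum>es\<in>{es. es \<in> edge_words l k \<and> underlying es = G}. ?w k es) =
          (\<Sum>es\<in>permutations_of_multiset ?M. (1 / fact k) *\<^sub>R (?c G *\<^sub>R edge_prod ix (dir G)))"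
      proof (rule sum.cong)
        show "{es. es \<in> edge_words l k \<and> underlying es = G} = permutations_of_multiset ?M"
          using edge_words_of_multigraph(1)[OF G(1)] G(2) by simp
        fix es assume "es \<in> permutations_of_multiset ?M"
        then have "es \<in> {es \<in> edge_words l (size G). underlying es = G}"
          unfolding edge_words_of_multigraph(1)[OF G(1)] .
        then have "underlying es = underlying (dir G)" using dir[OF G(1)] by simp
        from graph_coeff_underlying[OF sympl this, of fs ix]
        have "graph_coeff \<Omega> es fs *\<^sub>R edge_prod ix es = ?c G *\<^sub>R edge_prod ix (dir G)" .
        then show "?w k es =
            (1 / fact k) *\<^sub>R (?c G *\<^sub>R edge_prod ix (dir G))"
          by (metis divide_inverse_commute inverse_eq_divide scaleR_scaleR)
      qed
      also have "\<dots> = (real (card (permutations_of_multiset ?M)) / fact k * ?c G) *\<^sub>R edge_prod ix (dir G)"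
        by (simp add: sum_constant_scaleR del: sum_constant)
      also have "real (card (permutations_of_multiset ?M)) / fact k = 1 / real (parallel_factor l G)"
      proof -
        have "card (permutations_of_multiset ?M) * parallel_factor l G = fact k"
          using card_permutations_of_multiset_aux[of ?M] edge_words_of_multigraph(2)[OF G(1)] G(2) by simp
        then have "real (card (permutations_of_multiset ?M)) * real (parallel_factor l G) = fact k"
          by (metis of_nat_fact of_nat_mult)
        moreover from this have "real (parallel_factor l G) \<noteq> 0" by (metis fact_nonzero mult_zero_right)
        ultimately show ?thesis by (simp add: field_simps)
      qed
      finally show "(\<Sum>es\<in>{es. es \<in> edge_words l k \<and> underlying es = G}.
          ?w k es) =
          ?P G" by simp
    qed
    finally show "(\<Sum>es\<in>edge_words l k. ?w k es) = \<dots>" .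
  qed
  also have "\<dots> = (\<Sum>G\<in>C. ?P G)"
    using fin by (intro sum.group) (auto simp: C_def)
  also have "\<dots> = (\<Sum>G\<in>?S. ?P G)"
    using sub fin by (intro sum.mono_neutral_right) (auto simp: C_def)
  finally show "wick_coeff \<Omega> N fs ix = \<dots>" .
qed

section \<open>Contraction of edges\<close>

text \<open>Vertices are numbered from 1, list positions from 0. The difference of two indicators is
  antisymmetric in \<open>i\<close> and \<open>j\<close> also for \<open>i = j\<close>, where it counts a loop as 0.\<close>

definition edge_sign :: "nat \<Rightarrow> nat \<Rightarrow> nat \<times> nat \<Rightarrow> real" where
  "edge_sign i j e = of_bool (e = (Suc i, Suc j)) - of_bool (e = (Suc j, Suc i))"

lemma edge_sign_anti: "edge_sign j i e = - edge_sign i j e"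
  by (simp add: edge_sign_def)

definition contract_sum :: "nat \<Rightarrow> nat \<Rightarrow> nat list \<Rightarrow> digraph \<Rightarrow> even_poly" where
  "contract_sum i j iy es =
    (\<Sum>q<length es. edge_sign i j (es ! q) *\<^sub>R edge_prod iy (take q es @ drop (Suc q) es))"

lemma contract_sum_Nil [simp]: "contract_sum i j iy [] = 0"
  by (simp add: contract_sum_def)

lemma contract_sum_Cons:
  "contract_sum i j iy ((a, b) # es) = edge_sign i j (a, b) *\<^sub>R edge_prod iy es +
    t_even (iy ! (a - 1)) (iy ! (b - 1)) * contract_sum i j iy es"
  unfolding contract_sum_def length_Cons sum.lessThan_Suc_shift by (simp add: sum_distrib_left)

text \<open>In a list without repetition the index \<open>ix ! j\<close> occurs at position \<open>j\<close> only.\<close>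

lemma rename_index_edge_prod:
  assumes "ix \<in> index_lists N l" "distinct ix" "j < l" "set es \<subseteq> {1..l} \<times> {1..l}"
  shows "rename_index (ix ! j) k (edge_prod ix es) = edge_prod (ix[j := k]) es"
  using assms(4)
proof (induction es)
  case (Cons e es)
  obtain a b where e: "e = (a, b)" by (cases e)
  have len: "length ix = l" using assms(1) by (simp add: index_lists_def)
  have renamed: "(if ix ! c = ix ! j then k else ix ! c) = ix[j := k] ! c" if "c < l" for c
    using that assms(2,3) len by (auto simp: nth_eq_iff_index_eq nth_list_update)
  have "a - 1 < l" "b - 1 < l" using Cons.prems e by auto
  then have "rename_index (ix ! j) k (t_even (ix ! (a - 1)) (ix ! (b - 1))) =
      t_even (ix[j := k] ! (a - 1)) (ix[j := k] ! (b - 1))"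
    by (simp only: rename_index_t_even renamed)
  then show ?case using Cons e by simp
qed simp

text \<open>The derivative selects an edge whose ends carry the indices \<open>k\<close> and \<open>p = ix ! j\<close>; renaming then
  merges these ends.\<close>

lemma contract_edge_prod:
  assumes ix: "ix \<in> index_lists N l" "distinct ix" and j: "j < l" and k: "k \<noteq> ix ! j"
    and es: "set es \<subseteq> {1..l} \<times> {1..l}"
  shows "rename_index (ix ! j) k (t_even_deriv k (ix ! j) (edge_prod ix es)) =
    (\<Sum>i\<in>{..<l} - {j}. if ix ! i = k then contract_sum i j (ix[j := k]) es else 0)"
  using es
proof (induction es)
  case Nil
  have "mconst 1 = (1 :: even_poly)" by simp
  then have "t_even_deriv k (ix ! j) 1 = 0"
    using t_even_deriv_mult[of k "ix ! j" 1 1] by simp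
  then show ?case by (simp cong: if_cong)
next
  case (Cons e es)
  obtain a b where e: "e = (Suc a, Suc b)" "a < l" "b < l"
    using Cons.prems by (cases e) (auto simp: Suc_le_eq gr0_conv_Suc)
  let ?p = "ix ! j" and ?t = "t_even (ix ! a) (ix ! b)"
  have len: "length ix = l" using ix(1) by (simp add: index_lists_def)
  have same: "ix ! c = ?p \<longleftrightarrow> c = j" if "c < l" for c
    using that ix(2) j len by (auto simp: nth_eq_iff_index_eq)
  have delta: "(\<Sum>i\<in>{..<l} - {j}. if ix ! i = k \<and> i = c then r else 0) = (if ix ! c = k then r else 0)"
    if "c < l" for c and r :: real
  proof -
    have "(\<Sum>i\<in>{..<l} - {j}. if ix ! i = k \<and> i = c then r else 0) =
        (\<Sum>i\<in>{..<l} - {j}. if i = c then if ix ! c = k then r else 0 else 0)"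
      by (rule sum.cong) auto
    then show ?thesis using that k by (auto simp: sum.delta)
  qed
  have "(\<Sum>i\<in>{..<l} - {j}. if ix ! i = k then edge_sign i j e else 0) =
      (\<Sum>i\<in>{..<l} - {j}. if ix ! i = k \<and> i = a then of_bool (b = j) else 0) -
      (\<Sum>i\<in>{..<l} - {j}. if ix ! i = k \<and> i = b then of_bool (a = j) else 0)"
    unfolding sum_subtractf[symmetric] by (rule sum.cong) (auto simp: edge_sign_def e)
  also have "\<dots> = (if ix ! a = k then of_bool (b = j) else 0) - (if ix ! b = k then of_bool (a = j) else 0)"
    unfolding delta[OF e(2)] delta[OF e(3)] ..
  finally have sgn: "(\<Sum>i\<in>{..<l} - {j}. if ix ! i = k then edge_sign i j e else 0) *\<^sub>R (1 :: even_poly) =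
      t_even_deriv k ?p ?t"
    using k same[OF e(2)] same[OF e(3)] by (auto simp: t_even_deriv_t_even)
  have rename1: "rename_index ?p k (r *\<^sub>R 1) = r *\<^sub>R 1" for r by simp
  have "rename_index ?p k (t_even_deriv k ?p (edge_prod ix (e # es))) =
      rename_index ?p k (t_even_deriv k ?p ?t) * rename_index ?p k (edge_prod ix es) +
      rename_index ?p k ?t * rename_index ?p k (t_even_deriv k ?p (edge_prod ix es))"
    by (simp add: e t_even_deriv_mult)
  also have "rename_index ?p k (t_even_deriv k ?p ?t) =
      (\<Sum>i\<in>{..<l} - {j}. if ix ! i = k then edge_sign i j e else 0) *\<^sub>R 1"
    unfolding sgn[symmetric] rename1 ..
  also have "rename_index ?p k (edge_prod ix es) = edge_prod (ix[j := k]) es"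
    using ix j Cons.prems by (intro rename_index_edge_prod) auto
  also have "rename_index ?p k ?t = t_even (ix[j := k] ! a) (ix[j := k] ! b)"
    using same[OF e(2)] same[OF e(3)] e j len by (auto simp: rename_index_t_even nth_list_update)
  also have "rename_index ?p k (t_even_deriv k ?p (edge_prod ix es)) =
      (\<Sum>i\<in>{..<l} - {j}. if ix ! i = k then contract_sum i j (ix[j := k]) es else 0)"
    using Cons by simp
  finally show ?case
    unfolding e(1) scaleR_mpoly_mult mult_1
    unfolding scaleR_sum_left sum_distrib_left sum.distrib[symmetric]
    by (rule trans) (intro sum.cong refl, simp add: contract_sum_Cons)
qed

text \<open>Moving the odd variable of a vertex from position \<open>i\<close> to the front passes \<open>i\<close> others.\<close>

lemma index_sum_insert_at:
  assumes "i \<le> m"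
  shows "index_sum N (Suc m) w = (-1) ^ i *\<^sub>R index_sum N (Suc m) (\<lambda>iy. w (insert_at i (hd iy) (tl iy)))"
proof -
  have "index_sum N (Suc m) w = (\<Sum>k\<in>{1..N}. \<Sum>ys\<in>index_lists N m.
      odd_word (insert_at i k ys) * even_part (w (insert_at i k ys)))"
    unfolding index_sum_def sum_index_lists_insert_at[OF assms] ..
  also have "\<dots> = (\<Sum>k\<in>{1..N}. \<Sum>ys\<in>index_lists N m.
      (-1) ^ i *\<^sub>R (odd_word (k # ys) * even_part (w (insert_at i k ys))))"
    using assms by (intro sum.cong refl) (simp add: odd_word_insert_at index_lists_def del: odd_word_simps)
  also have "\<dots> = (-1) ^ i *\<^sub>R index_sum N (Suc m) (\<lambda>iy. w (insert_at i (hd iy) (tl iy)))"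
    unfolding index_sum_def sum_index_lists_insert_at[OF le0]
    by (simp add: scaleR_sum_right del: odd_word_simps)
  finally show ?thesis .
qed

text \<open>Doubling the merged vertex at the level of indices is the same as renumbering the edges by the
  contraction map \<open>\<rho>\<close> and placing the merged vertex at position \<open>i\<close>.\<close>

lemma edge_prod_double_first:
  assumes iy: "iy \<in> index_lists N (l - 1)" and ij: "i < j" "j < l" and es: "set es \<subseteq> {1..l} \<times> {1..l}"
  defines "\<rho> \<equiv> \<lambda>v. if v = Suc j then Suc i else if Suc j < v then v - 1 else v"
  shows "edge_prod (double_first i j iy) es = edge_prod (insert_at i (hd iy) (tl iy)) (map (map_prod \<rho> \<rho>) es)"
proof -
  let ?iz = "insert_at i (hd iy) (tl iy)"
  have len: "length (tl iy) = l - 2" "length ?iz = l - 1" using iy ij by (auto simp: index_lists_def)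
  have D: "double_first i j iy = insert_at j (hd iy) ?iz" using ij by (simp add: double_first_def)
  have nth: "double_first i j iy ! (v - 1) = ?iz ! (\<rho> v - 1)" if "v \<in> {1..l}" for v
  proof -
    have "?iz ! i = hd iy" using len ij by (simp add: nth_insert_at)
    then show ?thesis using that ij len unfolding D by (auto simp: \<rho>_def nth_insert_at[of j])
  qed
  show ?thesis using es
  proof (induction es)
    case (Cons e es)
    obtain a b where e: "e = (a, b)" by (cases e)
    have "a \<in> {1..l}" "b \<in> {1..l}" using Cons.prems e by auto
    from nth[OF this(1)] nth[OF this(2)] show ?case using Cons by (simp add: e)
  qed simp
qed

lemma graph_poly_linear: "linear (graph_poly N l)"
  unfolding graph_poly_def by (rule linear_lin_ext)

lemma graph_poly_single [simp]: "graph_poly N l (single es r) = r *\<^sub>R digraph_poly N l es"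
  by (simp add: graph_poly_def)

text \<open>Only the pair of ends of the contracted edge contributes to the sum. Moving the merged vertex from
  the front to its place \<open>i\<close> contributes \<open>(-1)\<^sup>i\<close>, which leaves the sign \<open>(-1)\<^sup>j\<^sup>+\<^sup>1\<close> of the contraction.\<close>

lemma graph_poly_contract_edge:
  assumes es: "set es \<subseteq> {1..l} \<times> {1..l}" and q: "q < length es"
  shows "graph_poly N (l - 1) (contract_edge es q) =
    (\<Sum>j<l. \<Sum>i<j. ((-1) ^ (i + j + 1) * edge_sign i j (es ! q)) *\<^sub>R
      index_sum N (l - 1) (\<lambda>iy. edge_prod (double_first i j iy) (take q es @ drop (Suc q) es)))"
proof -
  obtain a b where e: "es ! q = (Suc a, Suc b)" "a < l" "b < l"
  proof -
    have "es ! q \<in> {1..l} \<times> {1..l}" using nth_mem[OF q] es by blast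
    then show ?thesis using that by (cases "es ! q") (auto simp: Suc_le_eq gr0_conv_Suc)
  qed
  let ?es = "take q es @ drop (Suc q) es"
  let ?I = "\<lambda>i j. index_sum N (l - 1) (\<lambda>iy. edge_prod (double_first i j iy) ?es)"
  have es': "set ?es \<subseteq> {1..l} \<times> {1..l}"
    using es set_take_subset[of q es] set_drop_subset[of "Suc q" es] by auto
  show ?thesis
  proof (cases "a = b")
    case True
    then have "edge_sign i j (es ! q) = 0" if "i < j" for i j using that by (auto simp: edge_sign_def e)
    then have "(\<Sum>j<l. \<Sum>i<j. ((-1) ^ (i + j + 1) * edge_sign i j (es ! q)) *\<^sub>R ?I i j) = 0"
      by (intro sum.neutral ballI) simp
    moreover have "graph_poly N (l - 1) (contract_edge es q) = 0"
      using linear_0[OF graph_poly_linear] by (simp add: contract_edge_def e True)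
    ultimately show ?thesis by simp
  next
    case False
    define i where "i = min a b"
    define j where "j = max a b"
    define s :: real where "s = (if a < b then 1 else - 1)"
    have ij: "i < j" "j < l" using False e by (auto simp: i_def j_def)
    define \<rho> where "\<rho> = (\<lambda>v. if v = Suc j then Suc i else if Suc j < v then v - 1 else v)"
    have contr: "contract_edge es q =
        ((-1) ^ Suc j * s) *\<^sub>R single (map (map_prod \<rho> \<rho>) ?es) 1"
    proof -
      have ends: "min (Suc a) (Suc b) = Suc i" "max (Suc a) (Suc b) = Suc j" by (simp_all add: i_def j_def)
      show ?thesis
        unfolding contract_edge_def e Let_def prod.case ends using False by (simp add: \<rho>_def s_def)
    qed
    have sgn: "edge_sign i' j' (es ! q) = (if i' = i \<and> j' = j then s else 0)" if "i' < j'" for i' j'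
      using that False by (auto simp: edge_sign_def e i_def j_def s_def)
    let ?X = "((-1) ^ (i + j + 1) * s) *\<^sub>R ?I i j"
    have inner: "(\<Sum>i'<j'. ((-1) ^ (i' + j' + 1) * edge_sign i' j' (es ! q)) *\<^sub>R ?I i' j') =
        (if j' = j then ?X else 0)" for j'
    proof -
      have "(\<Sum>i'<j'. ((-1) ^ (i' + j' + 1) * edge_sign i' j' (es ! q)) *\<^sub>R ?I i' j') =
          (\<Sum>i'<j'. if i' = i then if j' = j then ?X else 0 else 0)"
        by (intro sum.cong refl) (simp add: sgn)
      then show ?thesis using ij by (simp add: sum.delta del: power_Suc)
    qed
    have "(\<Sum>j'<l. \<Sum>i'<j'. ((-1) ^ (i' + j' + 1) * edge_sign i' j' (es ! q)) *\<^sub>R ?I i' j') =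
        (\<Sum>j'<l. if j' = j then ?X else 0)"
      unfolding inner ..
    also have "\<dots> = ?X"
      using ij by (simp add: sum.delta)
    also have "?I i j = index_sum N (l - 1) (\<lambda>iy. edge_prod (insert_at i (hd iy) (tl iy)) (map (map_prod \<rho> \<rho>) ?es))"
      using ij es' unfolding \<rho>_def by (intro index_sum_cong edge_prod_double_first)
    also have "\<dots> = (-1) ^ i *\<^sub>R digraph_poly N (l - 1) (map (map_prod \<rho> \<rho>) ?es)"
    proof -
      obtain m where m: "l - 1 = Suc m" "i \<le> m" using ij by (cases "l - 1") auto
      have "(-1) ^ i * (-1) ^ i = (1 :: real)" by (simp flip: power_mult_distrib)
      then show ?thesis
        unfolding digraph_poly_eq_index_sum m(1) index_sum_insert_at[OF m(2), of N "\<lambda>ix. edge_prod ix _"] by simp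
    qed
    also have "((-1) ^ (i + j + 1) * s) *\<^sub>R (-1) ^ i *\<^sub>R digraph_poly N (l - 1) (map (map_prod \<rho> \<rho>) ?es) =
        graph_poly N (l - 1) (contract_edge es q)"
    proof -
      have "(-1) ^ i * (-1) ^ i = (1 :: real)" by (simp flip: power_mult_distrib)
      then have "(-1) ^ (i + j + 1) * s * (-1) ^ i = ((-1) ^ Suc j * s :: real)"
        by (simp add: power_add mult_ac)
      then show ?thesis unfolding contr linear_scale[OF graph_poly_linear] by simp
    qed
    finally show ?thesis by simp
  qed
qed

lemma map_coeffs_scaleR:
  assumes "h 0 = 0" "\<And>r a. h (r *\<^sub>R a) = r *\<^sub>R h a"
  shows "map_coeffs h (r *\<^sub>R F) = r *\<^sub>R map_coeffs h (F :: superpoly)"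
  using assms by (intro grassmann_eqI) (auto simp: map_coeffs.rep_eq map.rep_eq gcoeffs_scaleR when_def)

lemma graph_diff_op_linear: "linear (graph_diff_op N l)"
proof (rule linearI)
  let ?D = "\<lambda>k p F. map_coeffs (rename_index p k) (map_coeffs (t_even_deriv k p) (odd_deriv p F))"
  have odd: "odd_deriv p (r *\<^sub>R F) = r *\<^sub>R odd_deriv p F" for p r and F :: superpoly
    by (rule grassmann_eqI) (simp add: lookup_odd_deriv gcoeffs_scaleR)
  have "?D k p (r *\<^sub>R F) = r *\<^sub>R ?D k p F" for k p r F
    by (simp add: odd map_coeffs_scaleR)
  then show "graph_diff_op N l (r *\<^sub>R F) = r *\<^sub>R graph_diff_op N l F" for r F
    by (simp add: graph_diff_op_def scaleR_sum_right mult.commute)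
  have "?D k p (F + G) = ?D k p F + ?D k p G" for k p F G
    using odd_deriv_sum[of p "\<lambda>b. if b then F else G" UNIV]
      map_coeffs_sum[of "t_even_deriv k p" "\<lambda>b. odd_deriv p (if b then F else G)" UNIV]
      map_coeffs_sum[of "rename_index p k" "\<lambda>b. map_coeffs (t_even_deriv k p) (odd_deriv p (if b then F else G))" UNIV]
    by (simp add: UNIV_bool add.commute)
  then show "graph_diff_op N l (F + G) = graph_diff_op N l F + graph_diff_op N l G" for F G
    by (simp add: graph_diff_op_def sum.distrib scaleR_add_right)
qed

lemma graph_diff_op_digraph_poly:
  assumes l: "1 \<le> l" "l \<le> N" and es: "set es \<subseteq> {1..l} \<times> {1..l}"
  shows "graph_diff_op N l (digraph_poly N l es) = graph_poly N (l - 1) (\<Sum>q<length es. contract_edge es q)"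
proof -
  let ?T = "\<lambda>q i j. ((-1) ^ (i + j + 1) * edge_sign i j (es ! q)) *\<^sub>R
    index_sum N (l - 1) (\<lambda>iy. edge_prod (double_first i j iy) (take q es @ drop (Suc q) es))"
  have "graph_diff_op N l (digraph_poly N l es) = (\<Sum>j<l. \<Sum>i<j. (-1) ^ (i + j + 1) *\<^sub>R
      index_sum N (l - 1) (\<lambda>iy. contract_sum i j (double_first i j iy) es))"
    unfolding digraph_poly_eq_index_sum
  proof (rule graph_diff_op_index_sum[OF l, where v = "\<lambda>i j iy. contract_sum i j iy es"])
    show "contract_sum j i iy es = - contract_sum i j iy es" for i j iy
      by (simp add: contract_sum_def edge_sign_anti[of j i] sum_negf)
  qed (rule contract_edge_prod[OF _ _ _ _ es])
  also have "\<dots> = (\<Sum>j<l. \<Sum>i<j. \<Sum>q<length es. ?T q i j)"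
    unfolding contract_sum_def index_sum_sum index_sum_scaleR scaleR_sum_right scaleR_scaleR ..
  also have "\<dots> = (\<Sum>q<length es. \<Sum>j<l. \<Sum>i<j. ?T q i j)"
    by (rule trans[OF sum.cong[OF refl sum.swap] sum.swap])
  also have "\<dots> = (\<Sum>q<length es. graph_poly N (l - 1) (contract_edge es q))"
    by (intro sum.cong refl graph_poly_contract_edge[symmetric] es) simp
  also have "\<dots> = graph_poly N (l - 1) (\<Sum>q<length es. contract_edge es q)"
    by (rule linear_sum[OF graph_poly_linear, symmetric])
  finally show ?thesis .
qed

theorem graph_poly_graph_diff:
  assumes "1 \<le> l" "l \<le> N" "\<gamma> \<in> graph_chains l"
  shows "graph_poly N (l - 1) (graph_diff \<gamma>) = graph_diff_op N l (graph_poly N l \<gamma>)"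
proof -
  have "graph_poly N (l - 1) (graph_diff \<gamma>) = (\<Sum>es\<in>keys \<gamma>. lookup \<gamma> es *\<^sub>R
      graph_poly N (l - 1) (\<Sum>q<length es. contract_edge es q))"
    by (simp add: graph_diff_def lin_ext_def linear_sum[OF graph_poly_linear] linear_scale[OF graph_poly_linear])
  also have "\<dots> = (\<Sum>es\<in>keys \<gamma>. lookup \<gamma> es *\<^sub>R graph_diff_op N l (digraph_poly N l es))"
    using assms by (intro sum.cong refl) (simp add: graph_diff_op_digraph_poly graph_chains_def)
  also have "\<dots> = graph_diff_op N l (graph_poly N l \<gamma>)"
    by (simp add: graph_poly_def lin_ext_def linear_sum[OF graph_diff_op_linear] linear_scale[OF graph_diff_op_linear])
  finally show ?thesis .
qed

section \<open>The Chevalley--Eilenberg differential\<close>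

lemma sum_edge_words_insert_at:
  "q \<le> n \<Longrightarrow> (\<Sum>es\<in>edge_words l (Suc n). g es) =
    (\<Sum>e\<in>edge_pairs l. \<Sum>es\<in>edge_words l n. g (insert_at q e es))"
  unfolding edge_words_def by (rule sum_lists_insert_at)

lemma graph_coeff_insert_at: "graph_coeff \<Omega> (insert_at q e es) fs = graph_coeff \<Omega> (e # es) fs"
  by (simp add: insert_at_def graph_coeff_move)

definition symplectic_pairing ::
  "real^'m^'m \<Rightarrow> ('m::finite \<Rightarrow> 'm \<Rightarrow> 'v) \<Rightarrow> 'v::real_vector" where
  "symplectic_pairing \<Omega> g = (\<Sum>\<mu>\<in>UNIV. \<Sum>\<nu>\<in>UNIV. (matrix_inv \<Omega> $ \<mu> $ \<nu>) *\<^sub>R g \<mu> \<nu>)"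

lemma symplectic_pairing_swap:
  assumes "symplectic_form \<Omega>"
  shows "symplectic_pairing \<Omega> (\<lambda>\<mu> \<nu>. g \<nu> \<mu>) = - symplectic_pairing \<Omega> g"
proof -
  have "symplectic_pairing \<Omega> (\<lambda>\<mu> \<nu>. g \<nu> \<mu>) = (\<Sum>\<nu>\<in>UNIV. \<Sum>\<mu>\<in>UNIV. (matrix_inv \<Omega> $ \<mu> $ \<nu>) *\<^sub>R g \<nu> \<mu>)"
    unfolding symplectic_pairing_def by (rule sum.swap)
  also have "\<dots> = - symplectic_pairing \<Omega> g"
    unfolding symplectic_pairing_def sum_negf[symmetric]
    by (intro sum.cong refl) (subst matrix_inv_antisym[OF assms], simp)
  finally show ?thesis .
qed

lemma symplectic_pairing_sum:
  "symplectic_pairing \<Omega> (\<lambda>\<mu> \<nu>. \<Sum>x\<in>S. g x \<mu> \<nu>) = (\<Sum>x\<in>S. symplectic_pairing \<Omega> (g x))"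
proof -
  have "symplectic_pairing \<Omega> (\<lambda>\<mu> \<nu>. \<Sum>x\<in>S. g x \<mu> \<nu>) =
      (\<Sum>\<mu>\<in>UNIV. \<Sum>x\<in>S. \<Sum>\<nu>\<in>UNIV. (matrix_inv \<Omega> $ \<mu> $ \<nu>) *\<^sub>R g x \<mu> \<nu>)"
    unfolding symplectic_pairing_def scaleR_sum_right by (rule sum.cong[OF refl sum.swap])
  also have "\<dots> = (\<Sum>x\<in>S. symplectic_pairing \<Omega> (g x))"
    unfolding symplectic_pairing_def by (rule sum.swap)
  finally show ?thesis .
qed

lemma symplectic_pairing_scaleR:
  "symplectic_pairing \<Omega> (\<lambda>\<mu> \<nu>. r *\<^sub>R g \<mu> \<nu>) = r *\<^sub>R symplectic_pairing \<Omega> g"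
  by (simp add: symplectic_pairing_def scaleR_sum_right mult.commute)

lemma symplectic_pairing_scaleR_left:
  "symplectic_pairing \<Omega> (\<lambda>\<mu> \<nu>. h \<mu> \<nu> *\<^sub>R x) = symplectic_pairing \<Omega> h *\<^sub>R x"
  by (simp add: symplectic_pairing_def scaleR_sum_left)

text \<open>Positions \<open>i\<close> and \<open>j\<close> of a list carry the vertices \<open>i + 1\<close> and \<open>j + 1\<close>.\<close>

abbreviation diff_pair :: "nat \<Rightarrow> nat \<Rightarrow> 'm \<Rightarrow> 'm \<Rightarrow> 'm fun_poly list \<Rightarrow> 'm fun_poly list" where
  "diff_pair i j \<mu> \<nu> fs \<equiv> diff_at \<nu> (Suc j) (diff_at \<mu> (Suc i) fs)"

lemma graph_coeff_Cons_pair: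
  "graph_coeff \<Omega> ((Suc i, Suc j) # es) fs = symplectic_pairing \<Omega> (\<lambda>\<mu> \<nu>. graph_coeff \<Omega> es (diff_pair i j \<mu> \<nu> fs))"
  by (simp add: symplectic_pairing_def)

lemma sum_edge_sign_graph_coeff:
  assumes "symplectic_form \<Omega>" "i < l" "j < l" "i \<noteq> j"
  shows "(\<Sum>e\<in>edge_pairs l. edge_sign i j e * graph_coeff \<Omega> (e # es) fs) =
    graph_coeff \<Omega> ((Suc i, Suc j) # es) fs"
proof (cases "i < j")
  case True
  then have "edge_sign i j e = of_bool (e = (Suc i, Suc j))" if "e \<in> edge_pairs l" for e
    using that by (cases e) (simp add: edge_sign_def mem_edge_pairs)
  then have "(\<Sum>e\<in>edge_pairs l. edge_sign i j e * graph_coeff \<Omega> (e # es) fs) =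
      (\<Sum>e\<in>edge_pairs l. if e = (Suc i, Suc j) then graph_coeff \<Omega> ((Suc i, Suc j) # es) fs else 0)"
    by (intro sum.cong refl) (simp del: graph_coeff.simps)
  then show ?thesis using assms True by (simp add: mem_edge_pairs del: graph_coeff.simps)
next
  case False
  then have "edge_sign i j e = - of_bool (e = (Suc j, Suc i))" if "e \<in> edge_pairs l" for e
    using that assms(4) by (cases e) (simp add: edge_sign_def mem_edge_pairs)
  then have "(\<Sum>e\<in>edge_pairs l. edge_sign i j e * graph_coeff \<Omega> (e # es) fs) =
      (\<Sum>e\<in>edge_pairs l. if e = (Suc j, Suc i) then - graph_coeff \<Omega> ((Suc j, Suc i) # es) fs else 0)"
    by (intro sum.cong refl) (simp del: graph_coeff.simps)
  also have "\<dots> = - graph_coeff \<Omega> ((Suc j, Suc i) # es) fs"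
    using assms False by (simp add: mem_edge_pairs del: graph_coeff.simps)
  also have "\<dots> = graph_coeff \<Omega> ((Suc i, Suc j) # es) fs"
    by (rule graph_coeff_flip[OF assms(1), symmetric])
  finally show ?thesis .
qed

text \<open>The contracted edge can stand at each of the \<open>n + 1\<close> places of a word; this factor turns
  \<open>1 / (n + 1)!\<close> into \<open>1 / n!\<close>.\<close>

lemma sum_contract_edge_words:
  assumes sympl: "symplectic_form \<Omega>" and ij: "i < l" "j < l" "i \<noteq> j"
  shows "(\<Sum>es\<in>edge_words l (Suc n). graph_coeff \<Omega> es fs *\<^sub>R contract_sum i j iy es) =
    real (Suc n) *\<^sub>R symplectic_pairing \<Omega> (\<lambda>\<mu> \<nu>.
      \<Sum>es\<in>edge_words l n. graph_coeff \<Omega> es (diff_pair i j \<mu> \<nu> fs) *\<^sub>R edge_prod iy es)"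
proof -
  let ?w = "\<lambda>es. graph_coeff \<Omega> ((Suc i, Suc j) # es) fs *\<^sub>R edge_prod iy es"
  let ?T = "\<lambda>q es. (graph_coeff \<Omega> es fs * edge_sign i j (es ! q)) *\<^sub>R
    edge_prod iy (take q es @ drop (Suc q) es)"
  have "(\<Sum>es\<in>edge_words l (Suc n). graph_coeff \<Omega> es fs *\<^sub>R contract_sum i j iy es) =
      (\<Sum>es\<in>edge_words l (Suc n). \<Sum>q<Suc n. ?T q es)"
    by (intro sum.cong refl) (simp add: contract_sum_def edge_words_def scaleR_sum_right del: sum.lessThan_Suc)
  also have "\<dots> = (\<Sum>q<Suc n. \<Sum>es\<in>edge_words l (Suc n). ?T q es)"
    by (rule sum.swap)
  also have "\<dots> = (\<Sum>q<Suc n. \<Sum>es\<in>edge_words l n. ?w es)"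
  proof (rule sum.cong[OF refl])
    fix q assume "q \<in> {..<Suc n}"
    then have q: "q \<le> n" by simp
    have "(\<Sum>es\<in>edge_words l (Suc n). ?T q es) =
      (\<Sum>e\<in>edge_pairs l. \<Sum>es\<in>edge_words l n. (edge_sign i j e * graph_coeff \<Omega> (e # es) fs) *\<^sub>R edge_prod iy es)"
      unfolding sum_edge_words_insert_at[OF q] graph_coeff_insert_at using q
      by (intro sum.cong refl) (simp add: edge_words_def delete_insert_at nth_insert_at mult.commute del: graph_coeff.simps)
    also have "\<dots> = (\<Sum>es\<in>edge_words l n. (\<Sum>e\<in>edge_pairs l. edge_sign i j e * graph_coeff \<Omega> (e # es) fs) *\<^sub>R edge_prod iy es)"
      unfolding scaleR_sum_left by (rule sum.swap)
    finally show "(\<Sum>es\<in>edge_words l (Suc n). ?T q es) =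
        (\<Sum>es\<in>edge_words l n. ?w es)"
      unfolding sum_edge_sign_graph_coeff[OF sympl ij] .
  qed
  also have "\<dots> = real (Suc n) *\<^sub>R (\<Sum>es\<in>edge_words l n. ?w es)"
    by (simp only: sum_constant_scaleR card_lessThan)
  also have "(\<Sum>es\<in>edge_words l n. ?w es) =
      symplectic_pairing \<Omega> (\<lambda>\<mu> \<nu>.
      \<Sum>es\<in>edge_words l n. graph_coeff \<Omega> es (diff_pair i j \<mu> \<nu> fs) *\<^sub>R edge_prod iy es)"
    unfolding graph_coeff_Cons_pair symplectic_pairing_sum symplectic_pairing_scaleR_left ..
  finally show ?thesis .
qed

text \<open>The derivative of the exponential brings down a propagator between the points \<open>x\<^sub>k\<close> and
  \<open>x\<^sub>p\<close>, which are then identified.\<close>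

lemma contract_wick_coeff:
  assumes sympl: "symplectic_form \<Omega>" and ix: "ix \<in> index_lists N l" "distinct ix" and len: "length fs = l"
    and j: "j < l" and k: "k \<in> {1..N}" "k \<noteq> ix ! j"
  shows "rename_index (ix ! j) k (t_even_deriv k (ix ! j) (wick_coeff \<Omega> N fs ix)) =
    (\<Sum>i\<in>{..<l} - {j}. if ix ! i = k
      then symplectic_pairing \<Omega> (\<lambda>\<mu> \<nu>. wick_coeff \<Omega> N (diff_pair i j \<mu> \<nu> fs) (ix[j := k])) else 0)"
proof -
  define K where "K = total_degree fs"
  let ?R = "\<lambda>w. rename_index (ix ! j) k (t_even_deriv k (ix ! j) w)"
  let ?V = "\<lambda>n fs iy. \<Sum>es\<in>edge_words l n. graph_coeff \<Omega> es fs *\<^sub>R edge_prod iy es"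
  let ?C = "\<lambda>n i. \<Sum>es\<in>edge_words l n. graph_coeff \<Omega> es fs *\<^sub>R contract_sum i j (ix[j := k]) es"
  let ?W = "\<lambda>i. symplectic_pairing \<Omega> (\<lambda>\<mu> \<nu>. wick_coeff \<Omega> N (diff_pair i j \<mu> \<nu> fs) (ix[j := k]))"
  let ?U = "\<lambda>n i. symplectic_pairing \<Omega> (\<lambda>\<mu> \<nu>. ?V n (diff_pair i j \<mu> \<nu> fs) (ix[j := k]))"
  have iy: "ix[j := k] \<in> index_lists N l"
    using ix k set_update_subset_insert[of ix j k] by (auto simp: index_lists_def)
  have V: "?R (?V n fs ix) = (\<Sum>i\<in>{..<l} - {j}. if ix ! i = k
      then ?C n i else 0)" for n
  proof -
    have "?R (?V n fs ix) = (\<Sum>es\<in>edge_words l n. graph_coeff \<Omega> es fs *\<^sub>R ?R (edge_prod ix es))"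
      by (simp add: t_even_deriv_sum rename_index_sum)
    also have "\<dots> = (\<Sum>es\<in>edge_words l n. \<Sum>i\<in>{..<l} - {j}. if ix ! i = k
        then graph_coeff \<Omega> es fs *\<^sub>R contract_sum i j (ix[j := k]) es else 0)"
    proof (rule sum.cong[OF refl])
      fix es assume "es \<in> edge_words l n"
      then have es: "set es \<subseteq> {1..l} \<times> {1..l}" by (auto simp: edge_words_def mem_edge_pairs)
      show "graph_coeff \<Omega> es fs *\<^sub>R ?R (edge_prod ix es) = (\<Sum>i\<in>{..<l} - {j}. if ix ! i = k
          then graph_coeff \<Omega> es fs *\<^sub>R contract_sum i j (ix[j := k]) es else 0)"
        unfolding contract_edge_prod[OF ix j k(2) es] scaleR_sum_right by (intro sum.cong refl) simp
    qed
    also have "\<dots> = (\<Sum>i\<in>{..<l} - {j}. \<Sum>es\<in>edge_words l n. if ix ! i = k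
        then graph_coeff \<Omega> es fs *\<^sub>R contract_sum i j (ix[j := k]) es else 0)"
      by (rule sum.swap)
    also have "\<dots> = (\<Sum>i\<in>{..<l} - {j}. if ix ! i = k
      then ?C n i else 0)"
      by (intro sum.cong refl) simp
    finally show ?thesis .
  qed
  have expand: "wick_coeff \<Omega> N fs' iy' = (\<Sum>n\<le>K'. (1 / fact n) *\<^sub>R ?V n fs' iy')"
    if "iy' \<in> index_lists N l" "length fs' = l" "total_degree fs' \<le> K'" for fs' iy' K'
    using wick_coeff_expansion[OF sympl that] by (simp add: scaleR_sum_right)
  \<comment> \<open>The derivative shifts the order by one, so the left side is expanded one order further.\<close>
  have "?R (wick_coeff \<Omega> N fs ix) = (\<Sum>n\<le>Suc K. (1 / fact n) *\<^sub>R ?R (?V n fs ix))"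
    unfolding expand[OF ix(1) len le_SucI[OF order_refl], folded K_def]
    by (simp only: t_even_deriv_sum rename_index_sum t_even_deriv_simps rename_index_simps)
  also have "\<dots> = (\<Sum>n\<le>K. (1 / fact (Suc n)) *\<^sub>R ?R (?V (Suc n) fs ix))"
  proof -
    have "edge_words l 0 = {[]}" by (auto simp: edge_words_def)
    then have "?R (?V 0 fs ix) = 0" unfolding V by (simp cong: if_cong)
    then show ?thesis unfolding sum.atMost_Suc_shift by simp
  qed
  also have "\<dots> = (\<Sum>n\<le>K. \<Sum>i\<in>{..<l} - {j}. if ix ! i = k then (1 / fact n) *\<^sub>R
      ?U n i else 0)"
  proof (rule sum.cong[OF refl])
    fix n
    have "(1 / fact (Suc n)) *\<^sub>R (real (Suc n) *\<^sub>R x) = (1 / fact n) *\<^sub>R x" for x :: even_poly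
      by (simp add: field_simps del: of_nat_Suc)
    then show "(1 / fact (Suc n)) *\<^sub>R ?R (?V (Suc n) fs ix) = (\<Sum>i\<in>{..<l} - {j}. if ix ! i = k then (1 / fact n) *\<^sub>R
      ?U n i else 0)"
      unfolding V scaleR_sum_right using j
      by (intro sum.cong refl) (simp add: sum_contract_edge_words[OF sympl] del: fact_Suc of_nat_Suc)
  qed
  also have "\<dots> = (\<Sum>i\<in>{..<l} - {j}. \<Sum>n\<le>K. if ix ! i = k then (1 / fact n) *\<^sub>R
      ?U n i else 0)"
    by (rule sum.swap)
  also have "\<dots> = (\<Sum>i\<in>{..<l} - {j}. if ix ! i = k
      then ?W i else 0)"
  proof (rule sum.cong[OF refl])
    fix i
    have "wick_coeff \<Omega> N (diff_pair i j \<mu> \<nu> fs) (ix[j := k]) =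
        (\<Sum>n\<le>K. (1 / fact n) *\<^sub>R ?V n (diff_pair i j \<mu> \<nu> fs) (ix[j := k]))" for \<mu> \<nu>
      unfolding K_def
      by (rule expand[OF iy]) (simp add: len, rule order_trans[OF total_degree_diff_at_le total_degree_diff_at_le])
    then have "?W i =
        (\<Sum>n\<le>K. (1 / fact n) *\<^sub>R ?U n i)"
      by (simp only: symplectic_pairing_sum symplectic_pairing_scaleR)
    then show "(\<Sum>n\<le>K. if ix ! i = k then (1 / fact n) *\<^sub>R
      ?U n i else 0) =
      (if ix ! i = k
      then ?W i else 0)"
      by simp
  qed
  finally show ?thesis .
qed

text \<open>The operators of different entries commute, so an entry of a chain can be moved together with
  its index.\<close>

lemma source_ops_mset:
  assumes "mset (zip ix fs) = mset (zip iy gs)"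
  shows "source_ops ix fs F = source_ops iy gs F"
proof -
  let ?op = "\<lambda>(i, f). source_op i f"
  have "fold ?op (rev (zip ix fs)) = fold ?op (rev (zip iy gs))"
    by (rule fold_multiset_equiv) (auto simp: fun_eq_iff source_op_commute assms)
  then show ?thesis by (simp add: source_ops_def foldr_conv_fold)
qed

lemma zip_insert_at:
  assumes "length xs = length ys" "j \<le> length ys"
  shows "zip (insert_at j x xs) (insert_at j y ys) = insert_at j (x, y) (zip xs ys)"
  using assms by (simp add: insert_at_def take_zip drop_zip)

lemma source_ops_insert_at:
  assumes "length ix = length fs" "j \<le> length fs"
  shows "source_ops (insert_at j i ix) (insert_at j f fs) F = source_op i f (source_ops ix fs F)"
proof -
  have "source_ops (insert_at j i ix) (insert_at j f fs) F = source_ops (i # ix) (f # fs) F"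
    using assms by (intro source_ops_mset) (simp add: zip_insert_at)
  then show ?thesis by simp
qed

text \<open>At a common point the operators multiply, which combines the two derivatives into the Poisson
  bracket.\<close>

lemma wick_coeff_merge:
  assumes len: "length iy = length gs" and ij: "i < j" "j \<le> Suc (length gs)"
  shows "symplectic_pairing \<Omega> (\<lambda>\<mu> \<nu>. wick_coeff \<Omega> N (insert_at j (mpderiv \<nu> g) (insert_at i (mpderiv \<mu> f) gs))
      (insert_at j k (insert_at i k iy))) = wick_coeff \<Omega> N (poisson \<Omega> f g # gs) (k # iy)"
proof -
  let ?F = "source_ops iy gs (series_exp (source_form \<Omega> N))"
  have "wick_coeff \<Omega> N (insert_at j (mpderiv \<nu> g) (insert_at i (mpderiv \<mu> f) gs)) (insert_at j k (insert_at i k iy)) =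
      source_op k (mpderiv \<mu> f * mpderiv \<nu> g) ?F 0" for \<mu> \<nu>
    using len ij by (simp add: wick_coeff_def source_ops_insert_at source_op_source_op mult.commute)
  then show ?thesis
    by (simp add: symplectic_pairing_def wick_coeff_def poisson_def source_op_sum source_op_scaleR)
qed

lemma insert_at_nths:
  assumes "i < j" "j < length fs"
  shows "fs = insert_at j (fs ! j) (insert_at i (fs ! i) (nths fs (- {i, j})))"
    and "length (nths fs (- {i, j})) = length fs - 2"
proof -
  define xs where "xs = take i fs"
  define ys where "ys = take (j - Suc i) (drop (Suc i) fs)"
  define zs where "zs = drop (Suc j) fs"
  have len: "length xs = i" "length ys = j - Suc i" using assms by (simp_all add: xs_def ys_def)
  have fs: "fs = xs @ fs ! i # ys @ fs ! j # zs"
  proof -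
    have "drop (Suc i) fs = ys @ fs ! j # zs"
      using id_take_nth_drop[of "j - Suc i" "drop (Suc i) fs"] assms by (simp add: ys_def zs_def)
    then show ?thesis using id_take_nth_drop[of i fs] assms by (simp add: xs_def)
  qed
  have all: "nths xs A = xs" if "\<forall>c<length xs. c \<in> A" for xs :: "'a list" and A
    using that by (simp add: nths_all)
  have "nths ys {c. Suc (c + i) \<noteq> j} = ys" using len assms by (intro all) auto
  moreover have "nths xs (- {i, j}) = xs" using len assms by (intro all) auto
  ultimately have rest: "nths fs (- {i, j}) = xs @ ys @ zs"
    using assms len by (subst fs) (simp add: nths_append nths_Cons all)
  have "insert_at i x (xs @ ys @ zs) = xs @ x # ys @ zs" for x
    using len by (simp add: insert_at_def)
  moreover have "insert_at j y (xs @ x # ys @ zs) = xs @ x # ys @ y # zs" for x y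
    using len assms by (simp add: insert_at_def Suc_diff_le take_Cons' drop_Cons')
  ultimately show "fs = insert_at j (fs ! j) (insert_at i (fs ! i) (nths fs (- {i, j})))"
    using fs rest by simp
  show "length (nths fs (- {i, j})) = length fs - 2"
    using arg_cong[OF fs, of length] rest by simp
qed

lemma diff_pair_insert_at:
  assumes "i < j" "j \<le> Suc (length gs)"
  shows "diff_pair i j \<mu> \<nu> (insert_at j g (insert_at i f gs)) =
    insert_at j (mpderiv \<nu> g) (insert_at i (mpderiv \<mu> f) gs)"
proof -
  have "(insert_at j g (insert_at i f gs))[i := x] = insert_at j g (insert_at i x gs)" for x
    using assms by (intro nth_equalityI) (auto simp: nth_insert_at nth_list_update)
  then show ?thesis using assms by (simp add: diff_at_def nth_insert_at list_update_insert_at)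
qed

lemma chain_correlator_linear: "linear (chain_correlator \<Omega> N)"
  unfolding chain_correlator_def by (rule linear_lin_ext)

lemma chain_correlator_single [simp]:
  "chain_correlator \<Omega> N (single fs r) = r *\<^sub>R correlator \<Omega> N fs"
  by (simp add: chain_correlator_def)

lemma chain_correlator_ce_diff_list:
  "chain_correlator \<Omega> N (ce_diff_list \<Omega> fs) = (\<Sum>j<length fs. \<Sum>i<j. (-1) ^ (i + j + 1) *\<^sub>R
    correlator \<Omega> N (poisson \<Omega> (fs ! i) (fs ! j) # nths fs (- {i, j})))"
proof -
  have shift: "(\<Sum>j\<in>{1..l}. \<Sum>i\<in>{1..<j}. h i j) = (\<Sum>j<l. \<Sum>i<j. h (Suc i) (Suc j))"
    for h :: "nat \<Rightarrow> nat \<Rightarrow> 'x::comm_monoid_add" and l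
  proof -
    have "(\<Sum>i\<in>{1..<Suc j}. h i (Suc j)) = (\<Sum>i<j. h (Suc i) (Suc j))" for j
      by (rule sum.reindex_bij_witness[where i = Suc and j = "\<lambda>i. i - 1"]) auto
    moreover have "(\<Sum>j\<in>{1..l}. \<Sum>i\<in>{1..<j}. h i j) = (\<Sum>j<l. \<Sum>i\<in>{1..<Suc j}. h i (Suc j))"
      by (rule sum.reindex_bij_witness[where i = Suc and j = "\<lambda>i. i - 1"]) auto
    ultimately show ?thesis by simp
  qed
  show ?thesis
    unfolding ce_diff_list_def shift linear_sum[OF chain_correlator_linear] linear_scale[OF chain_correlator_linear]
    by simp
qed

theorem graph_diff_op_correlator:
  fixes fs :: "'m::finite fun_poly list"
  assumes sympl: "symplectic_form \<Omega>" and l: "1 \<le> l" "l \<le> N" and len: "length fs = l"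
  shows "graph_diff_op N l (correlator \<Omega> N fs) = chain_correlator \<Omega> N (ce_diff_list \<Omega> fs)"
proof -
  define v where "v i j iy = symplectic_pairing \<Omega> (\<lambda>\<mu> \<nu>. wick_coeff \<Omega> N (diff_pair i j \<mu> \<nu> fs) iy)" for i j iy
  have "graph_diff_op N l (correlator \<Omega> N fs) =
      (\<Sum>j<l. \<Sum>i<j. (-1) ^ (i + j + 1) *\<^sub>R index_sum N (l - 1) (\<lambda>iy. v i j (double_first i j iy)))"
    unfolding correlator_eq_index_sum len
  proof (rule graph_diff_op_index_sum[OF l])
    show "v j i iy = - v i j iy" for i j iy
      unfolding v_def symplectic_pairing_swap[OF sympl, symmetric] by (simp only: diff_at_commute)
  qed (unfold v_def, rule contract_wick_coeff[OF sympl _ _ len])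
  also have "\<dots> = (\<Sum>j<l. \<Sum>i<j. (-1) ^ (i + j + 1) *\<^sub>R
      correlator \<Omega> N (poisson \<Omega> (fs ! i) (fs ! j) # nths fs (- {i, j})))"
  proof (intro sum.cong refl arg_cong2[where f = scaleR])
    fix j i assume "j \<in> {..<l}" "i \<in> {..<j}"
    then have ij: "i < j" "j < length fs" using len by auto
    let ?gs = "nths fs (- {i, j})"
    have lgs: "length ?gs = l - 2" using insert_at_nths(2)[OF ij] len by simp
    have "v i j (double_first i j iy) = wick_coeff \<Omega> N (poisson \<Omega> (fs ! i) (fs ! j) # ?gs) iy"
      if iy_in: "iy \<in> index_lists N (l - 1)" for iy
    proof -
      obtain k ys where iy: "iy = k # ys" "length ys = l - 2"
        using iy_in ij len by (cases iy) (auto simp: index_lists_def)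
      have "v i j (double_first i j iy) = symplectic_pairing \<Omega> (\<lambda>\<mu> \<nu>. wick_coeff \<Omega> N
          (diff_pair i j \<mu> \<nu> (insert_at j (fs ! j) (insert_at i (fs ! i) ?gs))) (insert_at j k (insert_at i k ys)))"
        unfolding v_def insert_at_nths(1)[OF ij, symmetric] using ij by (simp add: double_first_def iy)
      also have "\<dots> = wick_coeff \<Omega> N (poisson \<Omega> (fs ! i) (fs ! j) # ?gs) (k # ys)"
        using ij len lgs iy(2) by (simp add: diff_pair_insert_at wick_coeff_merge)
      finally show ?thesis unfolding iy .
    qed
    moreover have "length (poisson \<Omega> (fs ! i) (fs ! j) # ?gs) = l - 1" using lgs ij len by simp
    ultimately show "index_sum N (l - 1) (\<lambda>iy. v i j (double_first i j iy)) =
        correlator \<Omega> N (poisson \<Omega> (fs ! i) (fs ! j) # ?gs)"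
      unfolding correlator_eq_index_sum by (auto intro: index_sum_cong)
  qed
  finally show ?thesis unfolding chain_correlator_ce_diff_list len .
qed

theorem graph_diff_op_chain_correlator:
  fixes c :: "'m::finite fun_poly list \<Rightarrow>\<^sub>0 real"
  assumes "symplectic_form \<Omega>" "1 \<le> l" "l \<le> N" and "\<And>fs. fs \<in> keys c \<Longrightarrow> length fs = l"
  shows "chain_correlator \<Omega> N (ce_diff \<Omega> c) = graph_diff_op N l (chain_correlator \<Omega> N c)"
proof -
  have "chain_correlator \<Omega> N (ce_diff \<Omega> c) = (\<Sum>fs\<in>keys c. lookup c fs *\<^sub>R
      chain_correlator \<Omega> N (ce_diff_list \<Omega> fs))"
    by (simp add: ce_diff_def lin_ext_def linear_sum[OF chain_correlator_linear] linear_scale[OF chain_correlator_linear])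
  also have "\<dots> = (\<Sum>fs\<in>keys c. lookup c fs *\<^sub>R graph_diff_op N l (correlator \<Omega> N fs))"
    using assms by (intro sum.cong refl) (simp add: graph_diff_op_correlator)
  also have "\<dots> = graph_diff_op N l (chain_correlator \<Omega> N c)"
    by (simp add: chain_correlator_def lin_ext_def linear_sum[OF graph_diff_op_linear] linear_scale[OF graph_diff_op_linear])
  finally show ?thesis .
qed

section \<open>Invariance under the relations of the wedge product\<close>

text \<open>The coefficients are symmetric under simultaneous permutation of functions and indices, so only
  the sign of the odd variables remains.\<close>

lemma correlator_insert_at:
  assumes "i \<le> length gs"
  shows "correlator \<Omega> N (insert_at i f gs) = (-1) ^ i *\<^sub>R correlator \<Omega> N (f # gs)"
proof -
  have "wick_coeff \<Omega> N (insert_at i f gs) (insert_at i (hd iy) (tl iy)) = wick_coeff \<Omega> N (f # gs) iy"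
    if "iy \<in> index_lists N (Suc (length gs))" for iy
    using that assms by (cases iy) (auto simp: index_lists_def wick_coeff_def source_ops_insert_at)
  then show ?thesis
    unfolding correlator_eq_index_sum using index_sum_insert_at[OF assms, of N "wick_coeff \<Omega> N (insert_at i f gs)"]
    by (auto intro: index_sum_cong)
qed

lemma correlator_linear_Cons:
  "correlator \<Omega> N ((a *\<^sub>R f + b *\<^sub>R g) # gs) = a *\<^sub>R correlator \<Omega> N (f # gs) + b *\<^sub>R correlator \<Omega> N (g # gs)"
proof -
  have "wick_coeff \<Omega> N ((a *\<^sub>R f + b *\<^sub>R g) # gs) iy =
      a *\<^sub>R wick_coeff \<Omega> N (f # gs) iy + b *\<^sub>R wick_coeff \<Omega> N (g # gs) iy"
    if "iy \<in> index_lists N (Suc (length gs))" for iy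
    using that by (cases iy) (auto simp: index_lists_def wick_coeff_def source_op_add source_op_scaleR)
  then have "correlator \<Omega> N ((a *\<^sub>R f + b *\<^sub>R g) # gs) = index_sum N (Suc (length gs))
      (\<lambda>iy. a *\<^sub>R wick_coeff \<Omega> N (f # gs) iy + b *\<^sub>R wick_coeff \<Omega> N (g # gs) iy)"
    unfolding correlator_eq_index_sum by (auto intro: index_sum_cong)
  then show ?thesis by (simp add: correlator_eq_index_sum index_sum_add index_sum_scaleR)
qed

text \<open>With the two equal functions in front, exchanging them reverses the sign but not the chain.\<close>

lemma correlator_repeated:
  assumes "i \<le> length gs" "j \<le> Suc (length gs)"
  shows "correlator \<Omega> N (insert_at j f (insert_at i f gs)) = 0"
proof -
  have "correlator \<Omega> N (insert_at 1 f (f # gs)) = - correlator \<Omega> N (f # f # gs)"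
    using correlator_insert_at[of 1 "f # gs"] by simp
  then have "correlator \<Omega> N (f # f # gs) = 0" by (intro eq_neg_imp_zero) (simp add: insert_at_def)
  moreover have "f # insert_at i f gs = insert_at (Suc i) f (f # gs)" by (simp add: insert_at_def)
  ultimately show ?thesis using assms by (simp add: correlator_insert_at)
qed

text \<open>Contracting the vector field with \<open>\<Omega>\<close> recovers the first derivatives of the Hamiltonian.\<close>

lemma ham_field_eq_zero:
  fixes d :: "'m::finite fun_poly"
  assumes "symplectic_form \<Omega>" "ham_field \<Omega> d = 0" "lookup d 0 = 0"
  shows "d = 0"
proof (rule mpderiv_eq_zero_imp_zero)
  fix \<rho>
  have inv: "matrix_inv \<Omega> ** \<Omega> = mat 1" using assms(1) by (simp add: symplectic_form_def matrix_inv_left)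
  have comp: "(\<Sum>\<mu>\<in>UNIV. (matrix_inv \<Omega> $ \<mu> $ \<nu>) *\<^sub>R mpderiv \<mu> d) = 0" for \<nu>
    using arg_cong[OF assms(2), of "\<lambda>v. v $ \<nu>"] by (simp add: ham_field_def)
  have "0 = (\<Sum>\<nu>\<in>UNIV. (\<Omega> $ \<nu> $ \<rho>) *\<^sub>R (\<Sum>\<mu>\<in>UNIV. (matrix_inv \<Omega> $ \<mu> $ \<nu>) *\<^sub>R mpderiv \<mu> d))"
    by (simp add: comp)
  also have "\<dots> = (\<Sum>\<mu>\<in>UNIV. ((matrix_inv \<Omega> ** \<Omega>) $ \<mu> $ \<rho>) *\<^sub>R mpderiv \<mu> d)"
    unfolding scaleR_sum_right
    by (subst sum.swap) (simp add: matrix_matrix_mult_def scaleR_sum_left mult.commute)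
  also have "\<dots> = (\<Sum>\<mu>\<in>UNIV. if \<mu> = \<rho> then mpderiv \<mu> d else 0)"
    unfolding inv by (intro sum.cong refl) (simp add: mat_def)
  finally show "mpderiv \<rho> d = 0" by (simp add: sum.delta)
qed fact

lemma ham_field_linear: "ham_field \<Omega> (a *\<^sub>R f + b *\<^sub>R g) = a *\<^sub>R ham_field \<Omega> f + b *\<^sub>R ham_field \<Omega> g"
  by (simp add: ham_field_def vec_eq_iff sum.distrib scaleR_sum_right scaleR_add_right mult.commute)

lemma lookup_ham0: "f \<in> ham0 \<Longrightarrow> lookup f 0 = 0"
  by (force simp: ham0_def in_keys_iff)

lemma ham_field_linear_eq:
  fixes f g h :: "'m::finite fun_poly"
  assumes "symplectic_form \<Omega>" "f \<in> ham0" "g \<in> ham0" "h \<in> ham0"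
    and "ham_field \<Omega> h = a *\<^sub>R ham_field \<Omega> f + b *\<^sub>R ham_field \<Omega> g"
  shows "h = a *\<^sub>R f + b *\<^sub>R g"
proof -
  have "ham_field \<Omega> (1 *\<^sub>R h + (- 1) *\<^sub>R (a *\<^sub>R f + b *\<^sub>R g)) = 0"
    unfolding ham_field_linear assms(5) by simp
  then have "1 *\<^sub>R h + (- 1) *\<^sub>R (a *\<^sub>R f + b *\<^sub>R g) = 0"
    using assms(2-4) by (intro ham_field_eq_zero[OF assms(1)]) (simp_all add: lookup_add lookup_minus lookup_ham0)
  then show ?thesis
    by (simp only: scaleR_one scaleR_minus_left add_uminus_conv_diff right_minus_eq)
qed

theorem chain_correlator_ce_equiv:
  fixes c c' :: "'m::finite fun_poly list \<Rightarrow>\<^sub>0 real"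
  assumes sympl: "symplectic_form \<Omega>" and equiv: "ce_equiv \<Omega> l c c'"
  shows "chain_correlator \<Omega> N c = chain_correlator \<Omega> N c'"
proof -
  have "chain_correlator \<Omega> N x = 0" if "x \<in> ce_relations \<Omega> l" for x
    using that unfolding ce_relations_def
  proof (elim UnE CollectE exE conjE)
    fix fs i f g h a b
    assume x: "x = single (fs[i := h]) 1 - a *\<^sub>R single (fs[i := f]) 1
        - b *\<^sub>R single (fs[i := g]) 1"
      and fs: "length fs = l" "i < l" and ham: "f \<in> ham0" "g \<in> ham0" "h \<in> ham0"
        "ham_field \<Omega> h = a *\<^sub>R ham_field \<Omega> f + b *\<^sub>R ham_field \<Omega> g"
    have h: "h = a *\<^sub>R f + b *\<^sub>R g" using ham_field_linear_eq[OF sympl ham] .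
    have "fs[i := y] = insert_at i y (take i fs @ drop (Suc i) fs)" for y
      using fs by (simp add: insert_at_def upd_conv_take_nth_drop)
    then have corr: "correlator \<Omega> N (fs[i := y]) = (-1) ^ i *\<^sub>R correlator \<Omega> N (y # take i fs @ drop (Suc i) fs)" for y
      using fs by (simp add: correlator_insert_at)
    show "chain_correlator \<Omega> N x = 0"
      unfolding x h linear_diff[OF chain_correlator_linear] linear_scale[OF chain_correlator_linear]
      by (simp add: corr correlator_linear_Cons scaleR_add_right mult.commute)
  next
    fix fs i j
    assume x: "x = single fs 1" and fs: "length fs = l" "set fs \<subseteq> ham0"
      and ij: "i < j" "j < l" "ham_field \<Omega> (fs ! i) = ham_field \<Omega> (fs ! j)"
    have "fs ! i \<in> ham0" "fs ! j \<in> ham0" using fs ij by auto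
    then have eq: "fs ! i = fs ! j"
      using ham_field_linear_eq[OF sympl, of "fs ! j" "fs ! j" "fs ! i" 1 0] ij(3) by simp
    have "fs = insert_at j (fs ! j) (insert_at i (fs ! j) (nths fs (- {i, j})))"
      using insert_at_nths(1)[of i j fs] ij fs eq by simp
    moreover have "correlator \<Omega> N (insert_at j (fs ! j) (insert_at i (fs ! j) (nths fs (- {i, j})))) = 0"
      using insert_at_nths(2)[of i j fs] ij fs by (intro correlator_repeated) auto
    ultimately show "chain_correlator \<Omega> N x = 0" unfolding x by simp
  qed
  then have "chain_correlator \<Omega> N (c - c') = 0"
    using linear_eq_0_on_span[OF chain_correlator_linear] equiv unfolding ce_equiv_def by blast
  then show ?thesis by (simp add: linear_diff[OF chain_correlator_linear])
qed

section \<open>Graph chains are determined by their polynomials\<close>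

lemma edge_prod_eq_prod_nth:
  "edge_prod ix es = (\<Prod>q<length es. case es ! q of (a, b) \<Rightarrow> t_even (ix ! (a - 1)) (ix ! (b - 1)))"
proof (induction es)
  case (Cons e es)
  then show ?case unfolding length_Cons prod.lessThan_Suc_shift by (cases e) simp
qed simp

lemma edge_prod_reorient:
  assumes "K \<subseteq> {..<length es}"
  shows "edge_prod ix (reorient \<sigma> K es) = (-1) ^ card K *\<^sub>R edge_prod ix (map (map_prod \<sigma> \<sigma>) es)"
proof -
  have "edge_prod ix (reorient \<sigma> K es) = (\<Prod>q<length es. (if q \<in> K then - 1 else 1) *
      (case map (map_prod \<sigma> \<sigma>) es ! q of (a, b) \<Rightarrow> t_even (ix ! (a - 1)) (ix ! (b - 1))))"
    unfolding edge_prod_eq_prod_nth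
  proof (rule prod.cong)
    fix q assume "q \<in> {..<length es}"
    then show "(case reorient \<sigma> K es ! q of (a, b) \<Rightarrow> t_even (ix ! (a - 1)) (ix ! (b - 1))) =
      (if q \<in> K then - 1 else 1) * (case map (map_prod \<sigma> \<sigma>) es ! q of (a, b) \<Rightarrow> t_even (ix ! (a - 1)) (ix ! (b - 1)))"
      using t_even_swap[of "ix ! (\<sigma> (snd (es ! q)) - 1)" "ix ! (\<sigma> (fst (es ! q)) - 1)"]
      by (cases "es ! q") (simp add: reorient_def)
  qed (simp add: reorient_def)
  also have "\<dots> = (\<Prod>q<length es. if q \<in> K then - 1 else 1) * edge_prod ix (map (map_prod \<sigma> \<sigma>) es)"
    unfolding prod.distrib by (simp add: edge_prod_eq_prod_nth)
  also have "(\<Prod>q<length es. if q \<in> K then - 1 else 1 :: even_poly) = (-1) ^ card K"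
    using assms by (simp add: prod.If_cases Int_absorb1 inf_absorb2 flip: prod_constant)
  also have "(-1) ^ card K * edge_prod ix (map (map_prod \<sigma> \<sigma>) es) =
      (-1) ^ card K *\<^sub>R edge_prod ix (map (map_prod \<sigma> \<sigma>) es)"
    by (cases "even (card K)") simp_all
  finally show ?thesis .
qed

lemma nth_upt_vertex: "v \<in> {1..l} \<Longrightarrow> map g [1..<Suc l] ! (v - 1) = g v"
  by (auto simp del: upt_Suc)

text \<open>Renumbering the vertices is a permutation of the summation indices, up to the order of the odd
  variables.\<close>

lemma digraph_poly_permute:
  assumes es: "set es \<subseteq> {1..l} \<times> {1..l}" and \<sigma>: "\<sigma> permutes {1..l}"
  shows "digraph_poly N l (map (map_prod \<sigma> \<sigma>) es) = real_of_int (sign \<sigma>) *\<^sub>R digraph_poly N l es"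
proof -
  define P where "P \<tau> ix = map (\<lambda>a. ix ! (\<tau> a - 1)) [1..<Suc l]" for \<tau> and ix :: "nat list"
  have in_range: "\<tau> v \<in> {1..l}" if "\<tau> permutes {1..l}" "v \<in> {1..l}" for \<tau> v
    using that permutes_in_image by metis
  have P_mem: "P \<tau> ix \<in> index_lists N l" if "\<tau> permutes {1..l}" "ix \<in> index_lists N l" for \<tau> ix
  proof -
    have "ix ! (\<tau> a - 1) \<in> set ix" if "a \<in> {1..l}" for a
      using in_range[OF \<open>\<tau> permutes {1..l}\<close> that] \<open>ix \<in> index_lists N l\<close> by (intro nth_mem) (auto simp: index_lists_def)
    then show ?thesis using that(2) unfolding P_def index_lists_def by (auto simp del: upt_Suc)
  qed
  have P_P: "P \<tau> (P \<tau>' ix) = ix" if "\<tau> permutes {1..l}" "\<And>a. \<tau>' (\<tau> a) = a" "ix \<in> index_lists N l" for \<tau> \<tau>' ix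
  proof (rule nth_equalityI)
    show "length (P \<tau> (P \<tau>' ix)) = length ix" using that(3) by (simp add: P_def index_lists_def del: upt_Suc)
    fix c assume "c < length (P \<tau> (P \<tau>' ix))"
    then have c: "Suc c \<in> {1..l}" by (simp add: P_def del: upt_Suc)
    then have "P \<tau> (P \<tau>' ix) ! c = P \<tau>' ix ! (\<tau> (Suc c) - 1)"
      using nth_upt_vertex[OF c, of "\<lambda>a. P \<tau>' ix ! (\<tau> a - 1)"] by (simp add: P_def del: upt_Suc)
    also have "\<dots> = ix ! c"
      using nth_upt_vertex[OF in_range[OF that(1) c], of "\<lambda>a. ix ! (\<tau>' a - 1)"] that(2) by (simp add: P_def del: upt_Suc)
    finally show "P \<tau> (P \<tau>' ix) ! c = ix ! c" .
  qed
  have word: "odd_word ix = real_of_int (sign \<sigma>) *\<^sub>R odd_word (P \<sigma> ix)" if "ix \<in> index_lists N l" for ix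
  proof -
    have "ix = map (\<lambda>a. ix ! (a - 1)) [1..<Suc l]"
      using that by (intro nth_equalityI) (auto simp: index_lists_def simp del: upt_Suc)
    then have "odd_word (P \<sigma> ix) = real_of_int (sign \<sigma>) *\<^sub>R odd_word ix"
      unfolding P_def using odd_word_permute[OF \<sigma>, of "\<lambda>a. ix ! (a - 1)"] by simp
    moreover have "real_of_int (sign \<sigma>) * real_of_int (sign \<sigma>) = 1"
      by (simp flip: of_int_mult)
    ultimately show ?thesis by simp
  qed
  have edges: "edge_prod ix (map (map_prod \<sigma> \<sigma>) es) = edge_prod (P \<sigma> ix) es" for ix
    using es
  proof (induction es)
    case (Cons e es)
    obtain a b where e: "e = (a, b)" by (cases e)
    have ab: "a \<in> {1..l}" "b \<in> {1..l}" using Cons.prems e by auto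
    have "P \<sigma> ix ! (a - 1) = ix ! (\<sigma> a - 1)" "P \<sigma> ix ! (b - 1) = ix ! (\<sigma> b - 1)"
      unfolding P_def by (rule nth_upt_vertex[OF ab(1)], rule nth_upt_vertex[OF ab(2)])
    then show ?case using Cons by (simp add: e)
  qed simp
  have inv: "inv \<sigma> permutes {1..l}" "\<And>a. inv \<sigma> (\<sigma> a) = a" "\<And>a. \<sigma> (inv \<sigma> a) = a"
    using \<sigma> permutes_inv permutes_inverses by (blast, metis, metis)
  have "digraph_poly N l (map (map_prod \<sigma> \<sigma>) es) =
      (\<Sum>ix\<in>index_lists N l. real_of_int (sign \<sigma>) *\<^sub>R (odd_word (P \<sigma> ix) * even_part (edge_prod (P \<sigma> ix) es)))"
    unfolding digraph_poly_eq_index_sum index_sum_def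
    by (intro sum.cong refl) (subst word, assumption, simp add: edges)
  also have "\<dots> = (\<Sum>ix\<in>index_lists N l. real_of_int (sign \<sigma>) *\<^sub>R (odd_word ix * even_part (edge_prod ix es)))"
    by (rule sum.reindex_bij_witness[where i = "P (inv \<sigma>)" and j = "P \<sigma>"])
      (auto intro!: P_mem P_P \<sigma> inv)
  also have "\<dots> = real_of_int (sign \<sigma>) *\<^sub>R digraph_poly N l es"
    by (simp add: digraph_poly_eq_index_sum index_sum_def scaleR_sum_right)
  finally show ?thesis .
qed

lemma graph_poly_relation:
  assumes "x \<in> graph_relations l"
  shows "graph_poly N l x = 0"
proof -
  obtain es es' \<sigma> K where x: "x = single es' 1 -
      ((-1) ^ card K * real_of_int (sign \<sigma>)) *\<^sub>R single es 1"
    and es: "set es \<subseteq> {1..l} \<times> {1..l}" "\<sigma> permutes {1..l}" "K \<subseteq> {..<length es}" "mset es' = mset (reorient \<sigma> K es)"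
    using assms unfolding graph_relations_def by blast
  have "digraph_poly N l es' = (-1) ^ card K *\<^sub>R digraph_poly N l (map (map_prod \<sigma> \<sigma>) es)"
    unfolding digraph_poly_eq_index_sum index_sum_scaleR[symmetric]
    using edge_prod_mset[OF es(4)] edge_prod_reorient[OF es(3)] by simp
  then show ?thesis
    unfolding x linear_diff[OF graph_poly_linear] linear_scale[OF graph_poly_linear]
    using digraph_poly_permute[OF es(1,2), of N] by simp
qed

text \<open>Monomials in the even variables correspond to multisets of upward edges; for each monomial one
  word with these edges is chosen.\<close>

definition edge_mon :: "digraph \<Rightarrow> (nat \<times> nat \<Rightarrow>\<^sub>0 nat)" where
  "edge_mon es = (\<Sum>e\<leftarrow>es. single e 1)"

definition word_of_mon :: "(nat \<times> nat \<Rightarrow>\<^sub>0 nat) \<Rightarrow> digraph" where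
  "word_of_mon m = (SOME es. edge_mon es = m)"

definition graph_of_poly :: "even_poly \<Rightarrow> (digraph \<Rightarrow>\<^sub>0 real)" where
  "graph_of_poly = lin_ext (\<lambda>m. single (word_of_mon m) 1)"

lemma lookup_edge_mon: "lookup (edge_mon es) e = count (mset es) e"
  by (induction es) (auto simp: edge_mon_def lookup_add lookup_single when_def)

lemma mset_word_of_mon: "mset (word_of_mon (edge_mon es)) = mset es"
proof -
  have "edge_mon (word_of_mon (edge_mon es)) = edge_mon es"
    unfolding word_of_mon_def by (rule someI) (rule refl)
  then show ?thesis by (intro multiset_eqI) (metis lookup_edge_mon)
qed

lemma linear_graph_of_poly: "linear graph_of_poly"
  unfolding graph_of_poly_def by (rule linear_lin_ext)

lemma edge_prod_upward_word:
  "set es \<subseteq> edge_pairs l \<Longrightarrow> edge_prod [1..<Suc l] es = single (edge_mon es) 1"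
proof (induction es)
  case Nil
  show ?case by (simp add: edge_mon_def)
next
  case (Cons e es)
  obtain a b where e: "e = (a, b)" by (cases e)
  then have ab: "1 \<le> a" "a < b" "b \<le> l" using Cons.prems by (auto simp: mem_edge_pairs)
  then have "[1..<Suc l] ! (a - 1) = a" "[1..<Suc l] ! (b - 1) = b" by (simp_all del: upt_Suc)
  then show ?case using Cons ab by (simp add: e t_even_def mvar_def mult_single edge_mon_def del: upt_Suc)
qed

text \<open>Reversing the loop gives the same word with the opposite orientation.\<close>

lemma graph_relations_loop:
  assumes es: "set es \<subseteq> {1..l} \<times> {1..l}" and loop: "(a, a) \<in> set es"
  shows "single es 1 \<in> span (graph_relations l)"
proof -
  obtain q where q: "q < length es" "es ! q = (a, a)" using loop by (auto simp: in_set_conv_nth)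
  have "reorient id {q} es = es"
    using q by (intro nth_equalityI) (auto simp: reorient_def split: prod.split)
  then have "single es 1 - ((-1) ^ card {q} * real_of_int (sign (id :: nat \<Rightarrow> nat))) *\<^sub>R single es 1
      \<in> graph_relations l"
    unfolding graph_relations_def using es q permutes_id by fastforce
  then have "single es 1 + single es 1 \<in> span (graph_relations l)"
    by (intro span_base) (simp add: sign_id)
  from span_scale[OF this, of "1 / 2"] show ?thesis by (simp flip: scaleR_2)
qed

text \<open>The monomial records the edges directed upwards; the sign with which it occurs is the sign by
  which this orientation, after renumbering by \<open>\<sigma>\<close>, differs from the given one.\<close>

lemma graph_of_poly_edge_prod:
  assumes es: "set es \<subseteq> {1..l} \<times> {1..l}" and \<sigma>: "\<sigma> permutes {1..l}"
  shows "real_of_int (sign \<sigma>) *\<^sub>R graph_of_poly (edge_prod [1..<Suc l] (map (map_prod \<sigma> \<sigma>) es)) -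
    single es 1 \<in> span (graph_relations l)"
proof (cases "\<exists>a. (a, a) \<in> set es")
  case True
  then obtain a where a: "(a, a) \<in> set es" by blast
  then have "edge_prod [1..<Suc l] (map (map_prod \<sigma> \<sigma>) es) = 0"
    by (induction es) (auto simp del: upt_Suc)
  then show ?thesis using graph_relations_loop[OF es a] linear_0[OF linear_graph_of_poly] span_neg
    by (simp del: upt_Suc)
next
  case False
  define es' where "es' = map (map_prod \<sigma> \<sigma>) es"
  define K where "K = {q. q < length es \<and> snd (es' ! q) < fst (es' ! q)}"
  define s where "s = (-1) ^ card K * real_of_int (sign \<sigma>)"
  have K: "K \<subseteq> {..<length es}" by (auto simp: K_def)
  have reor: "reorient \<sigma> K es = upward es'"
  proof (rule nth_equalityI)
    show "length (reorient \<sigma> K es) = length (upward es')" by (simp add: reorient_def upward_def es'_def)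
    fix q assume "q < length (reorient \<sigma> K es)"
    then show "reorient \<sigma> K es ! q = upward es' ! q"
      by (cases "es ! q") (auto simp: reorient_def upward_def es'_def K_def)
  qed
  have up: "set (upward es') \<subseteq> edge_pairs l"
  proof
    fix e assume "e \<in> set (upward es')"
    then obtain a b where ab: "(a, b) \<in> set es" "e = (min (\<sigma> a) (\<sigma> b), max (\<sigma> a) (\<sigma> b))"
      by (auto simp: upward_def es'_def)
    then have "a \<in> {1..l}" "b \<in> {1..l}" "a \<noteq> b" using es False by auto
    then have "\<sigma> a \<in> {1..l}" "\<sigma> b \<in> {1..l}" "\<sigma> a \<noteq> \<sigma> b"
      using permutes_in_image[OF \<sigma>] permutes_inj[OF \<sigma>] by (blast, blast, metis injD)
    then show "e \<in> edge_pairs l" using ab(2) by (auto simp: mem_edge_pairs)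
  qed
  let ?w = "word_of_mon (edge_mon (upward es'))"
  have "single (edge_mon (upward es')) 1 = (-1) ^ card K *\<^sub>R edge_prod [1..<Suc l] es'"
    using edge_prod_reorient[OF K, of "[1..<Suc l]" \<sigma>] edge_prod_upward_word[OF up]
    by (simp only: reor flip: es'_def)
  then have "graph_of_poly ((-1) ^ card K *\<^sub>R edge_prod [1..<Suc l] es') = single ?w 1"
    by (metis graph_of_poly_def lin_ext_single scaleR_one)
  then have img: "(-1) ^ card K *\<^sub>R graph_of_poly (edge_prod [1..<Suc l] es') = single ?w 1"
    by (simp only: linear_scale[OF linear_graph_of_poly])
  have sq: "(-1) ^ card K * (-1) ^ card K = (1 :: real)" "real_of_int (sign \<sigma>) * real_of_int (sign \<sigma>) = 1"
    by (simp_all flip: of_int_mult power_mult_distrib)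
  have "mset ?w = mset (reorient \<sigma> K es)" unfolding reor by (rule mset_word_of_mon)
  then have "single ?w 1 - s *\<^sub>R single es 1 \<in> graph_relations l"
    unfolding graph_relations_def s_def using es \<sigma> K by blast
  from span_scale[OF span_base[OF this], of s]
  have "s *\<^sub>R single ?w 1 - (s * s) *\<^sub>R single es 1 \<in> span (graph_relations l)"
    by (simp only: scaleR_diff_right scaleR_scaleR)
  moreover have "s * s = 1"
  proof -
    have "s * s = ((-1) ^ card K * (-1) ^ card K) * (real_of_int (sign \<sigma>) * real_of_int (sign \<sigma>))"
      unfolding s_def by (simp only: mult_ac)
    then show ?thesis by (simp only: sq mult_1)
  qed
  moreover have "s *\<^sub>R single ?w 1 = real_of_int (sign \<sigma>) *\<^sub>R graph_of_poly (edge_prod [1..<Suc l] es')"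
  proof -
    have "s * (-1) ^ card K = real_of_int (sign \<sigma>) * ((-1) ^ card K * (-1) ^ card K)"
      unfolding s_def by (simp only: mult_ac)
    then have "s * (-1) ^ card K = real_of_int (sign \<sigma>)" by (simp only: sq mult_1_right)
    then show ?thesis unfolding img[symmetric] scaleR_scaleR by simp
  qed
  ultimately show ?thesis by (simp add: es'_def del: upt_Suc)
qed

lemma bij_betw_permutations_lists:
  "bij_betw (\<lambda>\<sigma>. map \<sigma> [1..<Suc l]) {\<sigma>. \<sigma> permutes {1..l}} {ix. length ix = l \<and> set ix = {1..l}}"
proof (rule bij_betwI[where g = "\<lambda>ix a. if a \<in> {1..l} then ix ! (a - 1) else a"], goal_cases)
  case 1
  have "set (map \<sigma> [1..<Suc l]) = \<sigma> ` {1..l}" for \<sigma> :: "nat \<Rightarrow> nat"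
    by (simp add: atLeastLessThanSuc_atLeastAtMost del: upt_Suc)
  then show ?case by (auto simp: permutes_image simp del: upt_Suc)
next
  case 2
  show ?case
  proof
    fix ix :: "nat list" assume "ix \<in> {ix. length ix = l \<and> set ix = {1..l}}"
    then have ix: "length ix = l" "set ix = {1..l}" by auto
    let ?\<sigma> = "\<lambda>a. if a \<in> {1..l} then ix ! (a - 1) else a"
    have dist: "distinct ix" using ix by (intro card_distinct) simp
    have "bij_betw ?\<sigma> {1..l} {1..l}"
    proof (rule bij_betw_imageI)
      show "inj_on ?\<sigma> {1..l}"
        using dist ix by (auto simp: inj_on_def nth_eq_iff_index_eq)
      have "?\<sigma> ` {1..l} = (\<lambda>c. ix ! c) ` {..<l}"
        by (force simp: image_iff Bex_def intro!: exI[of _ "Suc _"])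
      also have "\<dots> = {1..l}" using ix by (auto simp: set_conv_nth)
      finally show "?\<sigma> ` {1..l} = {1..l}" .
    qed
    then show "?\<sigma> \<in> {\<sigma>. \<sigma> permutes {1..l}}" by (intro CollectI bij_imp_permutes) auto
  qed
next
  case (3 \<sigma>)
  then show ?case by (auto simp: fun_eq_iff nth_upt_vertex permutes_not_in simp del: upt_Suc)
next
  case (4 ix)
  then show ?case by (intro nth_equalityI) (auto simp: simp del: upt_Suc)
qed

lemma lookup_digraph_poly_vertices:
  assumes "l \<le> N" and es: "set es \<subseteq> {1..l} \<times> {1..l}"
  shows "lookup (gcoeffs (digraph_poly N l es)) (fset_of_list [1..<Suc l]) =
    (\<Sum>\<sigma> | \<sigma> permutes {1..l}. real_of_int (sign \<sigma>) *\<^sub>R edge_prod [1..<Suc l] (map (map_prod \<sigma> \<sigma>) es))"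
proof -
  let ?A = "fset_of_list [1..<Suc l]"
  have A: "fset ?A = {1..l}" by (simp add: fset_of_list.rep_eq atLeastLessThanSuc_atLeastAtMost del: upt_Suc)
  have "lookup (gcoeffs (digraph_poly N l es)) ?A =
      (\<Sum>ix\<in>index_lists N l. lookup (gcoeffs (odd_word ix)) ?A * edge_prod ix es)"
    by (simp add: digraph_poly_eq_index_sum index_sum_def gcoeffs_sum lookup_sum lookup_mult_even_part del: upt_Suc)
  also have "\<dots> = (\<Sum>ix | length ix = l \<and> set ix = {1..l}.
      lookup (gcoeffs (odd_word ix)) ?A * edge_prod ix es)"
  proof (rule sum.mono_neutral_right)
    show "{ix. length ix = l \<and> set ix = {1..l}} \<subseteq> index_lists N l" using assms(1) by (auto simp: index_lists_def)
    show "\<forall>ix\<in>index_lists N l - {ix. length ix = l \<and> set ix = {1..l}}.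
        lookup (gcoeffs (odd_word ix)) ?A * edge_prod ix es = 0"
    proof
      fix ix assume ix: "ix \<in> index_lists N l - {ix. length ix = l \<and> set ix = {1..l}}"
      then have "fset ?A \<noteq> set ix" unfolding A by (auto simp: index_lists_def)
      from lookup_odd_word_eq_zero[OF this]
      show "lookup (gcoeffs (odd_word ix)) ?A * edge_prod ix es = 0" by simp
    qed
  qed simp
  also have "\<dots> = (\<Sum>\<sigma> | \<sigma> permutes {1..l}.
      lookup (gcoeffs (odd_word (map \<sigma> [1..<Suc l]))) ?A * edge_prod (map \<sigma> [1..<Suc l]) es)"
    by (rule sum.reindex_bij_betw[OF bij_betw_permutations_lists, symmetric])
  also have "\<dots> = (\<Sum>\<sigma> | \<sigma> permutes {1..l}. real_of_int (sign \<sigma>) *\<^sub>R edge_prod [1..<Suc l] (map (map_prod \<sigma> \<sigma>) es))"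
  proof (rule sum.cong[OF refl])
    fix \<sigma> assume "\<sigma> \<in> {\<sigma>. \<sigma> permutes {1..l}}"
    then have \<sigma>: "\<sigma> permutes {1..l}" by simp
    have "odd_word (map \<sigma> [1..<Suc l]) = real_of_int (sign \<sigma>) *\<^sub>R odd_word [1..<Suc l]"
      using odd_word_permute[OF \<sigma>, of id] by (simp del: upt_Suc)
    then have word: "lookup (gcoeffs (odd_word (map \<sigma> [1..<Suc l]))) ?A = real_of_int (sign \<sigma>) *\<^sub>R 1"
      using lookup_odd_word_sorted[of "[1..<Suc l]"] by (simp add: gcoeffs_scaleR del: upt_Suc)
    have "edge_prod (map \<sigma> [1..<Suc l]) es = edge_prod [1..<Suc l] (map (map_prod \<sigma> \<sigma>) es)"
      using es
    proof (induction es)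
      case (Cons e es)
      obtain a b where e: "e = (a, b)" by (cases e)
      have ab: "a \<in> {1..l}" "b \<in> {1..l}" using Cons.prems e by auto
      then have \<sigma>ab: "\<sigma> a \<in> {1..l}" "\<sigma> b \<in> {1..l}" using permutes_in_image[OF \<sigma>] by blast+
      have "[1..<Suc l] ! (\<sigma> a - 1) = \<sigma> a" "[1..<Suc l] ! (\<sigma> b - 1) = \<sigma> b"
        using nth_upt_vertex[OF \<sigma>ab(1), of id] nth_upt_vertex[OF \<sigma>ab(2), of id] by (simp_all del: upt_Suc)
      then show ?case
        using Cons nth_upt_vertex[OF ab(1), of \<sigma>] nth_upt_vertex[OF ab(2), of \<sigma>] by (simp add: e del: upt_Suc)
    qed simp
    then show "lookup (gcoeffs (odd_word (map \<sigma> [1..<Suc l]))) ?A * edge_prod (map \<sigma> [1..<Suc l]) es =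
        real_of_int (sign \<sigma>) *\<^sub>R edge_prod [1..<Suc l] (map (map_prod \<sigma> \<sigma>) es)"
      unfolding word by simp
  qed
  finally show ?thesis .
qed

text \<open>The coefficient of \<open>t\<^sub>1 \<cdots> t\<^sub>l\<close> is a sum over the numberings of the vertices. Reading its monomials
  as graphs, each of the \<open>l!\<close> numberings gives back the chain modulo the relations.\<close>

lemma graph_poly_eq_zero_imp:
  assumes "l \<le> N" "\<gamma> \<in> graph_chains l" "graph_poly N l \<gamma> = 0"
  shows "\<gamma> \<in> span (graph_relations l)"
proof -
  let ?K = "keys \<gamma>" and ?c = "lookup \<gamma>"
  let ?S = "{\<sigma>. \<sigma> permutes {1..l}}"
  let ?g = "\<lambda>\<sigma> es. real_of_int (sign \<sigma>) *\<^sub>R graph_of_poly (edge_prod [1..<Suc l] (map (map_prod \<sigma> \<sigma>) es))"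
  have es: "set es \<subseteq> {1..l} \<times> {1..l}" if "es \<in> ?K" for es using assms(2) that by (auto simp: graph_chains_def)
  have "0 = graph_of_poly (lookup (gcoeffs (graph_poly N l \<gamma>)) (fset_of_list [1..<Suc l]))"
    by (simp add: assms(3) zero_grassmann.rep_eq linear_0[OF linear_graph_of_poly] del: upt_Suc)
  also have "\<dots> = graph_of_poly (\<Sum>es\<in>?K. ?c es *\<^sub>R
      lookup (gcoeffs (digraph_poly N l es)) (fset_of_list [1..<Suc l]))"
    by (simp add: graph_poly_def lin_ext_def gcoeffs_sum gcoeffs_scaleR lookup_sum del: upt_Suc)
  also have "\<dots> = graph_of_poly (\<Sum>es\<in>?K. ?c es *\<^sub>R
      (\<Sum>\<sigma>\<in>?S. real_of_int (sign \<sigma>) *\<^sub>R edge_prod [1..<Suc l] (map (map_prod \<sigma> \<sigma>) es)))"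
    using es by (intro arg_cong[where f = graph_of_poly] sum.cong refl arg_cong2[where f = scaleR]
        lookup_digraph_poly_vertices[OF assms(1)])
  also have "\<dots> = (\<Sum>es\<in>?K. ?c es *\<^sub>R (\<Sum>\<sigma>\<in>?S. ?g \<sigma> es))"
    by (simp only: linear_sum[OF linear_graph_of_poly] linear_scale[OF linear_graph_of_poly])
  finally have zero: "(\<Sum>es\<in>?K. ?c es *\<^sub>R (\<Sum>\<sigma>\<in>?S. ?g \<sigma> es)) = 0" by simp
  have "(\<Sum>es\<in>?K. ?c es *\<^sub>R (\<Sum>\<sigma>\<in>?S. ?g \<sigma> es - single es 1)) \<in> span (graph_relations l)"
    using es by (intro span_sum span_scale graph_of_poly_edge_prod) auto
  also have "(\<Sum>es\<in>?K. ?c es *\<^sub>R (\<Sum>\<sigma>\<in>?S. ?g \<sigma> es - single es 1)) =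
      (\<Sum>es\<in>?K. ?c es *\<^sub>R (\<Sum>\<sigma>\<in>?S. ?g \<sigma> es)) - (\<Sum>es\<in>?K. real (card ?S) *\<^sub>R (?c es *\<^sub>R single es 1))"
    unfolding sum_subtractf[symmetric]
    by (intro sum.cong refl) (simp only: sum_subtractf sum_constant_scaleR scaleR_diff_right scaleR_scaleR mult.commute)
  also have "\<dots> = - (real (fact l) *\<^sub>R \<gamma>)"
  proof -
    have "card ?S = fact l" by (rule card_permutations) simp_all
    moreover have "(\<Sum>es\<in>?K. ?c es *\<^sub>R single es 1) = \<gamma>"
      using poly_mapping_eq_sum_single[of \<gamma>] by (simp add: scaleR_single)
    ultimately show ?thesis unfolding zero scaleR_sum_right[symmetric] by simp
  qed
  finally have "- (real (fact l) *\<^sub>R \<gamma>) \<in> span (graph_relations l)" .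
  from span_scale[OF this, of "- (1 / real (fact l))"] show ?thesis by simp
qed

theorem graph_poly_eq_iff:
  assumes "l \<le> N" "\<gamma> \<in> graph_chains l" "\<gamma>' \<in> graph_chains l"
  shows "graph_poly N l \<gamma> = graph_poly N l \<gamma>' \<longleftrightarrow> graph_equiv l \<gamma> \<gamma>'"
proof -
  have "\<gamma> - \<gamma>' \<in> graph_chains l"
    using assms(2,3) keys_diff[of \<gamma> \<gamma>'] unfolding graph_chains_def by blast
  then have "graph_poly N l (\<gamma> - \<gamma>') = 0 \<longleftrightarrow> \<gamma> - \<gamma>' \<in> span (graph_relations l)"
    using graph_poly_eq_zero_imp[OF assms(1)]
      linear_eq_0_on_span[OF graph_poly_linear, of "graph_relations l" N l] graph_poly_relation by blast
  then show ?thesis by (simp add: graph_equiv_def linear_diff[OF graph_poly_linear])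
qed

section \<open>The map from Chevalley--Eilenberg chains to graph chains\<close>

text \<open>The words with more edges than the total degree have coefficient 0.\<close>

definition wick_graph :: "real^'m^'m \<Rightarrow> 'm::finite fun_poly list \<Rightarrow> (digraph \<Rightarrow>\<^sub>0 real)" where
  "wick_graph \<Omega> fs = (\<Sum>k\<le>total_degree fs. \<Sum>es\<in>edge_words (length fs) k.
    single es (graph_coeff \<Omega> es fs / fact k))"

lemma graph_chains_sum:
  "(\<And>x. x \<in> S \<Longrightarrow> f x \<in> graph_chains l) \<Longrightarrow> sum f S \<in> graph_chains l"
  using keys_sum[of f S] unfolding graph_chains_def by blast

lemma graph_chains_scaleR: "\<gamma> \<in> graph_chains l \<Longrightarrow> r *\<^sub>R \<gamma> \<in> graph_chains l"
  by (auto simp: graph_chains_def in_keys_iff)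

lemma graph_chains_single: "set es \<subseteq> {1..l} \<times> {1..l} \<Longrightarrow> single es r \<in> graph_chains l"
  by (auto simp: graph_chains_def)

lemma wick_graph_mem: "wick_graph \<Omega> fs \<in> graph_chains (length fs)"
  unfolding wick_graph_def
  by (intro graph_chains_sum graph_chains_single) (auto simp: edge_words_def mem_edge_pairs)

lemma correlator_eq_graph_poly:
  fixes fs :: "'m::finite fun_poly list"
  assumes "symplectic_form \<Omega>"
  shows "correlator \<Omega> N fs = graph_poly N (length fs) (wick_graph \<Omega> fs)"
proof -
  have "correlator \<Omega> N fs = index_sum N (length fs) (\<lambda>ix. \<Sum>k\<le>total_degree fs. \<Sum>es\<in>edge_words (length fs) k.
      (graph_coeff \<Omega> es fs / fact k) *\<^sub>R edge_prod ix es)"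
    unfolding correlator_eq_index_sum
    using wick_coeff_expansion[OF assms] by (intro index_sum_cong) simp
  also have "\<dots> = graph_poly N (length fs) (wick_graph \<Omega> fs)"
    unfolding wick_graph_def linear_sum[OF graph_poly_linear] graph_poly_single digraph_poly_eq_index_sum
      index_sum_sum index_sum_scaleR ..
  finally show ?thesis .
qed

lemma correlator_multigraphs:
  fixes fs :: "'m::finite fun_poly list"
  assumes "symplectic_form \<Omega>" "length fs = l" "\<And>G. G \<in> multigraphs l \<Longrightarrow> underlying (dir G) = G"
  shows "correlator \<Omega> N fs = (\<Sum>G | G \<in> multigraphs l \<and> graph_coeff \<Omega> (dir G) fs \<noteq> 0.
    (graph_coeff \<Omega> (dir G) fs / real (parallel_factor l G)) *\<^sub>R digraph_poly N l (dir G))"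
  unfolding digraph_poly_eq_index_sum index_sum_scaleR[symmetric] index_sum_sum[symmetric]
    correlator_eq_index_sum assms(2)
  using wick_coeff_multigraphs(2)[OF assms] by (intro index_sum_cong) simp

lemma chain_correlator_eq_graph_poly:
  fixes c :: "'m::finite fun_poly list \<Rightarrow>\<^sub>0 real"
  assumes "symplectic_form \<Omega>" "c \<in> ce_chains l"
  shows "\<exists>\<gamma>\<in>graph_chains l. chain_correlator \<Omega> N c = graph_poly N l \<gamma>"
proof
  let ?\<gamma> = "\<Sum>fs\<in>keys c. lookup c fs *\<^sub>R wick_graph \<Omega> fs"
  have len: "length fs = l" if "fs \<in> keys c" for fs using assms(2) that by (auto simp: ce_chains_def)
  show "?\<gamma> \<in> graph_chains l"
    using len wick_graph_mem by (intro graph_chains_sum graph_chains_scaleR) blast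
  show "chain_correlator \<Omega> N c = graph_poly N l ?\<gamma>"
    unfolding linear_sum[OF graph_poly_linear] linear_scale[OF graph_poly_linear] chain_correlator_def lin_ext_def
    using len by (intro sum.cong refl) (simp add: correlator_eq_graph_poly[OF assms(1)])
qed

theorem theorem6p1:
  fixes \<Omega> :: "real^'m::finite^'m" and n N l :: nat
  assumes "CARD('m) = 2 * n" and "symplectic_form \<Omega>" and "1 \<le> l" and "l \<le> N"
  shows
    "\<comment> \<open>identification of graph chains with polynomials\<close>
     (\<forall>\<gamma>\<in>graph_chains l. \<forall>\<gamma>'\<in>graph_chains l.
        graph_poly N l \<gamma> = graph_poly N l \<gamma>' \<longleftrightarrow> graph_equiv l \<gamma> \<gamma>') \<and>
     \<comment> \<open>part 1\<close>
     (\<forall>fs :: 'm fun_poly list. length fs = l \<longrightarrow>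
        (\<exists>\<gamma>\<in>graph_chains l. correlator \<Omega> N fs = graph_poly N l \<gamma>)) \<and>
     (\<forall>c\<in>ce_chains l. \<exists>\<gamma>\<in>graph_chains l. chain_correlator \<Omega> N c = graph_poly N l \<gamma>) \<and>
     (\<forall>c\<in>ce_chains l. \<forall>c'\<in>ce_chains l.
        ce_equiv \<Omega> l c c' \<longrightarrow> chain_correlator \<Omega> N c = chain_correlator \<Omega> N c') \<and>
     (\<forall>(fs :: 'm fun_poly list) (dir :: nat set multiset \<Rightarrow> digraph).
        length fs = l \<and> (\<forall>G\<in>multigraphs l. underlying (dir G) = G) \<longrightarrow>
        finite {G\<in>multigraphs l. graph_coeff \<Omega> (dir G) fs \<noteq> 0} \<and>
        correlator \<Omega> N fs =
          (\<Sum>G | G \<in> multigraphs l \<and> graph_coeff \<Omega> (dir G) fs \<noteq> 0.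
             (graph_coeff \<Omega> (dir G) fs / real (parallel_factor l G)) *\<^sub>R digraph_poly N l (dir G))) \<and>
     \<comment> \<open>part 2\<close>
     (\<forall>\<gamma>\<in>graph_chains l.
        graph_poly N (l - 1) (graph_diff \<gamma>) = graph_diff_op N l (graph_poly N l \<gamma>)) \<and>
     \<comment> \<open>part 3\<close>
     (\<forall>c :: 'm fun_poly list \<Rightarrow>\<^sub>0 real. (\<forall>fs\<in>Poly_Mapping.keys c. length fs = l) \<longrightarrow>
        chain_correlator \<Omega> N (ce_diff \<Omega> c) = graph_diff_op N l (chain_correlator \<Omega> N c))"
proof (intro conjI ballI allI impI)
  note sympl = assms(2) and l = assms(3,4)
  show "graph_poly N l \<gamma> = graph_poly N l \<gamma>' \<longleftrightarrow> graph_equiv l \<gamma> \<gamma>'"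
    if "\<gamma> \<in> graph_chains l" "\<gamma>' \<in> graph_chains l" for \<gamma> \<gamma>'
    using graph_poly_eq_iff[OF l(2) that] .
  show "\<exists>\<gamma>\<in>graph_chains l. correlator \<Omega> N fs = graph_poly N l \<gamma>" if "length fs = l" for fs :: "'m fun_poly list"
    using correlator_eq_graph_poly[OF sympl, of N fs] wick_graph_mem[of \<Omega> fs] that by blast
  show "\<exists>\<gamma>\<in>graph_chains l. chain_correlator \<Omega> N c = graph_poly N l \<gamma>" if "c \<in> ce_chains l"
    for c :: "'m fun_poly list \<Rightarrow>\<^sub>0 real"
    using chain_correlator_eq_graph_poly[OF sympl that] .
  show "chain_correlator \<Omega> N c = chain_correlator \<Omega> N c'" if "ce_equiv \<Omega> l c c'" for c c' :: "'m fun_poly list \<Rightarrow>\<^sub>0 real"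
    using chain_correlator_ce_equiv[OF sympl that] .
  show "finite {G\<in>multigraphs l. graph_coeff \<Omega> (dir G) fs \<noteq> 0}"
    "correlator \<Omega> N fs = (\<Sum>G | G \<in> multigraphs l \<and> graph_coeff \<Omega> (dir G) fs \<noteq> 0.
             (graph_coeff \<Omega> (dir G) fs / real (parallel_factor l G)) *\<^sub>R digraph_poly N l (dir G))"
    if "length fs = l \<and> (\<forall>G\<in>multigraphs l. underlying (dir G) = G)" for fs :: "'m fun_poly list" and dir
    using that wick_coeff_multigraphs(1)[OF sympl, of fs l dir] correlator_multigraphs[OF sympl, of fs l dir N] by blast+
  show "graph_poly N (l - 1) (graph_diff \<gamma>) = graph_diff_op N l (graph_poly N l \<gamma>)" if "\<gamma> \<in> graph_chains l" for \<gamma>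
    using graph_poly_graph_diff[OF l that] .
  show "chain_correlator \<Omega> N (ce_diff \<Omega> c) = graph_diff_op N l (chain_correlator \<Omega> N c)"
    if "\<forall>fs\<in>Poly_Mapping.keys c. length fs = l" for c :: "'m fun_poly list \<Rightarrow>\<^sub>0 real"
    using graph_diff_op_chain_correlator[OF sympl l] that by blast
qed

end
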